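(* Consider the monocular global-shutter camera-IMU system with self-calibration observing one unknown point landmark: the input-affine system $\dot{\mathbf x}=\mathbf f_0(\mathbf x)+\mathbf f_1(\mathbf x)\mathbf a_m+\mathbf f_2(\mathbf x)\boldsymbol\omega_m$ on the 54-dimensional state $\mathbf x$ described in the context, with outputs $\mathbf h_1$ (distorted pinhole image observation of the landmark), $h_2$ (squared gravity magnitude) and $h_3$ (squared quaternion norm), and with the inputs $\mathbf a_m,\boldsymbol\omega_m\in\mathbb R^3$ unconstrained (general motion). Then: (i) The eight camera intrinsic parameters $f_x,f_y,c_x,c_y,k_1,k_2,p_1,p_2$ are weakly observable, already from the second-order codistribution: the unit covectors $\nabla f_x,\nabla f_y,\nabla c_x,\nabla c_y,\nabla k_1,\nabla k_2,\nabla p_1,\nabla p_2$ belong to $\mathcal O_2$ of this system. (ii) For the reduced system obtained by deleting these eight parameters from the state, giving $\mathbf x'$ with $\dim \mathbf x'=46$, and replacing $\mathbf h_1$ by $\mathbf h_1'=\boldsymbol\gamma$ (keeping $h_2,h_3$ and the same dynamics), the third-order codistribution has full rank, $\operatorname{rank}(\mathcal O_3)=46=\dim(\mathbf x')$; hence the reduced system is weakly observable. Consequently all components of $\mathbf x$, i.e. the landmark direction and inverse depth, the body-frame velocity and gravity, the IMU biases $\mathbf b_g,\mathbf b_a$, the IMU intrinsic matrices $\mathbf M_g,\mathbf T_s,\mathbf M_a$, the camera extrinsic parameters $\mathbf p_{CB},\mathbf q_{CB}$ and the camera intrinsic parameters, are weakly observable under general motion.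
   Context: State. $\mathbf x=\{\boldsymbol\gamma,\rho,\mathbf v^B,\mathbf g^B,\mathbf b_g,\mathbf b_a,\mathbf M_g,\mathbf T_s,\mathbf M_a,\mathbf p_{CB},\mathbf q_{CB},f_x,f_y,c_x,c_y,k_1,k_2,p_1,p_2\}$, where $\boldsymbol\gamma=[\gamma_1,\gamma_2]^{\mathsf T}\in\mathbb R^2$, $\rho\in\mathbb R$ (direction and inverse depth of the landmark in the camera frame $C$: if the landmark has coordinates $(p_x,p_y,p_z)$ in $C$, then $\boldsymbol\gamma=[p_x/p_z,p_y/p_z]^{\mathsf T}$, $\rho=1/p_z$), $\mathbf v^B,\mathbf g^B,\mathbf b_g,\mathbf b_a\in\mathbb R^3$ (velocity and gravity in the body frame $B$, gyroscope and accelerometer biases), $\mathbf M_g,\mathbf T_s\in\mathbb R^{3\times3}$ arbitrary (9 entries each), $\mathbf M_a\in\mathbb R^{3\times 3}$ lower triangular (6 entries), $\mathbf p_{CB}\in\mathbb R^3$, $\mathbf q_{CB}=[q_w,q_x,q_y,q_z]^{\mathsf T}\in\mathbb R^4$, and 8 scalar intrinsic parameters. Thus $\dim\mathbf x=54$. $\mathbf R_{CB}$ is the rotation matrix of the quaternion $\mathbf q_{CB}$. Dynamics. With inputs $\mathbf a_m,\boldsymbol\omega_m\in\mathbb R^3$ (accelerometer and gyroscope readings) put $$\mathbf a_t=\mathbf M_a(\mathbf a_m-\mathbf b_a),\qquad \boldsymbol\omega_t=\mathbf M_g(\boldsymbol\omega_m-\mathbf b_g)-\mathbf M_g\mathbf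 T_s(\mathbf a_m-\mathbf b_a),$$ $$\bar{\boldsymbol\gamma}=\begin{bmatrix}\boldsymbol\gamma\\1\end{bmatrix},\qquad C_{\gamma\rho}=\begin{bmatrix}\mathbf I_2&-\boldsymbol\gamma\\ \mathbf 0_{1\times2}&-\rho\end{bmatrix}.$$ Then $$\begin{bmatrix}\dot{\boldsymbol\gamma}\\\dot\rho\end{bmatrix}=C_{\gamma\rho}\left[(\mathbf R_{CB}\boldsymbol\omega_t)\times(\rho\,\mathbf p_{CB}-\bar{\boldsymbol\gamma})-\rho\,\mathbf R_{CB}\mathbf v^B\right],\quad \dot{\mathbf v}^B=\mathbf v^B\times\boldsymbol\omega_t+\mathbf a_t+\mathbf g^B,\quad \dot{\mathbf g}^B=\mathbf g^B\times\boldsymbol\omega_t,$$ and all other state components have zero time derivative. The right-hand side is affine in $(\mathbf a_m,\boldsymbol\omega_m)$; $\mathbf f_0$ is the drift vector field and $\mathbf f_1=[\mathbf f_{11},\mathbf f_{12},\mathbf f_{13}]$, $\mathbf f_2=[\mathbf f_{21},\mathbf f_{22},\mathbf f_{23}]$ collect the vector fields multiplying the components of $\mathbf a_m$ and $\boldsymbol\omega_m$. Outputs. With $r^2=\gamma_1^2+\gamma_2^2$, $$\mathbf h_1=\begin{bmatrix} f_x[\gamma_1(1+k_1r^2+k_2r^4)+2p_1\gamma_1\gamma_2+p_2(r^2+2\gamma_1^2)]+c_x\\ f_y[\gamma_2(1+k_1r^2+k_2r^4)+p_1(r^2+2\gamma_2^2)+2p_2\gamma_1\gamma_2]+c_y\end{bmatrix},$$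 $$h_2=(\mathbf g^B)^{\mathsf T}\mathbf g^B,\qquad h_3=\mathbf q_{CB}^{\mathsf T}\mathbf q_{CB}.$$ Lie derivatives and codistributions. For a scalar function $\phi$ of the state and vector field $\mathbf f$, $\mathcal L^0\phi=\phi$, $\mathcal L^1_{\mathbf f}\phi=\nabla\phi\cdot\mathbf f$, and higher-order Lie derivatives are obtained by iterating, $\mathcal L^2_{\mathbf f,\mathbf g}\phi=\mathcal L^1_{\mathbf g}\mathcal L^1_{\mathbf f}\phi$, etc. $\mathcal O_k$ is the span of the gradients (row vectors) of all Lie derivatives of order at most $k$ of the components of the outputs along the vector fields $\mathbf f_0,\mathbf f_{11},\mathbf f_{12},\mathbf f_{13},\mathbf f_{21},\mathbf f_{22},\mathbf f_{23}$. The rank of $\mathcal O_k$, and membership in it, are understood at generic states (equivalently, over the field of functions of the symbolic state variables). Weak observability. A state $\mathbf x(t_0)$ is weakly observable if it has a neighborhood in which every other state can be distinguished from it by knowledge of the outputs and of general (unconstrained) inputs on a time interval $[t_0,t_0+T]$. Full rank of $\mathcal O_k$ for some $k$ is sufficient for weak observability, and a single component $x_i$ is weakly observable if $\nabla x_i\in\mathcal O_k$. *)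

theory Defs
  imports "HOL-Analysis.Analysis"
begin

section \<open>Lie derivatives, codistributions and weak observability\<close>

definition grad :: "('a::euclidean_space \<Rightarrow> real) \<Rightarrow> 'a \<Rightarrow> 'a" where
  "grad \<phi> x = (THE D. GDERIV \<phi> x :> D)"

definition lie_derivative :: "('a::euclidean_space \<Rightarrow> 'a) \<Rightarrow> ('a \<Rightarrow> real) \<Rightarrow> ('a \<Rightarrow> real)" where
  "lie_derivative f \<phi> = (\<lambda>x. grad \<phi> x \<bullet> f x)"

text \<open>The Lie derivatives of order exactly \<open>k\<close> of the functions in \<open>H\<close> along the fields in \<open>V\<close>.\<close>

fun lie_derivatives ::
  "('a::euclidean_space \<Rightarrow> 'a) set \<Rightarrow> ('a \<Rightarrow> real) set \<Rightarrow> nat \<Rightarrow> ('a \<Rightarrow> real) set" where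
  "lie_derivatives V H 0 = H"
| "lie_derivatives V H (Suc k) = {lie_derivative f \<phi> | f \<phi>. f \<in> V \<and> \<phi> \<in> lie_derivatives V H k}"

text \<open>Covectors are identified with vectors through the inner product.\<close>

definition codistribution ::
  "('a::euclidean_space \<Rightarrow> 'a) set \<Rightarrow> ('a \<Rightarrow> real) set \<Rightarrow> nat \<Rightarrow> 'a \<Rightarrow> 'a set" where
  "codistribution V H k x = span {grad \<phi> x | \<phi> j. j \<le> k \<and> \<phi> \<in> lie_derivatives V H j}"

text \<open>A property holds at generic states if it holds off the zero set of some nonzero polynomial
  in the coordinates. For ranks and span membership of vectors of rational functions this is the
  same as working over the field of rational functions.\<close>

definition generically :: "('a::euclidean_space \<Rightarrow> bool) \<Rightarrow> bool" where
  "generically P \<longleftrightarrow>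
     (\<exists>p. real_polynomial_function p \<and> (\<exists>x. p x \<noteq> 0) \<and> (\<forall>x. p x \<noteq> 0 \<longrightarrow> P x))"

text \<open>A controlled system is given by its right-hand side \<open>F a \<omega> x\<close>, with two inputs in
  three-dimensional space. For \<open>F\<close> affine in the inputs, the following are the drift and
  the fields multiplying the components of the inputs.\<close>

type_synonym 'a control_system = "real^3 \<Rightarrow> real^3 \<Rightarrow> 'a \<Rightarrow> 'a"

definition drift_field :: "'a::euclidean_space control_system \<Rightarrow> 'a \<Rightarrow> 'a" where
  "drift_field F x = F 0 0 x"

definition input_field1 :: "'a::euclidean_space control_system \<Rightarrow> 3 \<Rightarrow> 'a \<Rightarrow> 'a" where
  "input_field1 F j x = F (axis j 1) 0 x - F 0 0 x"

definition input_field2 :: "'a::euclidean_space control_system \<Rightarrow> 3 \<Rightarrow> 'a \<Rightarrow> 'a" where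
  "input_field2 F j x = F 0 (axis j 1) x - F 0 0 x"

definition system_fields :: "'a::euclidean_space control_system \<Rightarrow> ('a \<Rightarrow> 'a) set" where
  "system_fields F = {drift_field F} \<union> range (input_field1 F) \<union> range (input_field2 F)"

definition trajectory ::
  "'a::euclidean_space control_system \<Rightarrow> (real \<Rightarrow> real^3) \<Rightarrow> (real \<Rightarrow> real^3) \<Rightarrow> real \<Rightarrow> (real \<Rightarrow> 'a) \<Rightarrow> bool" where
  "trajectory F a \<omega> T X \<longleftrightarrow>
     (\<forall>t\<in>{0..T}. (X has_vector_derivative F (a t) (\<omega> t) (X t)) (at t within {0..T}))"

text \<open>The systems are autonomous, so the initial time is taken to be \<open>0\<close>. Inputs are otherwise
  unconstrained, but continuous: together with local Lipschitz continuity of \<open>F\<close> in the state this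
  makes the trajectories, which are required to exist on the whole interval, unique.\<close>

definition distinguishable ::
  "'a::euclidean_space control_system \<Rightarrow> ('a \<Rightarrow> real) set \<Rightarrow> 'a \<Rightarrow> 'a \<Rightarrow> bool" where
  "distinguishable F H x0 x1 \<longleftrightarrow>
     (\<exists>T>0. \<exists>a \<omega> X Y. continuous_on {0..T} a \<and> continuous_on {0..T} \<omega> \<and>
        trajectory F a \<omega> T X \<and> X 0 = x0 \<and> trajectory F a \<omega> T Y \<and> Y 0 = x1 \<and>
        (\<exists>t\<in>{0..T}. \<exists>h\<in>H. h (X t) \<noteq> h (Y t)))"

definition weakly_observable ::
  "'a::euclidean_space control_system \<Rightarrow> ('a \<Rightarrow> real) set \<Rightarrow> 'a \<Rightarrow> bool" where
  "weakly_observable F H x0 \<longleftrightarrow>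
     (\<exists>U. open U \<and> x0 \<in> U \<and> (\<forall>x1\<in>U. x1 \<noteq> x0 \<longrightarrow> distinguishable F H x0 x1))"

definition component_weakly_observable ::
  "'a::euclidean_space control_system \<Rightarrow> ('a \<Rightarrow> real) set \<Rightarrow> ('a \<Rightarrow> real) \<Rightarrow> 'a \<Rightarrow> bool" where
  "component_weakly_observable F H c x0 \<longleftrightarrow>
     (\<exists>U. open U \<and> x0 \<in> U \<and> (\<forall>x1\<in>U. c x1 \<noteq> c x0 \<longrightarrow> distinguishable F H x0 x1))"


section \<open>The camera-IMU system\<close>

text \<open>Row-wise entries \<open>m11, m21, m22, m31, m32, m33\<close> of a lower triangular matrix.\<close>

type_synonym lower_tri3 = "real \<times> real \<times> real \<times> real \<times> real \<times> real"

fun lower_tri_matrix :: "lower_tri3 \<Rightarrow> real^3^3" where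
  "lower_tri_matrix (m11, m21, m22, m31, m32, m33) =
     vector [vector [m11, 0, 0], vector [m21, m22, 0], vector [m31, m32, m33]]"

text \<open>The components are \<open>\<gamma>, \<rho>, v, g, b\<^sub>g, b\<^sub>a, M\<^sub>g, T\<^sub>s, M\<^sub>a, p\<^sub>C\<^sub>B, q\<^sub>C\<^sub>B\<close>;
  those of the camera are \<open>f\<^sub>x, f\<^sub>y, c\<^sub>x, c\<^sub>y, k\<^sub>1, k\<^sub>2, p\<^sub>1, p\<^sub>2\<close>.\<close>

type_synonym imu_state =
  "(real^2) \<times> real \<times> (real^3) \<times> (real^3) \<times> (real^3) \<times> (real^3) \<times>
   (real^3^3) \<times> (real^3^3) \<times> lower_tri3 \<times> (real^3) \<times> (real^4)"

type_synonym camera =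
  "real \<times> real \<times> real \<times> real \<times> real \<times> real \<times> real \<times> real"

type_synonym full_state = "imu_state \<times> camera"

text \<open>The rotation matrix of \<open>q = [w, x, y, z]\<close> (Hamilton convention). The state \<open>q\<close> is not
  constrained to unit norm, hence the normalization.\<close>

definition quat_rotation :: "real^4 \<Rightarrow> real^3^3" where
  "quat_rotation q = (let w = q$1; x = q$2; y = q$3; z = q$4 in
     inverse (w^2 + x^2 + y^2 + z^2) *\<^sub>R
       vector [vector [w^2 + x^2 - y^2 - z^2, 2 * (x*y - w*z), 2 * (x*z + w*y)],
               vector [2 * (x*y + w*z), w^2 - x^2 + y^2 - z^2, 2 * (y*z - w*x)],
               vector [2 * (x*z - w*y), 2 * (y*z + w*x), w^2 - x^2 - y^2 + z^2]])"

definition C_matrix :: "real^2 \<Rightarrow> real \<Rightarrow> real^3^3" where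
  "C_matrix \<gamma> \<rho> = vector [vector [1, 0, - \<gamma>$1], vector [0, 1, - \<gamma>$2], vector [0, 0, - \<rho>]]"

fun imu_dynamics :: "imu_state control_system" where
  "imu_dynamics a\<^sub>m \<omega>\<^sub>m (\<gamma>, \<rho>, v, g, b\<^sub>g, b\<^sub>a, M\<^sub>g, T\<^sub>s, M\<^sub>a, p, q) =
     (let R = quat_rotation q;
          a\<^sub>t = lower_tri_matrix M\<^sub>a *v (a\<^sub>m - b\<^sub>a);
          \<omega>\<^sub>t = M\<^sub>g *v (\<omega>\<^sub>m - b\<^sub>g) - (M\<^sub>g ** T\<^sub>s) *v (a\<^sub>m - b\<^sub>a);
          d = C_matrix \<gamma> \<rho> *v
                (cross3 (R *v \<omega>\<^sub>t) (\<rho> *\<^sub>R p - vector [\<gamma>$1, \<gamma>$2, 1]) - \<rho> *\<^sub>R (R *v v))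
      in (vector [d$1, d$2], d$3, cross3 v \<omega>\<^sub>t + a\<^sub>t + g, cross3 g \<omega>\<^sub>t, 0, 0, 0, 0, 0, 0, 0))"

fun full_dynamics :: "full_state control_system" where
  "full_dynamics a\<^sub>m \<omega>\<^sub>m (s, c) = (imu_dynamics a\<^sub>m \<omega>\<^sub>m s, 0)"

fun landmark_direction :: "imu_state \<Rightarrow> real^2" where
  "landmark_direction (\<gamma>, _) = \<gamma>"

fun gravity_sq :: "imu_state \<Rightarrow> real" where
  "gravity_sq (\<gamma>, \<rho>, v, g, _) = g \<bullet> g"

fun quat_norm_sq :: "imu_state \<Rightarrow> real" where
  "quat_norm_sq (\<gamma>, \<rho>, v, g, b\<^sub>g, b\<^sub>a, M\<^sub>g, T\<^sub>s, M\<^sub>a, p, q) = q \<bullet> q"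

fun image_point :: "full_state \<Rightarrow> real^2" where
  "image_point (s, f\<^sub>x, f\<^sub>y, c\<^sub>x, c\<^sub>y, k\<^sub>1, k\<^sub>2, p\<^sub>1, p\<^sub>2) =
     (let x = landmark_direction s $ 1; y = landmark_direction s $ 2; r2 = x^2 + y^2 in
      vector [f\<^sub>x * (x * (1 + k\<^sub>1 * r2 + k\<^sub>2 * r2^2) + 2 * p\<^sub>1 * x * y + p\<^sub>2 * (r2 + 2 * x^2)) + c\<^sub>x,
              f\<^sub>y * (y * (1 + k\<^sub>1 * r2 + k\<^sub>2 * r2^2) + p\<^sub>1 * (r2 + 2 * y^2) + 2 * p\<^sub>2 * x * y) + c\<^sub>y])"

definition full_outputs :: "(full_state \<Rightarrow> real) set" where
  "full_outputs = {\<lambda>x. image_point x $ 1, \<lambda>x. image_point x $ 2,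
                   \<lambda>x. gravity_sq (fst x), \<lambda>x. quat_norm_sq (fst x)}"

definition reduced_outputs :: "(imu_state \<Rightarrow> real) set" where
  "reduced_outputs = {\<lambda>x. landmark_direction x $ 1, \<lambda>x. landmark_direction x $ 2,
                      gravity_sq, quat_norm_sq}"

definition camera_parameters :: "(full_state \<Rightarrow> real) set" where
  "camera_parameters =
     {\<lambda>(s, f\<^sub>x, f\<^sub>y, c\<^sub>x, c\<^sub>y, k\<^sub>1, k\<^sub>2, p\<^sub>1, p\<^sub>2). f\<^sub>x, \<lambda>(s, f\<^sub>x, f\<^sub>y, c\<^sub>x, c\<^sub>y, k\<^sub>1, k\<^sub>2, p\<^sub>1, p\<^sub>2). f\<^sub>y,
      \<lambda>(s, f\<^sub>x, f\<^sub>y, c\<^sub>x, c\<^sub>y, k\<^sub>1, k\<^sub>2, p\<^sub>1, p\<^sub>2). c\<^sub>x, \<lambda>(s, f\<^sub>x, f\<^sub>y, c\<^sub>x, c\<^sub>y, k\<^sub>1, k\<^sub>2, p\<^sub>1, p\<^sub>2). c\<^sub>y,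
      \<lambda>(s, f\<^sub>x, f\<^sub>y, c\<^sub>x, c\<^sub>y, k\<^sub>1, k\<^sub>2, p\<^sub>1, p\<^sub>2). k\<^sub>1, \<lambda>(s, f\<^sub>x, f\<^sub>y, c\<^sub>x, c\<^sub>y, k\<^sub>1, k\<^sub>2, p\<^sub>1, p\<^sub>2). k\<^sub>2,
      \<lambda>(s, f\<^sub>x, f\<^sub>y, c\<^sub>x, c\<^sub>y, k\<^sub>1, k\<^sub>2, p\<^sub>1, p\<^sub>2). p\<^sub>1, \<lambda>(s, f\<^sub>x, f\<^sub>y, c\<^sub>x, c\<^sub>y, k\<^sub>1, k\<^sub>2, p\<^sub>1, p\<^sub>2). p\<^sub>2}"

lemma DIM_imu_state: "DIM(imu_state) = 46" and DIM_full_state: "DIM(full_state) = 54"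
  by simp_all

lemma imu_dynamics_affine:
  "imu_dynamics a \<omega> x = drift_field imu_dynamics x
     + (\<Sum>j\<in>UNIV. a$j *\<^sub>R input_field1 imu_dynamics j x)
     + (\<Sum>j\<in>UNIV. \<omega>$j *\<^sub>R input_field2 imu_dynamics j x)"
proof -
  obtain \<gamma> \<rho> v g b\<^sub>g b\<^sub>a M\<^sub>g T\<^sub>s M\<^sub>a p q where x: "x = (\<gamma>, \<rho>, v, g, b\<^sub>g, b\<^sub>a, M\<^sub>g, T\<^sub>s, M\<^sub>a, p, q)"
    by (metis prod.collapse)
  define R K L where "R = quat_rotation q" and "K = M\<^sub>g ** T\<^sub>s" and "L = lower_tri_matrix M\<^sub>a"
  show ?thesis
    unfolding x drift_field_def input_field1_def input_field2_def imu_dynamics.simps Let_def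
      R_def[symmetric] K_def[symmetric] L_def[symmetric]
    apply (simp add: sum_3 vec_eq_iff forall_2 forall_3 cross3_def matrix_vector_mult_def
        axis_def C_matrix_def)
    apply (intro conjI; algebra)
    done
qed

lemma full_dynamics_affine:
  "full_dynamics a \<omega> x = drift_field full_dynamics x
     + (\<Sum>j\<in>UNIV. a$j *\<^sub>R input_field1 full_dynamics j x)
     + (\<Sum>j\<in>UNIV. \<omega>$j *\<^sub>R input_field2 full_dynamics j x)"
  apply (cases x)
  using imu_dynamics_affine[of a \<omega> "fst x"]
  apply (simp add: drift_field_def input_field1_def input_field2_def sum_3)
  done

lemma rotation_matrix_quat_rotation:
  assumes "q \<noteq> 0"
  shows "rotation_matrix (quat_rotation q)"
proof -
  define w x y z where "w = q$1" and "x = q$2" and "y = q$3" and "z = q$4"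
  define N where "N = w^2 + x^2 + y^2 + z^2"
  define M :: "real^3^3" where "M =
       vector [vector [w^2 + x^2 - y^2 - z^2, 2 * (x*y - w*z), 2 * (x*z + w*y)],
               vector [2 * (x*y + w*z), w^2 - x^2 + y^2 - z^2, 2 * (y*z - w*x)],
               vector [2 * (x*z - w*y), 2 * (y*z + w*x), w^2 - x^2 - y^2 + z^2]]"
  have N: "N \<noteq> 0"
    using assms unfolding N_def w_def x_def y_def z_def
    by (auto simp: vec_eq_iff forall_4 add_nonneg_eq_0_iff)
  have Q: "quat_rotation q = inverse N *\<^sub>R M"
    by (simp add: quat_rotation_def M_def N_def w_def x_def y_def z_def Let_def)
  have "transpose M ** M = (N^2) *\<^sub>R mat 1"
    unfolding M_def N_def
    apply (simp add: vec_eq_iff forall_3 matrix_matrix_mult_def transpose_def sum_3 mat_def)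
    apply (intro conjI; algebra)
    done
  then have 1: "transpose (quat_rotation q) ** quat_rotation q = mat 1"
    using N by (simp add: Q transpose_scalar scalar_matrix_assoc[symmetric] matrix_scalar_ac
        power2_eq_square field_simps)
  have "det M = N^3"
    unfolding M_def N_def by (simp add: det_3) algebra
  moreover have "det (quat_rotation q) = (inverse N)^3 * det M"
    unfolding Q det_3 by (simp add: algebra_simps power3_eq_cube)
  ultimately have "det (quat_rotation q) = 1"
    using N by (simp add: power_inverse)
  with 1 show ?thesis
    by (simp add: rotation_matrix_def orthogonal_matrix)
qed

end

(*
The observability rank condition is reached after a rational change of coordinates. In the camera
frame the parameters enter only through W = R M_g, K = - R M_g T_s, \<Lambda> = \<rho> R M_a and the biases rotated
and scaled in the same way; together with \<gamma>, s = \<rho> p, \<nu> = \<rho> R v, \<Gamma> = \<rho> R g and the intrinsic parameters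
these form 52 functions on which the dynamics is polynomial with integer coefficients, so every Lie
derivative of the outputs is such a polynomial. Ranks are lower semicontinuous, hence one integer
point with full rank suffices. At that point the second-order words that avoid drift followed by
drift depend on 28 of the functions only and determine their differentials, which gives (i); third-order
words determine the other 24. The squared norms of gravity and quaternion fix the two remaining scales.
The rank of the reduced system follows from that of the full one, whose Lie derivatives are polynomials
in the reduced ones and the intrinsic parameters.

Full rank gives weak observability although inputs must be continuous: if a pair of states is not
distinguished, neither is the pair reached by steering both for a short time towards another input
value, and letting that time tend to zero yields equality of all iterated Lie derivatives.
*)
theory Submission
  imports Defs
begin

section \<open>Rational functions and generic states\<close>

text \<open>Semicontinuity settles full rank but not membership: that a covector lies in a span at
  one point says nothing about nearby points. This obstacle shapes part (i). Membership is rephrased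
  as a kernel condition, and the second-order words are restricted so that they involve a fixed set
  of variables on which their differentials have trivial kernel. Triviality of the kernel is an open
  condition, and it forces the differential of each of these variables into the span.

  The 52 functions fall two short of the 54 coordinates because of two symmetries: rescaling the
  quaternion, and multiplying \<open>\<rho>\<close> while dividing \<open>p\<close>,
  \<open>v\<close>, \<open>g\<close> and \<open>M_a\<close> by the same factor (the monocular
  scale). A rotation of the body frame is not a third symmetry only because \<open>M_a\<close> is
  lower triangular: such a rotation can be absorbed into the unstructured \<open>M_g\<close> without
  changing \<open>W\<close> and \<open>K\<close>, but absorbing it into \<open>M_a\<close> destroys
  the triangular form.\<close>

inductive rat_fun :: "('a::euclidean_space \<Rightarrow> real) \<Rightarrow> ('a \<Rightarrow> real) \<Rightarrow> bool" for N where
  linear: "bounded_linear f \<Longrightarrow> rat_fun N f"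
| const: "rat_fun N (\<lambda>x. c)"
| add: "rat_fun N f \<Longrightarrow> rat_fun N g \<Longrightarrow> rat_fun N (\<lambda>x. f x + g x)"
| mult: "rat_fun N f \<Longrightarrow> rat_fun N g \<Longrightarrow> rat_fun N (\<lambda>x. f x * g x)"
| inv: "rat_fun N (\<lambda>x. inverse (N x))"

lemma rat_fun_polynomial: "real_polynomial_function p \<Longrightarrow> rat_fun N p"
  by (induction rule: real_polynomial_function.induct) (auto intro: rat_fun.intros)

lemma GDERIV_bounded_linear:
  fixes f :: "'a::euclidean_space \<Rightarrow> real"
  assumes "bounded_linear f"
  shows "GDERIV f x :> adjoint f 1"
proof -
  have "(\<lambda>h. h \<bullet> adjoint f 1) = f"
    using adjoint_works[of f] assms by (auto simp: bounded_linear.linear fun_eq_iff)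
  then show ?thesis
    using bounded_linear_imp_has_derivative[OF assms, of "at x"] by (simp add: gderiv_def)
qed

lemma polynomial_gderiv:
  fixes p :: "'a::euclidean_space \<Rightarrow> real"
  assumes "real_polynomial_function p"
  shows "\<exists>D. (\<forall>x. GDERIV p x :> D x) \<and> (\<forall>b. real_polynomial_function (\<lambda>x. D x \<bullet> b))"
  using assms
proof (induction rule: real_polynomial_function.induct)
  case (linear f)
  then show ?case
    by (intro exI[of _ "\<lambda>_. adjoint f 1"])
      (auto intro: GDERIV_bounded_linear real_polynomial_function.intros(2))
next
  case (const c)
  then show ?case
    by (intro exI[of _ "\<lambda>_. 0"]) (auto intro: GDERIV_const real_polynomial_function.intros(2))
next
  case (add f g)
  then obtain D E where "\<forall>x. GDERIV f x :> D x" "\<forall>x. GDERIV g x :> E x"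
    "\<forall>b. real_polynomial_function (\<lambda>x. D x \<bullet> b)" "\<forall>b. real_polynomial_function (\<lambda>x. E x \<bullet> b)"
    by blast
  then show ?case
    by (intro exI[of _ "\<lambda>x. D x + E x"])
      (auto simp: inner_add_left intro!: GDERIV_add real_polynomial_function.intros(3))
next
  case (mult f g)
  then obtain D E where "\<forall>x. GDERIV f x :> D x" "\<forall>x. GDERIV g x :> E x"
    "\<forall>b. real_polynomial_function (\<lambda>x. D x \<bullet> b)" "\<forall>b. real_polynomial_function (\<lambda>x. E x \<bullet> b)"
    by blast
  with mult.hyps show ?case
    by (intro exI[of _ "\<lambda>x. f x *\<^sub>R E x + g x *\<^sub>R D x"])
      (auto simp: inner_add_left intro!: GDERIV_mult real_polynomial_function.intros(3)
        real_polynomial_function.intros(4))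
qed

text \<open>Differentiating \<open>inverse N\<close> gives minus its square times the gradient of
  \<open>N\<close>, so the polynomial ring localized at \<open>N\<close> is closed under partial
  derivatives. One denominator, fixed once, therefore serves Lie derivatives of every order.\<close>

lemma rat_fun_gderiv:
  fixes N :: "'a::euclidean_space \<Rightarrow> real"
  assumes N: "real_polynomial_function N" and "rat_fun N f"
  shows "\<exists>D. (\<forall>x. N x \<noteq> 0 \<longrightarrow> GDERIV f x :> D x) \<and> (\<forall>b. rat_fun N (\<lambda>x. D x \<bullet> b))"
  using assms(2)
proof (induction rule: rat_fun.induct)
  case (linear f)
  then show ?case
    by (intro exI[of _ "\<lambda>_. adjoint f 1"]) (auto intro: GDERIV_bounded_linear rat_fun.const)
next
  case (const c)
  then show ?case
    by (intro exI[of _ "\<lambda>_. 0"]) (auto intro: GDERIV_const rat_fun.const)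
next
  case (add f g)
  then obtain D E where "\<forall>x. N x \<noteq> 0 \<longrightarrow> GDERIV f x :> D x" "\<forall>x. N x \<noteq> 0 \<longrightarrow> GDERIV g x :> E x"
    "\<forall>b. rat_fun N (\<lambda>x. D x \<bullet> b)" "\<forall>b. rat_fun N (\<lambda>x. E x \<bullet> b)"
    by blast
  then show ?case
    by (intro exI[of _ "\<lambda>x. D x + E x"])
      (auto simp: inner_add_left intro!: GDERIV_add rat_fun.add)
next
  case (mult f g)
  then obtain D E where "\<forall>x. N x \<noteq> 0 \<longrightarrow> GDERIV f x :> D x" "\<forall>x. N x \<noteq> 0 \<longrightarrow> GDERIV g x :> E x"
    "\<forall>b. rat_fun N (\<lambda>x. D x \<bullet> b)" "\<forall>b. rat_fun N (\<lambda>x. E x \<bullet> b)"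
    by blast
  with mult.hyps show ?case
    by (intro exI[of _ "\<lambda>x. f x *\<^sub>R E x + g x *\<^sub>R D x"])
      (auto simp: inner_add_left intro!: GDERIV_mult rat_fun.add rat_fun.mult)
next
  case inv
  obtain D where D: "\<forall>x. GDERIV N x :> D x" "\<forall>b. real_polynomial_function (\<lambda>x. D x \<bullet> b)"
    using polynomial_gderiv[OF N] by blast
  have "rat_fun N (\<lambda>x. (- 1) * (inverse (N x) * inverse (N x)) * (D x \<bullet> b))" for b
    using D(2) by (intro rat_fun.intros rat_fun_polynomial) auto
  with D(1) show ?case
    by (intro exI[of _ "\<lambda>x. - (inverse (N x))\<^sup>2 *\<^sub>R D x"])
      (auto simp: power2_eq_square intro!: GDERIV_inverse[unfolded power2_eq_square, simplified])
qed

text \<open>\<open>generically\<close> asks for a polynomial, so a rational function has to be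
  cleared of denominators by a power of \<open>N\<close> that is the same at all points.\<close>

lemma rat_fun_numerator:
  assumes N: "real_polynomial_function N" and "rat_fun N f"
  shows "\<exists>p k. real_polynomial_function p \<and> (\<forall>x. N x \<noteq> 0 \<longrightarrow> p x = N x ^ k * f x)"
  using assms(2)
proof (induction rule: rat_fun.induct)
  case (linear f)
  then show ?case by (intro exI[of _ f] exI[of _ 0]) auto
next
  case (const c)
  then show ?case by (intro exI[of _ "\<lambda>_. c"] exI[of _ 0]) auto
next
  case (add f g)
  then obtain p k q l where
    *: "real_polynomial_function p" "\<forall>x. N x \<noteq> 0 \<longrightarrow> p x = N x ^ k * f x"
    "real_polynomial_function q" "\<forall>x. N x \<noteq> 0 \<longrightarrow> q x = N x ^ l * g x"
    by blast
  then have "real_polynomial_function (\<lambda>x. N x ^ l * p x + N x ^ k * q x)"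
    using N by (intro real_polynomial_function.intros(3,4) real_polynomial_function_power)
  moreover have "N x ^ l * p x + N x ^ k * q x = N x ^ (k + l) * (f x + g x)" if "N x \<noteq> 0" for x
    using that * by (simp add: power_add algebra_simps)
  ultimately show ?case by blast
next
  case (mult f g)
  then obtain p k q l where
    *: "real_polynomial_function p" "\<forall>x. N x \<noteq> 0 \<longrightarrow> p x = N x ^ k * f x"
    "real_polynomial_function q" "\<forall>x. N x \<noteq> 0 \<longrightarrow> q x = N x ^ l * g x"
    by blast
  then have "real_polynomial_function (\<lambda>x. p x * q x)"
    by auto
  moreover have "p x * q x = N x ^ (k + l) * (f x * g x)" if "N x \<noteq> 0" for x
    using that * by (simp add: power_add algebra_simps)
  ultimately show ?case by blast
next
  case inv
  then show ?case by (intro exI[of _ "\<lambda>_. 1"] exI[of _ 1]) auto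
qed

text \<open>Values on the zero set of \<open>N\<close> are left free: there \<open>grad\<close> is a
  definite description that may fail to denote, so a Lie derivative is only known to be rational off
  that set.\<close>

definition rational_on :: "('a::euclidean_space \<Rightarrow> real) \<Rightarrow> ('a \<Rightarrow> real) \<Rightarrow> bool" where
  "rational_on N f \<longleftrightarrow> (\<exists>r. rat_fun N r \<and> (\<forall>x. N x \<noteq> 0 \<longrightarrow> f x = r x))"

named_theorems rational_intros

lemma rational_on_linear: "bounded_linear f \<Longrightarrow> rational_on N f"
  unfolding rational_on_def by (blast intro: rat_fun.intros)

lemma rational_on_const [rational_intros]: "rational_on N (\<lambda>x. c)"
  unfolding rational_on_def by (blast intro: rat_fun.intros)

lemma rational_on_add [rational_intros]:
  assumes "rational_on N f" "rational_on N g"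
  shows "rational_on N (\<lambda>x. f x + g x)"
proof -
  obtain r s where "rat_fun N r" "\<forall>x. N x \<noteq> 0 \<longrightarrow> f x = r x" "rat_fun N s" "\<forall>x. N x \<noteq> 0 \<longrightarrow> g x = s x"
    using assms unfolding rational_on_def by blast
  then show ?thesis unfolding rational_on_def
    by (intro exI[of _ "\<lambda>x. r x + s x"]) (auto intro: rat_fun.intros)
qed

lemma rational_on_mult [rational_intros]:
  assumes "rational_on N f" "rational_on N g"
  shows "rational_on N (\<lambda>x. f x * g x)"
proof -
  obtain r s where "rat_fun N r" "\<forall>x. N x \<noteq> 0 \<longrightarrow> f x = r x" "rat_fun N s" "\<forall>x. N x \<noteq> 0 \<longrightarrow> g x = s x"
    using assms unfolding rational_on_def by blast
  then show ?thesis unfolding rational_on_def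
    by (intro exI[of _ "\<lambda>x. r x * s x"]) (auto intro: rat_fun.intros)
qed

lemma rational_on_inverse_denominator [rational_intros]: "rational_on N (\<lambda>x. inverse (N x))"
  unfolding rational_on_def by (blast intro: rat_fun.intros)

lemma rational_on_uminus [rational_intros]:
  "rational_on N f \<Longrightarrow> rational_on N (\<lambda>x. - f x)"
  using rational_on_mult[OF rational_on_const[of N "- 1"]] by simp

lemma rational_on_diff [rational_intros]:
  "rational_on N f \<Longrightarrow> rational_on N g \<Longrightarrow> rational_on N (\<lambda>x. f x - g x)"
  using rational_on_add[OF _ rational_on_uminus] by simp

lemma rational_on_sum [rational_intros]:
  "(\<And>i. i \<in> I \<Longrightarrow> rational_on N (f i)) \<Longrightarrow> rational_on N (\<lambda>x. \<Sum>i\<in>I. f i x)"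
  by (induction I rule: infinite_finite_induct) (auto intro: rational_intros)

lemma rational_on_power [rational_intros]:
  "rational_on N f \<Longrightarrow> rational_on N (\<lambda>x. f x ^ k)"
  by (induction k) (auto intro: rational_intros)

lemma rational_on_compose_linear:
  assumes "rational_on N f" "bounded_linear L"
  shows "rational_on (\<lambda>x. N (L x)) (\<lambda>x. f (L x))"
proof -
  have "rat_fun N r \<Longrightarrow> rat_fun (\<lambda>x. N (L x)) (\<lambda>x. r (L x))" for r
    by (induction rule: rat_fun.induct)
      (auto intro: rat_fun.intros bounded_linear_compose[OF _ assms(2)])
  then show ?thesis using assms(1) unfolding rational_on_def by metis
qed

definition rational_field :: "('a::euclidean_space \<Rightarrow> real) \<Rightarrow> ('a \<Rightarrow> 'b::euclidean_space) \<Rightarrow> bool" where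
  "rational_field N f \<longleftrightarrow> (\<forall>b\<in>Basis. rational_on N (\<lambda>x. f x \<bullet> b))"

lemma rational_on_inner:
  assumes "rational_field N f" "rational_field N g"
  shows "rational_on N (\<lambda>x. f x \<bullet> g x)"
  using assms unfolding rational_field_def
  by (subst euclidean_inner) (auto intro!: rational_intros)

lemma grad_eq: "GDERIV f x :> D \<Longrightarrow> grad f x = D"
  unfolding grad_def
proof (rule the_equality)
  fix E assume "GDERIV f x :> D" "GDERIV f x :> E"
  then have "(\<lambda>h. h \<bullet> E) = (\<lambda>h. h \<bullet> D)"
    unfolding gderiv_def by (rule has_derivative_unique[rotated])
  then show "E = D"
    by (metis inner_commute vector_eq_rdot)
qed

lemma GDERIV_eqI: "\<lbrakk>(f has_derivative f') (at x); \<And>h. f' h = h \<bullet> D\<rbrakk> \<Longrightarrow> GDERIV f x :> D"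
  by (metis ext gderiv_def)

lemma GDERIV_continuous: "GDERIV f x :> D \<Longrightarrow> isCont f x"
  unfolding gderiv_def by (rule has_derivative_continuous)

locale rational_domain =
  fixes N :: "'a::euclidean_space \<Rightarrow> real"
  assumes denominator: "real_polynomial_function N"
begin

lemma open_domain: "open {x. N x \<noteq> 0}"
proof -
  have "continuous_on UNIV N"
    using continuous_real_polymonial_function[OF denominator] by (simp add: continuous_at_imp_continuous_on)
  then show ?thesis
    by (simp add: continuous_on_const open_Collect_neq)
qed

lemma rational_on_gradient:
  assumes "rational_on N f"
  shows "N x \<noteq> 0 \<Longrightarrow> GDERIV f x :> grad f x"
    and "rational_field N (grad f)"
proof -
  obtain r where r: "rat_fun N r" "\<And>x. N x \<noteq> 0 \<Longrightarrow> f x = r x"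
    using assms unfolding rational_on_def by blast
  obtain D where D: "\<And>x. N x \<noteq> 0 \<Longrightarrow> GDERIV r x :> D x" "\<And>b. rat_fun N (\<lambda>x. D x \<bullet> b)"
    using rat_fun_gderiv[OF denominator r(1)] by blast
  have *: "GDERIV f x :> D x" if "N x \<noteq> 0" for x
    using D(1)[OF that] r(2) that open_domain unfolding gderiv_def
    by (auto elim!: has_derivative_transform_within_open)
  then have "grad f x = D x" if "N x \<noteq> 0" for x
    using that by (auto intro: grad_eq)
  then show "rational_field N (grad f)"
    unfolding rational_field_def rational_on_def using D(2) by metis
  show "N x \<noteq> 0 \<Longrightarrow> GDERIV f x :> grad f x"
    using * grad_eq by metis
qed

text \<open>The nonvanishing set of \<open>N\<close> is open, so agreement on it passes to
  gradients. This lets a Lie derivative be replaced by an expression that represents it off the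
  zeros of \<open>N\<close> before differentiating again.\<close>

lemma grad_cong:
  assumes "rational_on N f" "\<And>x. N x \<noteq> 0 \<Longrightarrow> f x = g x" "N x \<noteq> 0"
  shows "grad f x = grad g x"
proof -
  have "GDERIV g x :> grad f x"
    using rational_on_gradient(1)[OF assms(1,3)] assms(2,3) open_domain unfolding gderiv_def
    by (auto elim!: has_derivative_transform_within_open)
  then show ?thesis by (simp add: grad_eq)
qed

lemma rational_on_continuous:
  assumes "rational_on N f"
  shows "continuous_on {x. N x \<noteq> 0} f"
  using rational_on_gradient(1)[OF assms] by (auto intro!: continuous_at_imp_continuous_on GDERIV_continuous)

lemma rational_field_continuous:
  assumes "rational_field N f"
  shows "continuous_on {x. N x \<noteq> 0} f"
  using assms unfolding rational_field_def
  by (subst continuous_on_componentwise) (auto intro: rational_on_continuous)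

lemma rational_on_lie_derivative:
  "rational_field N f \<Longrightarrow> rational_on N \<phi> \<Longrightarrow> rational_on N (lie_derivative f \<phi>)"
  unfolding lie_derivative_def by (intro rational_on_inner rational_on_gradient(2))

lemma rational_on_lie_derivatives:
  assumes "\<And>f. f \<in> V \<Longrightarrow> rational_field N f" "\<And>h. h \<in> H \<Longrightarrow> rational_on N h"
    and "\<phi> \<in> lie_derivatives V H k"
  shows "rational_on N \<phi>"
  using assms(3) by (induction k arbitrary: \<phi>) (auto intro: rational_on_lie_derivative assms(1,2))

lemma grad_const: "grad (\<lambda>x. c) x = 0"
  by (intro grad_eq GDERIV_const)

lemma grad_add:
  "rational_on N f \<Longrightarrow> rational_on N g \<Longrightarrow> N x \<noteq> 0 \<Longrightarrow>
    grad (\<lambda>x. f x + g x) x = grad f x + grad g x"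
  by (intro grad_eq GDERIV_add rational_on_gradient(1))

lemma grad_mult:
  "rational_on N f \<Longrightarrow> rational_on N g \<Longrightarrow> N x \<noteq> 0 \<Longrightarrow>
    grad (\<lambda>x. f x * g x) x = f x *\<^sub>R grad g x + g x *\<^sub>R grad f x"
  by (intro grad_eq GDERIV_mult rational_on_gradient(1))

end

text \<open>The witness polynomial is required to be nonzero at a prescribed point. Two such
  conditions then hold together by multiplying their polynomials, whereas for bare
  \<open>generically\<close> one would have to know that a product of nonzero polynomial functions
  is nonzero.\<close>

definition generically_at :: "'a::euclidean_space \<Rightarrow> ('a \<Rightarrow> bool) \<Rightarrow> bool" where
  "generically_at x0 P \<longleftrightarrow>
     (\<exists>p. real_polynomial_function p \<and> p x0 \<noteq> 0 \<and> (\<forall>x. p x \<noteq> 0 \<longrightarrow> P x))"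

lemma generically_at_imp_generically: "generically_at x0 P \<Longrightarrow> generically P"
  unfolding generically_at_def generically_def by blast

lemma generically_at_conj:
  assumes "generically_at x0 P" "generically_at x0 Q"
  shows "generically_at x0 (\<lambda>x. P x \<and> Q x)"
proof -
  obtain p q where "real_polynomial_function p" "p x0 \<noteq> 0" "\<forall>x. p x \<noteq> 0 \<longrightarrow> P x"
    "real_polynomial_function q" "q x0 \<noteq> 0" "\<forall>x. q x \<noteq> 0 \<longrightarrow> Q x"
    using assms unfolding generically_at_def by blast
  then show ?thesis unfolding generically_at_def
    by (intro exI[of _ "\<lambda>x. p x * q x"]) auto
qed

lemma generically_at_mono:
  "generically_at x0 P \<Longrightarrow> (\<And>x. P x \<Longrightarrow> Q x) \<Longrightarrow> generically_at x0 Q"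
  unfolding generically_at_def by blast

context rational_domain
begin

lemma generically_at_rational_nonzero:
  assumes "rational_on N f" "f x0 \<noteq> 0" "N x0 \<noteq> 0"
  shows "generically_at x0 (\<lambda>x. N x \<noteq> 0 \<and> f x \<noteq> 0)"
proof -
  obtain r where r: "rat_fun N r" "\<And>x. N x \<noteq> 0 \<Longrightarrow> f x = r x"
    using assms unfolding rational_on_def by blast
  obtain p k where p: "real_polynomial_function p" "\<forall>x. N x \<noteq> 0 \<longrightarrow> p x = N x ^ k * r x"
    using rat_fun_numerator[OF denominator r(1)] by blast
  show ?thesis unfolding generically_at_def
    by (intro exI[of _ "\<lambda>x. N x * p x"]) (use p r(2) assms(2,3) denominator in auto)
qed

text \<open>Fraction-free Gaussian elimination: pivots are chosen at \<open>x0\<close>.\<close>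

lemma generically_at_trivial_kernel:
  assumes "finite J" "N x0 \<noteq> 0"
    and "\<And>i j. i \<in> I \<Longrightarrow> j \<in> J \<Longrightarrow> rational_on N (M i j)"
    and "\<And>\<xi>. \<forall>i\<in>I. (\<Sum>j\<in>J. M i j x0 * \<xi> j) = 0 \<Longrightarrow> \<forall>j\<in>J. \<xi> j = 0"
  shows "generically_at x0 (\<lambda>x. N x \<noteq> 0 \<and>
    (\<forall>\<xi>. (\<forall>i\<in>I. (\<Sum>j\<in>J. M i j x * \<xi> j) = 0) \<longrightarrow> (\<forall>j\<in>J. \<xi> j = 0)))"
  using assms
proof (induction J arbitrary: M rule: finite_induct)
  case empty
  then show ?case
    using generically_at_rational_nonzero[of "\<lambda>_. 1" x0] by (simp add: rational_on_const)
next
  case (insert a J)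
  \<comment> \<open>Otherwise the unit vector in direction \<open>a\<close> would lie in the kernel
    at \<open>x0\<close>.\<close>
  have "\<exists>i\<in>I. M i a x0 \<noteq> 0"
  proof (rule ccontr)
    assume *: "\<not> (\<exists>i\<in>I. M i a x0 \<noteq> 0)"
    have "(\<Sum>j\<in>insert a J. M i j x0 * (if j = a then 1 else 0)) = 0" if "i \<in> I" for i
      using that * insert.hyps by (simp add: sum.neutral)
    then have "\<forall>j\<in>insert a J. (if j = a then 1 else (0::real)) = 0"
      by (intro insert.prems(3)) blast
    then show False by auto
  qed
  then obtain k where k: "k \<in> I" "M k a x0 \<noteq> 0" by blast
  define M' where "M' i j = (\<lambda>x. M k a x * M i j x - M i a x * M k j x)" for i j
  have row: "(\<Sum>j\<in>J. M' i j x * \<xi> j) =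
      M k a x * (\<Sum>j\<in>insert a J. M i j x * \<xi> j) - M i a x * (\<Sum>j\<in>insert a J. M k j x * \<xi> j)" for i x \<xi>
    using insert.hyps unfolding M'_def
    by (simp add: sum_distrib_left left_diff_distrib sum_subtractf algebra_simps)
  have "generically_at x0 (\<lambda>x. N x \<noteq> 0 \<and>
    (\<forall>\<xi>. (\<forall>i\<in>I. (\<Sum>j\<in>J. M' i j x * \<xi> j) = 0) \<longrightarrow> (\<forall>j\<in>J. \<xi> j = 0)))"
  proof (rule insert.IH)
    show "rational_on N (M' i j)" if "i \<in> I" "j \<in> J" for i j
      unfolding M'_def using that k(1) by (intro rational_intros insert.prems(2)) auto
    show "\<forall>j\<in>J. \<xi> j = 0" if *: "\<forall>i\<in>I. (\<Sum>j\<in>J. M' i j x0 * \<xi> j) = 0" for \<xi>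
    proof -
      \<comment> \<open>Back substitution: the entry at \<open>a\<close> is chosen to satisfy the
        pivot row, so that by \<open>row\<close> the equations of the eliminated system give back
        the original ones.\<close>
      define \<zeta> where "\<zeta> = \<xi>(a := - (\<Sum>j\<in>J. M k j x0 * \<xi> j) / M k a x0)"
      have eq: "(\<Sum>j\<in>J. f j * \<zeta> j) = (\<Sum>j\<in>J. f j * \<xi> j)" for f
        using insert.hyps unfolding \<zeta>_def by (intro sum.cong) auto
      have 0: "(\<Sum>j\<in>insert a J. M k j x0 * \<zeta> j) = 0"
        using insert.hyps k(2) by (simp add: eq) (simp add: \<zeta>_def)
      have "(\<Sum>j\<in>insert a J. M i j x0 * \<zeta> j) = 0" if "i \<in> I" for i
        using row[of i x0 \<zeta>] * that k(2) by (simp only: 0 eq) simp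
      then have "\<forall>j\<in>insert a J. \<zeta> j = 0"
        by (intro insert.prems(3)) blast
      then show ?thesis
        using insert.hyps unfolding \<zeta>_def by (auto split: if_splits)
    qed
  qed (use insert.prems in auto)
  from generically_at_conj[OF this generically_at_rational_nonzero[of "M k a", OF _ k(2) insert.prems(1)]]
    insert.prems(2) k(1)
  have "generically_at x0 (\<lambda>x. (N x \<noteq> 0 \<and>
    (\<forall>\<xi>. (\<forall>i\<in>I. (\<Sum>j\<in>J. M' i j x * \<xi> j) = 0) \<longrightarrow> (\<forall>j\<in>J. \<xi> j = 0))) \<and> N x \<noteq> 0 \<and> M k a x \<noteq> 0)"
    by blast
  then show ?case
  proof (rule generically_at_mono)
    fix x assume x: "(N x \<noteq> 0 \<and>
      (\<forall>\<xi>. (\<forall>i\<in>I. (\<Sum>j\<in>J. M' i j x * \<xi> j) = 0) \<longrightarrow> (\<forall>j\<in>J. \<xi> j = 0))) \<and> N x \<noteq> 0 \<and> M k a x \<noteq> 0"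
    have "\<forall>j\<in>insert a J. \<xi> j = 0" if *: "\<forall>i\<in>I. (\<Sum>j\<in>insert a J. M i j x * \<xi> j) = 0" for \<xi>
    proof -
      have "\<forall>i\<in>I. (\<Sum>j\<in>J. M' i j x * \<xi> j) = 0"
        using * k(1) by (subst row) simp
      with x have J: "\<forall>j\<in>J. \<xi> j = 0" by blast
      then have "(\<Sum>j\<in>insert a J. M k j x * \<xi> j) = M k a x * \<xi> a"
        using insert.hyps by simp
      with * k(1) x J show ?thesis by auto
    qed
    with x show "N x \<noteq> 0 \<and>
      (\<forall>\<xi>. (\<forall>i\<in>I. (\<Sum>j\<in>insert a J. M i j x * \<xi> j) = 0) \<longrightarrow> (\<forall>j\<in>insert a J. \<xi> j = 0))"
      by blast
  qed
qed

end

text \<open>Duality: split \<open>v\<close> into its projection \<open>y\<close> onto the span and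
  \<open>z\<close> orthogonal to the span. Then \<open>z\<close> is a direction annihilated by all
  the gradients, so \<open>v \<bullet> z = 0\<close> and hence \<open>z = 0\<close>. Membership and
  rank claims become kernel claims in this way.\<close>

lemma in_codistributionI:
  assumes "\<And>\<xi>. (\<And>\<phi> j. j \<le> k \<Longrightarrow> \<phi> \<in> lie_derivatives V H j \<Longrightarrow> grad \<phi> x \<bullet> \<xi> = 0) \<Longrightarrow> v \<bullet> \<xi> = 0"
  shows "v \<in> codistribution V H k x"
proof -
  let ?S = "codistribution V H k x"
  obtain y z where yz: "y \<in> span ?S" "\<And>w. w \<in> span ?S \<Longrightarrow> orthogonal z w" "v = y + z"
    using orthogonal_subspace_decomp_exists by blast
  have S: "span ?S = ?S" unfolding codistribution_def by (simp add: span_span)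
  have "grad \<phi> x \<bullet> z = 0" if "j \<le> k" "\<phi> \<in> lie_derivatives V H j" for \<phi> j
  proof -
    have "grad \<phi> x \<in> ?S"
      unfolding codistribution_def using that by (intro span_base) blast
    then show ?thesis using yz(2)[of "grad \<phi> x"] S by (simp add: orthogonal_def inner_commute)
  qed
  then have "v \<bullet> z = 0" by (rule assms)
  moreover have "y \<bullet> z = 0" using yz(2)[OF yz(1)] by (simp add: orthogonal_def inner_commute)
  ultimately have "z = 0" using yz(3) by (simp add: inner_add_left)
  then show ?thesis using yz S by simp
qed

section \<open>The observability rank condition\<close>

text \<open>Picard-Lindeloef by Banach's fixed point theorem: \<open>T * B \<le> r\<close> keeps the
  iterates in the ball and \<open>T * L \<le> 1/2\<close> makes them contract. Inputs vary in time,
  so continuity of \<open>G\<close> is asked for along continuous curves. The displacement bound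
  \<open>B * t\<close> later forces end points to converge as the time shrinks.\<close>

lemma picard_existence:
  fixes G :: "real \<Rightarrow> 'a::euclidean_space \<Rightarrow> 'a"
  assumes T: "0 < T" and B: "0 \<le> B" and L: "0 \<le> L" and TB: "T * B \<le> r" and TL: "T * L \<le> 1/2"
    and cont: "\<And>\<phi>. continuous_on {0..T} \<phi> \<Longrightarrow> \<forall>t\<in>{0..T}. \<phi> t \<in> cball x r \<Longrightarrow>
      continuous_on {0..T} (\<lambda>t. G t (\<phi> t))"
    and bnd: "\<And>t y. t \<in> {0..T} \<Longrightarrow> y \<in> cball x r \<Longrightarrow> norm (G t y) \<le> B"
    and lip: "\<And>t y z. t \<in> {0..T} \<Longrightarrow> y \<in> cball x r \<Longrightarrow> z \<in> cball x r \<Longrightarrow>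
      norm (G t y - G t z) \<le> L * norm (y - z)"
  obtains X where "\<forall>t\<in>{0..T}. (X has_vector_derivative G t (X t)) (at t within {0..T})"
    "X 0 = x" "\<forall>t\<in>{0..T}. X t \<in> cball x r \<and> dist x (X t) \<le> B * t"
proof -
  \<comment> \<open>Clamping time to \<open>{0..T}\<close> turns curves on the interval into bounded
    continuous functions on the whole line, a type with a complete metric.\<close>
  define cl where "cl t = max 0 (min T t)" for t :: real
  have cl: "cl t \<in> {0..T}" for t using T by (auto simp: cl_def)
  have cl_id: "t \<in> {0..T} \<Longrightarrow> cl t = t" for t by (auto simp: cl_def)
  have cont_cl: "continuous_on S cl" for S unfolding cl_def by (intro continuous_intros)
  define I where "I \<phi> t = integral {0..t} (\<lambda>s. G s (\<phi> s))" for \<phi> t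
  define S where "S = PiC UNIV (\<lambda>_::real. cball x r)"
  have S: "\<phi> \<in> S \<longleftrightarrow> (\<forall>t. apply_bcontfun \<phi> t \<in> cball x r)" for \<phi>
    unfolding S_def mem_PiC_iff by auto
  have g: "continuous_on {0..T} (\<lambda>t. G t (apply_bcontfun \<phi> t))" if "\<phi> \<in> S" for \<phi>
    using that by (intro cont) (auto simp: S intro!: continuous_intros)
  have g': "continuous_on {0..t} (\<lambda>t. G t (apply_bcontfun \<phi> t))" if "\<phi> \<in> S" "t \<in> {0..T}" for \<phi> t
    using g[OF that(1)] by (rule continuous_on_subset) (use that in auto)
  have Ib: "norm (I (apply_bcontfun \<phi>) t) \<le> B * t" if "\<phi> \<in> S" "t \<in> {0..T}" for \<phi> t
    using integral_bound[of 0 t, OF _ g'[OF that], of B] that bnd unfolding I_def by (auto simp: S)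
  have Icont: "continuous_on UNIV (\<lambda>t. I (apply_bcontfun \<phi>) (cl t))" if "\<phi> \<in> S" for \<phi>
  proof -
    have "continuous_on {0..T} (I (apply_bcontfun \<phi>))"
      unfolding I_def
      by (intro indefinite_integral_continuous_1 integrable_continuous_real g that)
    then show ?thesis
      by (rule continuous_on_compose2[OF _ cont_cl]) (use cl in auto)
  qed
  have BT: "B * t \<le> r" if "t \<in> {0..T}" for t
    using that TB B mult_left_mono[of t T B] by (auto simp: mult.commute)
  define P where "P \<phi> = Bcontfun (\<lambda>t. x + I (apply_bcontfun \<phi>) (cl t))" for \<phi>
  have P: "apply_bcontfun (P \<phi>) t = x + I (apply_bcontfun \<phi>) (cl t)" if "\<phi> \<in> S" for \<phi> t
  proof -
    have "norm (x + I (apply_bcontfun \<phi>) (cl t)) \<le> norm x + r" for t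
      using Ib[OF that cl] BT[OF cl] norm_triangle_ineq order_trans by (metis add_left_mono)
    then have "(\<lambda>t. x + I (apply_bcontfun \<phi>) (cl t)) \<in> bcontfun"
      by (intro bcontfun_normI continuous_intros Icont that)
    then show ?thesis unfolding P_def by (simp add: Bcontfun_inverse)
  qed
  have PS: "P \<phi> \<in> S" if "\<phi> \<in> S" for \<phi>
    unfolding S using P[OF that] Ib[OF that cl] BT[OF cl] by (auto simp: dist_norm intro: order_trans)
  have contr: "dist (P \<phi>) (P \<psi>) \<le> 1/2 * dist \<phi> \<psi>" if "\<phi> \<in> S" "\<psi> \<in> S" for \<phi> \<psi>
  proof (rule dist_bound)
    fix t
    let ?t = "cl t"
    have "norm (integral {0..?t} (\<lambda>s. G s (apply_bcontfun \<phi> s) - G s (apply_bcontfun \<psi> s)))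
      \<le> (L * dist \<phi> \<psi>) * (?t - 0)"
    proof (rule integral_bound)
      fix s assume "s \<in> {0..?t}"
      then have "norm (G s (apply_bcontfun \<phi> s) - G s (apply_bcontfun \<psi> s))
          \<le> L * norm (apply_bcontfun \<phi> s - apply_bcontfun \<psi> s)"
        using that cl[of t] by (intro lip) (auto simp: S)
      also have "\<dots> \<le> L * dist \<phi> \<psi>"
        using L dist_bounded[of \<phi> s \<psi>] by (intro mult_left_mono) (auto simp: dist_norm)
      finally show "norm (G s (apply_bcontfun \<phi> s) - G s (apply_bcontfun \<psi> s)) \<le> L * dist \<phi> \<psi>" .
    qed (use cl[of t] in \<open>auto intro!: continuous_on_diff g' that\<close>)
    also have "\<dots> \<le> (L * dist \<phi> \<psi>) * T"
      using cl[of t] L by (intro mult_left_mono) auto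
    also have "\<dots> = (T * L) * dist \<phi> \<psi>" by simp
    also have "\<dots> \<le> 1/2 * dist \<phi> \<psi>" using TL by (intro mult_right_mono) auto
    finally show "dist (apply_bcontfun (P \<phi>) t) (apply_bcontfun (P \<psi>) t) \<le> 1/2 * dist \<phi> \<psi>"
      using that cl[of t]
      by (simp add: P dist_norm I_def integral_diff integrable_continuous_real g')
  qed
  have "complete S" unfolding S_def complete_eq_closed by (intro closed_PiC) auto
  moreover have "S \<noteq> {}"
  proof -
    have "0 \<le> r" using BT[of 0] T by auto
    then have "const_bcontfun x \<in> S" by (auto simp: S const_bcontfun.rep_eq)
    then show ?thesis by blast
  qed
  ultimately have "\<exists>!\<phi>. \<phi> \<in> S \<and> P \<phi> = \<phi>"
    using PS contr by (intro Banach_fix[of S "1/2"]) auto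
  then obtain \<phi> where \<phi>: "\<phi> \<in> S" "P \<phi> = \<phi>" by blast
  define X where "X = apply_bcontfun \<phi>"
  have X: "X t = x + I X t" if "t \<in> {0..T}" for t
    using P[OF \<phi>(1), of t] cl_id[OF that] \<phi>(2) unfolding X_def by simp
  show ?thesis
  proof (rule that)
    show "\<forall>t\<in>{0..T}. (X has_vector_derivative G t (X t)) (at t within {0..T})"
    proof
      fix t assume t: "t \<in> {0..T}"
      have "((\<lambda>t. x + I X t) has_vector_derivative 0 + G t (X t)) (at t within {0..T})"
        unfolding I_def using g[OF \<phi>(1)] t
        by (intro has_vector_derivative_add has_vector_derivative_const integral_has_vector_derivative)
          (auto simp: X_def)
      then show "(X has_vector_derivative G t (X t)) (at t within {0..T})"
        using X t by (auto elim!: has_vector_derivative_transform[rotated 2])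
    qed
    show "X 0 = x" using X[of 0] T by (simp add: I_def)
    show "\<forall>t\<in>{0..T}. X t \<in> cball x r \<and> dist x (X t) \<le> B * t"
    proof (intro ballI conjI)
      fix t assume t: "t \<in> {0..T}"
      show "X t \<in> cball x r" using \<phi>(1) unfolding X_def S by blast
      show "dist x (X t) \<le> B * t"
        using X[OF t] Ib[OF \<phi>(1) t] by (simp add: X_def dist_norm)
    qed
  qed
qed

lemma trajectory_restrict:
  "trajectory F a \<omega> T X \<Longrightarrow> S \<le> T \<Longrightarrow> trajectory F a \<omega> S X"
  unfolding trajectory_def by (auto intro: has_vector_derivative_within_subset[where S = "{0..T}"])

definition then_at :: "real \<Rightarrow> (real \<Rightarrow> 'b) \<Rightarrow> (real \<Rightarrow> 'b) \<Rightarrow> real \<Rightarrow> 'b" where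
  "then_at t f g s = (if s \<le> t then f s else g (s - t))"

lemma continuous_on_then_at:
  fixes f g :: "real \<Rightarrow> 'b::topological_space"
  assumes "continuous_on {0..t} f" "continuous_on {0..S} g" "g 0 = f t" "0 \<le> t" "0 \<le> S"
  shows "continuous_on {0..t + S} (then_at t f g)"
  unfolding then_at_def
proof (rule continuous_on_cases_1)
  show "continuous_on {s \<in> {0..t + S}. s \<le> t} f"
    using assms(1) by (rule continuous_on_subset) auto
  show "continuous_on {s \<in> {0..t + S}. t \<le> s} (\<lambda>s. g (s - t))"
    by (rule continuous_on_compose2[OF assms(2)]) (auto intro!: continuous_intros)
qed (use assms in auto)

text \<open>At the junction the derivative of each piece is one-sided; equality of the state and
  input values there makes the two sides agree, so the glued curve is differentiable.\<close>

lemma trajectory_then_at: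
  assumes 1: "trajectory F a \<omega> t X" and 2: "trajectory F a' \<omega>' S X'"
    and c: "X' 0 = X t" "a' 0 = a t" "\<omega>' 0 = \<omega> t" and t: "0 \<le> t" "0 \<le> S"
  shows "trajectory F (then_at t a a') (then_at t \<omega> \<omega>') (t + S) (then_at t X X')"
  unfolding trajectory_def
proof
  fix s assume s: "s \<in> {0..t + S}"
  have int: "closure {0..t} \<inter> closure {t..t + S} = {t}" using t by auto
  have "((\<lambda>s. if s \<in> {0..t} then X s else X' (s - t)) has_vector_derivative
     (if s \<in> {0..t} then F (a s) (\<omega> s) (X s) else F (a' (s - t)) (\<omega>' (s - t)) (X' (s - t))))
    (at s within {0..t + S})"
  proof (rule has_vector_derivative_If_within_closures[where T = "{t..t + S}"], goal_cases)
    case 3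
    then show ?case using 1 t unfolding int trajectory_def by (simp add: insert_absorb)
  next
    case 4
    then have u: "s - t \<in> {0..S}" unfolding int using t by auto
    have *: "(X' has_vector_derivative F (a' (s - t)) (\<omega>' (s - t)) (X' (s - t)))
        (at (s - t) within {0..S})"
      using 2 u unfolding trajectory_def by blast
    have d: "((\<lambda>s. s - t) has_vector_derivative 1) (at s within {t..t + S})"
      by (auto intro!: derivative_eq_intros)
    have im: "(\<lambda>s. s - t) ` {t..t + S} = {0..S}" by (auto simp: image_iff intro!: bexI[of _ "_ + t"])
    have "((X' \<circ> (\<lambda>s. s - t)) has_vector_derivative
        1 *\<^sub>R F (a' (s - t)) (\<omega>' (s - t)) (X' (s - t))) (at s within {t..t + S})"
      by (rule vector_diff_chain_within[OF d]) (use * im in simp)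
    then show ?case using t unfolding int by (simp add: o_def insert_absorb)
  qed (use s t c in \<open>auto\<close>)
  moreover have "then_at t X X' r = (if r \<in> {0..t} then X r else X' (r - t))" if "r \<in> {0..t + S}" for r
    using that by (auto simp: then_at_def)
  ultimately show "(then_at t X X' has_vector_derivative
      F (then_at t a a' s) (then_at t \<omega> \<omega>' s) (then_at t X X' s)) (at s within {0..t + S})"
    using s by (auto simp: then_at_def elim!: has_vector_derivative_transform[rotated 2])
qed

section \<open>Rational input-affine systems: undistinguished states share all iterated Lie
  derivatives\<close>

locale rational_system = rational_domain N for N :: "'a::euclidean_space \<Rightarrow> real" +
  fixes F :: "'a control_system" and H :: "('a \<Rightarrow> real) set"
  assumes rational_dynamics: "\<And>a \<omega>. rational_field N (F a \<omega>)"
    and rational_outputs: "\<And>h. h \<in> H \<Longrightarrow> rational_on N h"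
    and affine: "\<And>a \<omega> x. F a \<omega> x = drift_field F x
      + (\<Sum>j\<in>UNIV. a$j *\<^sub>R input_field1 F j x) + (\<Sum>j\<in>UNIV. \<omega>$j *\<^sub>R input_field2 F j x)"
begin

lemma rational_system_fields: "f \<in> system_fields F \<Longrightarrow> rational_field N f"
proof -
  have "rational_field N (\<lambda>x. F a \<omega> x - F b \<nu> x)" for a \<omega> b \<nu>
    using rational_dynamics unfolding rational_field_def
    by (auto simp: inner_diff_left intro!: rational_intros)
  moreover have "input_field1 F j = (\<lambda>x. F (axis j 1) 0 x - F 0 0 x)"
    "input_field2 F j = (\<lambda>x. F 0 (axis j 1) x - F 0 0 x)" "drift_field F = F 0 0" for j
    by (auto simp: input_field1_def input_field2_def drift_field_def)
  ultimately show "f \<in> system_fields F \<Longrightarrow> rational_field N f"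
    unfolding system_fields_def by (auto simp: rational_dynamics)
qed

lemma rational_words: "\<phi> \<in> lie_derivatives (system_fields F) H k \<Longrightarrow> rational_on N \<phi>"
  using rational_on_lie_derivatives[of "system_fields F" H] rational_system_fields rational_outputs by blast

text \<open>Gradients of the components are bounded on the compact ball, and the ball is convex, so
  the mean value inequality applies to each component. A single \<open>B\<close> bounds both the
  field and its increments.\<close>

lemma rational_field_lipschitz:
  assumes f: "rational_field N f" and r: "cball x r \<subseteq> {x. N x \<noteq> 0}"
  shows "\<exists>B\<ge>0. \<forall>y\<in>cball x r. norm (f y) \<le> B \<and> (\<forall>z\<in>cball x r. norm (f y - f z) \<le> B * norm (y - z))"
proof -
  have scalar: "\<exists>K. \<forall>y\<in>cball x r. \<forall>z\<in>cball x r. norm (f y \<bullet> b - f z \<bullet> b) \<le> K * norm (y - z)"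
    if b: "b \<in> Basis" for b
  proof -
    let ?g = "\<lambda>y. f y \<bullet> b"
    have g: "rational_on N ?g" using f b by (simp add: rational_field_def)
    have "compact (grad ?g ` cball x r)"
      by (intro compact_continuous_image continuous_on_subset[OF rational_field_continuous r]
          rational_on_gradient g) auto
    then obtain K where K: "\<forall>y\<in>cball x r. norm (grad ?g y) \<le> K"
      using bounded_iff compact_imp_bounded by (metis imageI)
    have "norm (?g y - ?g z) \<le> K * norm (y - z)" if "y \<in> cball x r" "z \<in> cball x r" for y z
    proof (rule differentiable_bound[OF convex_cball _ _ that])
      fix w assume w: "w \<in> cball x r"
      show "(?g has_derivative (\<lambda>h. h \<bullet> grad ?g w)) (at w within cball x r)"
        by (rule has_derivative_at_withinI)
          (use rational_on_gradient(1)[OF g, of w] w r in \<open>auto simp: gderiv_def\<close>)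
      have "norm (h \<bullet> grad ?g w) \<le> K * norm h" for h
      proof -
        have "norm (h \<bullet> grad ?g w) \<le> norm h * norm (grad ?g w)"
          using Cauchy_Schwarz_ineq2[of h "grad ?g w"] by simp
        also have "\<dots> \<le> norm h * K" using K w by (intro mult_left_mono) auto
        finally show ?thesis by (simp add: mult.commute)
      qed
      then show "onorm (\<lambda>h. h \<bullet> grad ?g w) \<le> K" by (intro onorm_le)
    qed
    then show ?thesis by blast
  qed
  then obtain K where K: "\<forall>b\<in>Basis. \<forall>y\<in>cball x r. \<forall>z\<in>cball x r.
      norm (f y \<bullet> b - f z \<bullet> b) \<le> K b * norm (y - z)" by metis
  have lip: "norm (f y - f z) \<le> (\<Sum>b\<in>Basis. K b) * norm (y - z)"
    if "y \<in> cball x r" "z \<in> cball x r" for y z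
  proof -
    have "norm (f y - f z) \<le> (\<Sum>b\<in>Basis. \<bar>(f y - f z) \<bullet> b\<bar>)" by (rule norm_le_l1)
    also have "\<dots> \<le> (\<Sum>b\<in>Basis. K b * norm (y - z))"
      using K that by (intro sum_mono) (auto simp: inner_diff_left)
    finally show ?thesis by (simp add: sum_distrib_right)
  qed
  have "compact (f ` cball x r)"
    by (intro compact_continuous_image continuous_on_subset[OF rational_field_continuous[OF f] r]) auto
  then obtain B where B: "\<forall>y\<in>cball x r. norm (f y) \<le> B"
    using bounded_iff compact_imp_bounded by (metis imageI)
  let ?B = "max 0 (max B (\<Sum>b\<in>Basis. K b))"
  have "norm (f y - f z) \<le> ?B * norm (y - z)" if "y \<in> cball x r" "z \<in> cball x r" for y z
    using lip[OF that] by (rule order_trans) (intro mult_right_mono; simp)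
  moreover have "norm (f y) \<le> ?B" if "y \<in> cball x r" for y
    using B that by (auto simp: le_max_iff_disj)
  ultimately show ?thesis by (intro exI[of _ ?B]) auto
qed

lemma dynamics_lipschitz:
  assumes r: "cball x r \<subseteq> {x. N x \<noteq> 0}" and M: "0 \<le> M"
  shows "\<exists>B\<ge>0. \<forall>a \<omega>. norm a \<le> M \<and> norm \<omega> \<le> M \<longrightarrow> (\<forall>y\<in>cball x r. norm (F a \<omega> y) \<le> B \<and>
     (\<forall>z\<in>cball x r. norm (F a \<omega> y - F a \<omega> z) \<le> B * norm (y - z)))"
proof -
  have fin: "finite (system_fields F)" by (simp add: system_fields_def)
  have "\<forall>f\<in>system_fields F. \<exists>B\<ge>0. \<forall>y\<in>cball x r. norm (f y) \<le> B \<and>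
      (\<forall>z\<in>cball x r. norm (f y - f z) \<le> B * norm (y - z))"
    using rational_field_lipschitz[OF rational_system_fields r] by blast
  then obtain b where b: "\<And>f. f \<in> system_fields F \<Longrightarrow> b f \<ge> 0 \<and> (\<forall>y\<in>cball x r. norm (f y) \<le> b f \<and>
      (\<forall>z\<in>cball x r. norm (f y - f z) \<le> b f * norm (y - z)))"
    by metis
  define C where "C = (\<Sum>f\<in>system_fields F. b f)"
  have bC: "b f \<le> C" "0 \<le> C" if "f \<in> system_fields F" for f
    unfolding C_def using that fin b by (auto intro!: member_le_sum sum_nonneg)
  have fb: "norm (f y) \<le> C" "norm (f y - f z) \<le> C * norm (y - z)"
    if "f \<in> system_fields F" "y \<in> cball x r" "z \<in> cball x r" for f y z
    using b[OF that(1)] bC(1)[OF that(1)] that mult_right_mono[OF bC(1)[OF that(1)], of "norm (y - z)"]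
    by force+
  have mem: "drift_field F \<in> system_fields F" "input_field1 F j \<in> system_fields F"
    "input_field2 F j \<in> system_fields F" for j by (auto simp: system_fields_def)
  have comp: "norm (c *\<^sub>R v) \<le> M * K" if "\<bar>c\<bar> \<le> M" "norm v \<le> K" for c :: real and v :: 'a and K
    using that M by (simp add: mult_mono)
  have tri: "norm (p + q + w) \<le> norm p + norm q + norm w" for p q w :: 'a
    using norm_triangle_ineq[of "p + q" w] norm_triangle_ineq[of p q] by linarith
  show ?thesis
  \<comment> \<open>One drift field and six input fields, each of the latter weighted by an input
    component of size at most \<open>M\<close>.\<close>
  proof (intro exI[of _ "(1 + 6 * M) * C"] conjI allI impI ballI)
    show "0 \<le> (1 + 6 * M) * C" using M bC(2)[OF mem(1)] by simp
    fix a \<omega> :: "real^3" and y assume u: "norm a \<le> M \<and> norm \<omega> \<le> M" and y: "y \<in> cball x r"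
    have c: "\<bar>a$j\<bar> \<le> M" "\<bar>\<omega>$j\<bar> \<le> M" for j
      using u component_le_norm_cart[of a j] component_le_norm_cart[of \<omega> j] by auto
    have "norm (\<Sum>j\<in>UNIV. a$j *\<^sub>R input_field1 F j y) \<le> (\<Sum>j\<in>(UNIV::3 set). M * C)"
      "norm (\<Sum>j\<in>UNIV. \<omega>$j *\<^sub>R input_field2 F j y) \<le> (\<Sum>j\<in>(UNIV::3 set). M * C)"
      by (intro sum_norm_le comp c fb(1)[OF mem(2) y y] fb(1)[OF mem(3) y y])+
    then show "norm (F a \<omega> y) \<le> (1 + 6 * M) * C"
      unfolding affine[of a \<omega> y] using fb(1)[OF mem(1) y y]
      by (intro order_trans[OF tri]) (simp add: algebra_simps)
    fix z assume z: "z \<in> cball x r"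
    have 1: "norm (\<Sum>j\<in>UNIV. a$j *\<^sub>R (input_field1 F j y - input_field1 F j z)) \<le> (\<Sum>j\<in>(UNIV::3 set). M * (C * norm (y - z)))"
      "norm (\<Sum>j\<in>UNIV. \<omega>$j *\<^sub>R (input_field2 F j y - input_field2 F j z)) \<le> (\<Sum>j\<in>(UNIV::3 set). M * (C * norm (y - z)))"
      by (intro sum_norm_le comp c fb(2)[OF mem(2) y z] fb(2)[OF mem(3) y z])+
    have "F a \<omega> y - F a \<omega> z = (drift_field F y - drift_field F z) +
       (\<Sum>j\<in>UNIV. a$j *\<^sub>R (input_field1 F j y - input_field1 F j z)) +
       (\<Sum>j\<in>UNIV. \<omega>$j *\<^sub>R (input_field2 F j y - input_field2 F j z))"
      unfolding affine[of a \<omega> y] affine[of a \<omega> z] by (simp add: scaleR_diff_right sum_subtractf)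
    then show "norm (F a \<omega> y - F a \<omega> z) \<le> (1 + 6 * M) * C * norm (y - z)"
      using fb(2)[OF mem(1) y z] 1
      by (simp only:) (intro order_trans[OF tri], simp add: algebra_simps)
  qed
qed

text \<open>The time \<open>\<delta>\<close> and the speed bound \<open>B\<close> depend on the
  starting state and on the bound \<open>M\<close> for the inputs, not on the inputs themselves.
  Hence one \<open>\<delta>\<close> serves a whole family of ever faster ramps between the same two
  input values.\<close>

lemma trajectory_exists:
  assumes x: "N x \<noteq> 0" and M: "0 \<le> M"
  obtains \<delta> B where "\<delta> > 0" "\<And>\<epsilon> a \<omega>. \<lbrakk>0 < \<epsilon>; \<epsilon> \<le> \<delta>; continuous_on {0..\<epsilon>} a; continuous_on {0..\<epsilon>} \<omega>;
      \<forall>t\<in>{0..\<epsilon>}. norm (a t) \<le> M \<and> norm (\<omega> t) \<le> M\<rbrakk> \<Longrightarrow>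
    \<exists>X. trajectory F a \<omega> \<epsilon> X \<and> X 0 = x \<and> (\<forall>t\<in>{0..\<epsilon>}. N (X t) \<noteq> 0 \<and> dist x (X t) \<le> B * t)"
proof -
  obtain r where r: "r > 0" "cball x r \<subseteq> {x. N x \<noteq> 0}"
    using open_domain x open_contains_cball by blast
  obtain B where B: "B \<ge> 0" "\<And>a \<omega> y z. \<lbrakk>norm a \<le> M; norm \<omega> \<le> M; y \<in> cball x r; z \<in> cball x r\<rbrakk> \<Longrightarrow>
      norm (F a \<omega> y) \<le> B \<and> norm (F a \<omega> y - F a \<omega> z) \<le> B * norm (y - z)"
    using dynamics_lipschitz[OF r(2) M] by blast
  \<comment> \<open>The two bounds keep the curve in the ball and give the contraction factor;
    \<open>B + 1\<close> avoids division by zero.\<close>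
  define \<delta> where "\<delta> = min (r / (B + 1)) (1 / (2 * (B + 1)))"
  have \<delta>: "\<delta> > 0" "\<delta> * B \<le> r" "\<delta> * B \<le> 1/2"
  proof -
    show "\<delta> > 0" using r B by (auto simp: \<delta>_def)
    have "\<delta> * (B + 1) \<le> (r / (B + 1)) * (B + 1)" "\<delta> * (B + 1) \<le> (1 / (2 * (B + 1))) * (B + 1)"
      using B(1) unfolding \<delta>_def by (intro mult_right_mono; simp)+
    moreover have "(r / (B + 1)) * (B + 1) = r" "(1 / (2 * (B + 1))) * (B + 1) = 1/2"
      using B(1) by (simp_all add: divide_simps)
    ultimately have "\<delta> * (B + 1) \<le> r" "\<delta> * (B + 1) \<le> 1/2" by metis+
    then show "\<delta> * B \<le> r" "\<delta> * B \<le> 1/2" using \<open>\<delta> > 0\<close> by (auto simp: algebra_simps)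
  qed
  show ?thesis
  proof (rule that[OF \<delta>(1), of B])
    fix \<epsilon> and a \<omega> :: "real \<Rightarrow> real^3"
    assume \<epsilon>: "0 < \<epsilon>" "\<epsilon> \<le> \<delta>" and c: "continuous_on {0..\<epsilon>} a" "continuous_on {0..\<epsilon>} \<omega>"
      and bd: "\<forall>t\<in>{0..\<epsilon>}. norm (a t) \<le> M \<and> norm (\<omega> t) \<le> M"
    have \<epsilon>B: "\<epsilon> * B \<le> \<delta> * B" using \<epsilon> B by (intro mult_right_mono) auto
    obtain X where X: "\<forall>t\<in>{0..\<epsilon>}. (X has_vector_derivative F (a t) (\<omega> t) (X t)) (at t within {0..\<epsilon>})"
      "X 0 = x" "\<forall>t\<in>{0..\<epsilon>}. X t \<in> cball x r \<and> dist x (X t) \<le> B * t"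
    proof (rule picard_existence[of \<epsilon> B B r x "\<lambda>t. F (a t) (\<omega> t)"])
      fix \<phi> :: "real \<Rightarrow> 'a"
      assume \<phi>: "continuous_on {0..\<epsilon>} \<phi>" "\<forall>t\<in>{0..\<epsilon>}. \<phi> t \<in> cball x r"
      have "continuous_on {0..\<epsilon>} (\<lambda>t. f (\<phi> t))" if "f \<in> system_fields F" for f
        by (rule continuous_on_compose2[OF rational_field_continuous[OF rational_system_fields[OF that]] \<phi>(1)])
          (use \<phi>(2) r(2) in blast)
      then show "continuous_on {0..\<epsilon>} (\<lambda>t. F (a t) (\<omega> t) (\<phi> t))"
        unfolding affine[of "a _" "\<omega> _" "\<phi> _"] using c
        by (intro continuous_intros) (auto simp: system_fields_def)
    qed (use \<epsilon> \<epsilon>B \<delta> B bd in auto)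
    then show "\<exists>X. trajectory F a \<omega> \<epsilon> X \<and> X 0 = x \<and> (\<forall>t\<in>{0..\<epsilon>}. N (X t) \<noteq> 0 \<and> dist x (X t) \<le> B * t)"
      using r(2) unfolding trajectory_def by (intro exI[of _ X]) blast
  qed
qed

text \<open>Prescribing the initial input value is what makes the relation propagate: after a common
  input has been followed up to time \<open>t\<close>, only continuations that start at the current
  input value keep the concatenated input continuous.\<close>

definition agree_from :: "real^3 \<Rightarrow> real^3 \<Rightarrow> 'a \<Rightarrow> 'a \<Rightarrow> bool" where
  "agree_from a0 \<omega>0 x y \<longleftrightarrow> (\<forall>T>0. \<forall>a \<omega> X Y. continuous_on {0..T} a \<longrightarrow> continuous_on {0..T} \<omega> \<longrightarrow>
     a 0 = a0 \<longrightarrow> \<omega> 0 = \<omega>0 \<longrightarrow> trajectory F a \<omega> T X \<longrightarrow> X 0 = x \<longrightarrow> trajectory F a \<omega> T Y \<longrightarrow> Y 0 = y \<longrightarrow>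
     (\<forall>t\<in>{0..T}. \<forall>h\<in>H. h (X t) = h (Y t)))"

lemma agree_from_shift:
  assumes ag: "agree_from (a 0) (\<omega> 0) x y" and c: "continuous_on {0..T} a" "continuous_on {0..T} \<omega>"
    and X: "trajectory F a \<omega> T X" "X 0 = x" and Y: "trajectory F a \<omega> T Y" "Y 0 = y"
    and t: "t \<in> {0..T}"
  shows "agree_from (a t) (\<omega> t) (X t) (Y t)"
  unfolding agree_from_def
proof (intro allI impI ballI)
  fix S a' \<omega>' X' Y' s h
  assume S: "(0::real) < S" and c': "continuous_on {0..S} a'" "continuous_on {0..S} \<omega>'"
    and i: "a' 0 = a t" "\<omega>' 0 = \<omega> t" and X': "trajectory F a' \<omega>' S X'" "X' 0 = X t"
    and Y': "trajectory F a' \<omega>' S Y'" "Y' 0 = Y t" and s: "s \<in> {0..S}" and h: "h \<in> H"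
  have sub: "continuous_on {0..t} a" "continuous_on {0..t} \<omega>"
    "trajectory F a \<omega> t X" "trajectory F a \<omega> t Y"
    using c X Y t by (auto intro: continuous_on_subset trajectory_restrict)
  have "h (then_at t X X' (t + s)) = h (then_at t Y Y' (t + s))"
    using ag[unfolded agree_from_def, rule_format, of "t + S" "then_at t a a'" "then_at t \<omega> \<omega>'"
        "then_at t X X'" "then_at t Y Y'" "t + s" h]
      continuous_on_then_at[OF sub(1) c'(1)] continuous_on_then_at[OF sub(2) c'(2)]
      trajectory_then_at[OF sub(3) X'(1)] trajectory_then_at[OF sub(4) Y'(1)] i X' Y' X Y S t s h
    by (simp add: then_at_def)
  then show "h (X' s) = h (Y' s)"
    using s X' Y' by (cases "s = 0") (auto simp: then_at_def)
qed

lemma along_trajectory: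
  assumes "rational_on N \<phi>" "trajectory F a \<omega> T X" "t \<in> {0..T}" "N (X t) \<noteq> 0"
  shows "((\<lambda>t. \<phi> (X t)) has_vector_derivative lie_derivative (F (a t) (\<omega> t)) \<phi> (X t)) (at t within {0..T})"
proof -
  have "(X has_derivative (\<lambda>h. h *\<^sub>R F (a t) (\<omega> t) (X t))) (at t within {0..T})"
    using assms(2,3) unfolding trajectory_def has_vector_derivative_def by blast
  from has_derivative_compose[OF this rational_on_gradient(1)[OF assms(1,4), unfolded gderiv_def]]
  show ?thesis unfolding has_vector_derivative_def lie_derivative_def
    by (simp add: inner_commute)
qed

text \<open>The input is steered from \<open>(a0, \<omega>0)\<close> to an arbitrary value during a time \<open>\<epsilon>\<close>; differentiating
  the agreement of \<open>\<phi>\<close> at the end and letting \<open>\<epsilon> \<rightarrow> 0\<close> gives the Lie derivatives along all fields,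
  although inputs are required to be continuous.\<close>

lemma agree_from_lie_derivative:
  assumes step: "\<And>a \<omega> x y. N x \<noteq> 0 \<Longrightarrow> N y \<noteq> 0 \<Longrightarrow> agree_from a \<omega> x y \<Longrightarrow> \<phi> x = \<phi> y"
    and \<phi>: "rational_on N \<phi>" and x: "N x \<noteq> 0" and y: "N y \<noteq> 0" and ag: "agree_from a0 \<omega>0 x y"
  shows "lie_derivative (F a1 \<omega>1) \<phi> x = lie_derivative (F a1 \<omega>1) \<phi> y"
proof -
  define M where "M = norm a0 + norm \<omega>0 + norm a1 + norm \<omega>1"
  have M: "0 \<le> M" by (simp add: M_def)
  let ?L = "lie_derivative (F a1 \<omega>1) \<phi>"
  obtain \<delta>x Bx where X: "\<delta>x > 0" "\<And>\<epsilon> a \<omega>. \<lbrakk>0 < \<epsilon>; \<epsilon> \<le> \<delta>x; continuous_on {0..\<epsilon>} a; continuous_on {0..\<epsilon>} \<omega>;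
      \<forall>t\<in>{0..\<epsilon>}. norm (a t) \<le> M \<and> norm (\<omega> t) \<le> M\<rbrakk> \<Longrightarrow>
    \<exists>X. trajectory F a \<omega> \<epsilon> X \<and> X 0 = x \<and> (\<forall>t\<in>{0..\<epsilon>}. N (X t) \<noteq> 0 \<and> dist x (X t) \<le> Bx * t)"
    by (rule trajectory_exists[OF x M]) blast
  obtain \<delta>y By where Y: "\<delta>y > 0" "\<And>\<epsilon> a \<omega>. \<lbrakk>0 < \<epsilon>; \<epsilon> \<le> \<delta>y; continuous_on {0..\<epsilon>} a; continuous_on {0..\<epsilon>} \<omega>;
      \<forall>t\<in>{0..\<epsilon>}. norm (a t) \<le> M \<and> norm (\<omega> t) \<le> M\<rbrakk> \<Longrightarrow>
    \<exists>Y. trajectory F a \<omega> \<epsilon> Y \<and> Y 0 = y \<and> (\<forall>t\<in>{0..\<epsilon>}. N (Y t) \<noteq> 0 \<and> dist y (Y t) \<le> By * t)"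
    by (rule trajectory_exists[OF y M]) blast
  define \<delta> where "\<delta> = min \<delta>x \<delta>y"
  have key: "\<exists>u v. N u \<noteq> 0 \<and> N v \<noteq> 0 \<and> dist x u \<le> Bx * \<epsilon> \<and> dist y v \<le> By * \<epsilon> \<and> ?L u = ?L v"
    if \<epsilon>: "0 < \<epsilon>" "\<epsilon> \<le> \<delta>" for \<epsilon>
  proof -
    define a where "a t = a0 + (t / \<epsilon>) *\<^sub>R (a1 - a0)" for t
    define \<omega> where "\<omega> t = \<omega>0 + (t / \<epsilon>) *\<^sub>R (\<omega>1 - \<omega>0)" for t
    have c: "continuous_on {0..\<epsilon>} a" "continuous_on {0..\<epsilon>} \<omega>"
      unfolding a_def \<omega>_def using \<epsilon> by (auto intro!: continuous_intros)
    have conv: "norm (p + s *\<^sub>R (q - p)) \<le> norm p + norm q" if "0 \<le> s" "s \<le> 1" for s and p q :: "real^3"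
    proof -
      have "p + s *\<^sub>R (q - p) = (1 - s) *\<^sub>R p + s *\<^sub>R q" by (simp add: algebra_simps)
      also have "norm \<dots> \<le> (1 - s) * norm p + s * norm q"
        using that by (intro norm_triangle_le) auto
      also have "\<dots> \<le> norm p + norm q"
        using that by (intro add_mono mult_left_le_one_le) auto
      finally show ?thesis .
    qed
    have b: "\<forall>t\<in>{0..\<epsilon>}. norm (a t) \<le> M \<and> norm (\<omega> t) \<le> M"
    proof
      fix t assume "t \<in> {0..\<epsilon>}"
      then have "0 \<le> t / \<epsilon>" "t / \<epsilon> \<le> 1" using \<epsilon> by auto
      from conv[OF this, of a0 a1] conv[OF this, of \<omega>0 \<omega>1]
      show "norm (a t) \<le> M \<and> norm (\<omega> t) \<le> M"
        unfolding a_def \<omega>_def M_def by (smt (verit) norm_ge_zero)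
    qed
    obtain X where X': "trajectory F a \<omega> \<epsilon> X" "X 0 = x" "\<forall>t\<in>{0..\<epsilon>}. N (X t) \<noteq> 0 \<and> dist x (X t) \<le> Bx * t"
      using X(2)[OF \<epsilon>(1) _ c b] \<epsilon>(2) by (auto simp: \<delta>_def)
    obtain Y where Y': "trajectory F a \<omega> \<epsilon> Y" "Y 0 = y" "\<forall>t\<in>{0..\<epsilon>}. N (Y t) \<noteq> 0 \<and> dist y (Y t) \<le> By * t"
      using Y(2)[OF \<epsilon>(1) _ c b] \<epsilon>(2) by (auto simp: \<delta>_def)
    have ends: "a 0 = a0" "\<omega> 0 = \<omega>0" "a \<epsilon> = a1" "\<omega> \<epsilon> = \<omega>1"
      using \<epsilon> by (auto simp: a_def \<omega>_def)
    \<comment> \<open>The pair reached at time \<open>t\<close> agrees from the current input value,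
      so the hypothesis on \<open>\<phi>\<close> applies along the entire ramp, which allows
      differentiation in \<open>t\<close>.\<close>
    have eq: "\<phi> (X t) = \<phi> (Y t)" if "t \<in> {0..\<epsilon>}" for t
      using agree_from_shift[of a \<omega> x y \<epsilon> X Y t] ag ends X' Y' c that by (intro step) auto
    have e: "\<epsilon> \<in> {0..\<epsilon>}" using \<epsilon> by simp
    \<comment> \<open>The one-sided derivative is taken at the end of the ramp, where the input has
      reached \<open>(a1, \<omega>1)\<close>; this produces the Lie derivative along the target
      field.\<close>
    have "((\<lambda>t. \<phi> (X t)) has_vector_derivative ?L (X \<epsilon>)) (at \<epsilon> within {0..\<epsilon>})"
      "((\<lambda>t. \<phi> (Y t)) has_vector_derivative ?L (Y \<epsilon>)) (at \<epsilon> within {0..\<epsilon>})"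
      using along_trajectory[OF \<phi> X'(1) e] along_trajectory[OF \<phi> Y'(1) e] X'(3) Y'(3) e ends by auto
    moreover from this(2) have "((\<lambda>t. \<phi> (X t)) has_vector_derivative ?L (Y \<epsilon>)) (at \<epsilon> within {0..\<epsilon>})"
      by (rule has_vector_derivative_transform[OF e, rotated]) (use eq in auto)
    ultimately have "?L (X \<epsilon>) = ?L (Y \<epsilon>)"
      using vector_derivative_unique_within_closed_interval[of 0 \<epsilon> \<epsilon>] \<epsilon> e by (metis box_real(2))
    then show ?thesis using X'(3) Y'(3) e by blast
  qed
  define e where "e n = \<delta> / (real n + 1)" for n
  have \<delta>: "\<delta> > 0" using X(1) Y(1) by (simp add: \<delta>_def)
  have e: "0 < e n" "e n \<le> \<delta>" for n using \<delta> by (auto simp: e_def field_simps)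
  have e0: "e \<longlonglongrightarrow> 0"
    using tendsto_mult_right_zero[OF LIMSEQ_inverse_real_of_nat, of \<delta>]
    by (simp add: e_def[abs_def] divide_inverse add.commute)
  obtain u v where uv: "\<And>n. N (u n) \<noteq> 0 \<and> N (v n) \<noteq> 0 \<and> dist x (u n) \<le> Bx * e n \<and>
      dist y (v n) \<le> By * e n \<and> ?L (u n) = ?L (v n)"
    using key[OF e] by metis
  have lim: "(\<lambda>n. ?L (w n)) \<longlonglongrightarrow> ?L z" if "\<And>n. dist z (w n) \<le> K * e n" "N z \<noteq> 0" for w z K
  proof -
    have "(\<lambda>n. K * e n) \<longlonglongrightarrow> 0" by (rule tendsto_mult_right_zero[OF e0])
    then have "(\<lambda>n. dist (w n) z) \<longlonglongrightarrow> 0"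
      by (rule Lim_null_comparison[rotated])
        (use that(1) in \<open>simp add: dist_commute eventually_sequentially\<close>)
    then have "w \<longlonglongrightarrow> z" by (rule tendsto_dist_iff[THEN iffD2])
    moreover have "isCont ?L z"
      by (rule GDERIV_continuous[OF rational_on_gradient(1)[OF
            rational_on_lie_derivative[OF rational_dynamics \<phi>] that(2)]])
    ultimately show ?thesis by (simp add: continuous_within_sequentially isCont_tendsto_compose)
  qed
  have "(\<lambda>n. ?L (u n)) \<longlonglongrightarrow> ?L x" "(\<lambda>n. ?L (v n)) \<longlonglongrightarrow> ?L y"
    by (rule lim[of x u Bx] lim[of y v By]; use uv x y in blast)+
  then show ?thesis using uv LIMSEQ_unique by (metis (no_types, lifting) ext)
qed

text \<open>Induction on the order, with states and initial inputs generalized, because the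
  inductive step needs the claim for \<open>\<psi>\<close> at all pairs that the ramps reach. Drift
  and input fields are values of \<open>F\<close> at fixed inputs or differences of two such values,
  and the Lie derivative is linear in the field.\<close>

lemma agree_from_words:
  assumes "\<phi> \<in> lie_derivatives (system_fields F) H k"
    and "N x \<noteq> 0" "N y \<noteq> 0" "agree_from a0 \<omega>0 x y"
  shows "\<phi> x = \<phi> y"
  using assms
proof (induction k arbitrary: \<phi> x y a0 \<omega>0)
  case 0
  \<comment> \<open>Short trajectories under constant input exist, so the agreement is not vacuous
    and can be read off at time 0.\<close>
  have M: "0 \<le> norm a0 + norm \<omega>0" by simp
  obtain \<delta> Bx where X: "\<delta> > 0" "\<And>\<epsilon> a \<omega>. \<lbrakk>0 < \<epsilon>; \<epsilon> \<le> \<delta>; continuous_on {0..\<epsilon>} a; continuous_on {0..\<epsilon>} \<omega>;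
      \<forall>t\<in>{0..\<epsilon>}. norm (a t) \<le> norm a0 + norm \<omega>0 \<and> norm (\<omega> t) \<le> norm a0 + norm \<omega>0\<rbrakk> \<Longrightarrow>
    \<exists>X. trajectory F a \<omega> \<epsilon> X \<and> X 0 = x \<and> (\<forall>t\<in>{0..\<epsilon>}. N (X t) \<noteq> 0 \<and> dist x (X t) \<le> Bx * t)"
    by (rule trajectory_exists[OF 0(2) M]) blast
  obtain \<delta>' By where Y: "\<delta>' > 0" "\<And>\<epsilon> a \<omega>. \<lbrakk>0 < \<epsilon>; \<epsilon> \<le> \<delta>'; continuous_on {0..\<epsilon>} a; continuous_on {0..\<epsilon>} \<omega>;
      \<forall>t\<in>{0..\<epsilon>}. norm (a t) \<le> norm a0 + norm \<omega>0 \<and> norm (\<omega> t) \<le> norm a0 + norm \<omega>0\<rbrakk> \<Longrightarrow>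
    \<exists>Y. trajectory F a \<omega> \<epsilon> Y \<and> Y 0 = y \<and> (\<forall>t\<in>{0..\<epsilon>}. N (Y t) \<noteq> 0 \<and> dist y (Y t) \<le> By * t)"
    by (rule trajectory_exists[OF 0(3) M]) blast
  let ?T = "min \<delta> \<delta>'"
  obtain X Y where "trajectory F (\<lambda>_. a0) (\<lambda>_. \<omega>0) ?T X" "X 0 = x"
    "trajectory F (\<lambda>_. a0) (\<lambda>_. \<omega>0) ?T Y" "Y 0 = y"
    using X(2)[of ?T "\<lambda>_. a0" "\<lambda>_. \<omega>0"] Y(2)[of ?T "\<lambda>_. a0" "\<lambda>_. \<omega>0"] X(1) Y(1) by auto
  then show ?case
    using 0(4)[unfolded agree_from_def, rule_format, of ?T "\<lambda>_. a0" "\<lambda>_. \<omega>0" X Y 0 \<phi>] 0(1) X(1) Y(1)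
    by auto
next
  case (Suc k)
  then obtain f \<psi> where f: "\<phi> = lie_derivative f \<psi>" "f \<in> system_fields F"
    "\<psi> \<in> lie_derivatives (system_fields F) H k" by auto
  have eq: "lie_derivative (F a \<omega>) \<psi> x = lie_derivative (F a \<omega>) \<psi> y" for a \<omega>
    by (rule agree_from_lie_derivative[OF _ rational_words[OF f(3)] Suc.prems(2,3,4)])
      (rule Suc.IH[OF f(3)])
  have "\<exists>a \<omega> b \<nu>. f = (\<lambda>x. F a \<omega> x) \<or> f = (\<lambda>x. F a \<omega> x - F b \<nu> x)"
    using f(2) unfolding system_fields_def
    by (auto simp: drift_field_def[abs_def] input_field1_def[abs_def] input_field2_def[abs_def] image_iff)
  then show ?case
    unfolding f(1) using eq by (fastforce simp: lie_derivative_def inner_diff_right)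
qed

lemma not_distinguishable_words:
  assumes "\<not> distinguishable F H x y" "N x \<noteq> 0" "N y \<noteq> 0"
    and "\<phi> \<in> lie_derivatives (system_fields F) H k"
  shows "\<phi> x = \<phi> y"
  using assms(1) by (intro agree_from_words[OF assms(4,2,3), of 0 0])
    (auto simp: agree_from_def distinguishable_def)

text \<open>Choose Lie derivatives whose gradients at \<open>x\<close> form a basis. The map they
  define has an injective derivative at \<open>x\<close>, hence is injective near \<open>x\<close>,
  while undistinguished states have equal images.\<close>

lemma full_rank_imp_weakly_observable:
  assumes x: "N x \<noteq> 0" and full: "codistribution (system_fields F) H k x = UNIV"
  shows "weakly_observable F H x"
proof -
  let ?W = "{\<phi>. \<exists>j\<le>k. \<phi> \<in> lie_derivatives (system_fields F) H j}"
  let ?G = "(\<lambda>\<phi>. grad \<phi> x) ` ?W"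
  have "?G = {grad \<phi> x | \<phi> j. j \<le> k \<and> \<phi> \<in> lie_derivatives (system_fields F) H j}"
    by blast
  then have "span ?G = UNIV" using full unfolding codistribution_def by simp
  moreover obtain B where "B \<subseteq> ?G" "independent B" "?G \<subseteq> span B"
    by (rule maximal_independent_subset)
  ultimately have B: "B \<subseteq> ?G" "independent B" "span B = UNIV"
    using span_mono[of ?G "span B"] by (auto simp: span_span)
  have finB: "finite B" using B(2) by (rule independent_imp_finite)
  have "\<forall>b\<in>B. \<exists>\<phi>. \<phi> \<in> ?W \<and> grad \<phi> x = b"
    using B(1) by blast
  from bchoice[OF this] obtain \<phi> where \<phi>: "\<And>b. b \<in> B \<Longrightarrow> \<phi> b \<in> ?W \<and> grad (\<phi> b) x = b"
    by blast
  have rat: "rational_on N (\<phi> b)" if "b \<in> B" for b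
    using \<phi>[OF that] rational_words by blast
  \<comment> \<open>Each function is weighted by its own gradient at \<open>x\<close>. This gives a
    map of the state space into itself, without a choice of coordinates, whose derivative at
    \<open>x\<close> sends \<open>h\<close> to
    \<open>\<Sum>b\<in>B. (h \<bullet> b) *\<^sub>R b\<close>.\<close>
  define P where "P y = (\<Sum>b\<in>B. \<phi> b y *\<^sub>R b)" for y
  define P' where "P' y h = (\<Sum>b\<in>B. (h \<bullet> grad (\<phi> b) y) *\<^sub>R b)" for y h
  have der: "(P has_derivative P' y) (at y)" if "N y \<noteq> 0" for y
    unfolding P_def[abs_def] P'_def[abs_def]
    using rational_on_gradient(1)[OF rat that] unfolding gderiv_def
    by (intro has_derivative_sum has_derivative_scaleR_left) auto
  have bl: "bounded_linear (P' y)" if "N y \<noteq> 0" for y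
    using der[OF that] by (rule has_derivative_bounded_linear)
  have inj: "inj (P' x)"
  proof -
    have "h = 0" if "P' x h = 0" for h
    proof -
      have "(\<Sum>b\<in>B. (h \<bullet> b) *\<^sub>R b) = 0" using that \<phi> unfolding P'_def by (simp cong: sum.cong)
      then have "\<forall>b\<in>B. h \<bullet> b = 0"
        using B(2) finB by (auto simp: independent_explicit)
      then have "\<forall>b\<in>span B. h \<bullet> b = 0"
        by (metis orthogonal_def orthogonal_to_span)
      then show ?thesis using B(3) by (metis UNIV_I inner_eq_zero_iff)
    qed
    then show ?thesis using bl[OF x] by (simp add: linear_injective_0 bounded_linear.linear)
  qed
  then obtain Q where Q: "linear Q" "Q \<circ> P' x = id"
    using linear_injective_left_inverse bl[OF x] bounded_linear.linear by blast
  obtain r where r: "r > 0" "ball x r \<subseteq> {x. N x \<noteq> 0}" "inj_on P (ball x r)"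
  proof (rule has_derivative_locally_injective[of x "{x. N x \<noteq> 0}" Q P' P])
    show "bounded_linear Q" using Q(1) by (rule linear_conv_bounded_linear[THEN iffD1])
    fix e :: real assume e: "e > 0"
    \<comment> \<open>The operator norm of the difference of the derivatives is at most the gradient
      deviation \<open>c\<close> times the sum of the norms of the basis vectors, and has to stay
      below \<open>e\<close>; the summand 1 keeps the quotient defined.\<close>
    define c where "c = e / (2 * ((\<Sum>b\<in>B. norm b) + 1))"
    have S0: "0 \<le> (\<Sum>b\<in>B. norm b)" by (simp add: sum_nonneg)
    have c: "c > 0" "c * (\<Sum>b\<in>B. norm b) < e"
    proof -
      show "c > 0" using e S0 by (auto simp: c_def intro!: divide_pos_pos)
      have "c * ((\<Sum>b\<in>B. norm b) + 1) = e / 2" using S0 by (simp add: c_def field_simps)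
      then show "c * (\<Sum>b\<in>B. norm b) < e" using \<open>c > 0\<close> e by (simp add: algebra_simps)
    qed
    have "\<forall>b\<in>B. \<forall>\<^sub>F y in at x. dist (grad (\<phi> b) y) (grad (\<phi> b) x) < c"
    proof
      fix b assume b: "b \<in> B"
      have "continuous_on {x. N x \<noteq> 0} (grad (\<phi> b))"
        by (intro rational_field_continuous rational_on_gradient rat b)
      then have "isCont (grad (\<phi> b)) x"
        using open_domain x by (simp add: continuous_on_eq_continuous_at)
      then show "\<forall>\<^sub>F y in at x. dist (grad (\<phi> b) y) (grad (\<phi> b) x) < c"
        using c(1) by (simp add: isCont_def tendsto_iff)
    qed
    then have "\<forall>\<^sub>F y in at x. \<forall>b\<in>B. dist (grad (\<phi> b) y) (grad (\<phi> b) x) < c"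
      using finB by (simp add: eventually_ball_finite_distrib)
    then obtain d where d: "d > 0" "\<And>y. y \<noteq> x \<Longrightarrow> dist y x < d \<Longrightarrow> \<forall>b\<in>B. dist (grad (\<phi> b) y) (grad (\<phi> b) x) < c"
      unfolding eventually_at by blast
    have "onorm (\<lambda>v. P' y v - P' x v) < e" if y: "dist x y < d" for y
    proof -
      have close: "norm (grad (\<phi> b) y - grad (\<phi> b) x) \<le> c" if "b \<in> B" for b
        using d(2)[of y] y that c(1) by (cases "y = x") (auto simp: dist_commute dist_norm[symmetric] less_imp_le)
      have "onorm (\<lambda>v. P' y v - P' x v) \<le> c * (\<Sum>b\<in>B. norm b)"
      proof (rule onorm_le)
        fix v
        have "P' y v - P' x v = (\<Sum>b\<in>B. (v \<bullet> (grad (\<phi> b) y - grad (\<phi> b) x)) *\<^sub>R b)"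
          unfolding P'_def by (simp add: inner_diff_right scaleR_diff_left sum_subtractf)
        also have "norm \<dots> \<le> (\<Sum>b\<in>B. (norm v * c) * norm b)"
        proof (rule sum_norm_le)
          fix b assume b: "b \<in> B"
          have "\<bar>v \<bullet> (grad (\<phi> b) y - grad (\<phi> b) x)\<bar> \<le> norm v * norm (grad (\<phi> b) y - grad (\<phi> b) x)"
            by (rule Cauchy_Schwarz_ineq2)
          also have "\<dots> \<le> norm v * c" using close[OF b] by (intro mult_left_mono) auto
          finally have "\<bar>v \<bullet> (grad (\<phi> b) y - grad (\<phi> b) x)\<bar> \<le> norm v * c" .
          then show "norm ((v \<bullet> (grad (\<phi> b) y - grad (\<phi> b) x)) *\<^sub>R b) \<le> norm v * c * norm b"
            by (simp add: mult_right_mono)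
        qed
        finally show "norm (P' y v - P' x v) \<le> c * (\<Sum>b\<in>B. norm b) * norm v"
          by (simp add: sum_distrib_left mult_ac)
      qed
      with c(2) show ?thesis by simp
    qed
    with d(1) show "\<exists>d>0. \<forall>y. dist x y < d \<longrightarrow> onorm (\<lambda>v. P' y v - P' x v) < e" by blast
  qed (use x open_domain Q(2) der in auto)
  show ?thesis
    unfolding weakly_observable_def
  proof (intro exI[of _ "ball x r"] conjI ballI impI)
    fix y assume y: "y \<in> ball x r" "y \<noteq> x"
    show "distinguishable F H x y"
    proof (rule ccontr)
      assume "\<not> distinguishable F H x y"
      then have "\<phi> b x = \<phi> b y" if "b \<in> B" for b
        using not_distinguishable_words[OF _ x] \<phi>[OF that] r(2) y(1) by blast
      then have "P x = P y" unfolding P_def by simp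
      then show False using r y by (auto dest: inj_onD)
    qed
  qed (use r in auto)
qed

end

section \<open>Polynomial expressions and their Lie derivatives\<close>

text \<open>Integer coefficients make evaluation at an integer point an exact ground computation, so
  the rank at that point can be checked by rewriting.\<close>

datatype pexp = PC int | PV nat | PAdd pexp pexp | PMul pexp pexp

instantiation pexp :: "{plus, times, minus, uminus, zero, one}"
begin
definition "p + q = PAdd p q" for p q :: pexp
definition "p * q = PMul p q" for p q :: pexp
definition "- p = PMul (PC (- 1)) p" for p :: pexp
definition "p - q = PAdd p (PMul (PC (- 1)) q)" for p q :: pexp
definition "0 = PC 0"
definition "1 = PC 1"
instance ..
end

lemmas pexp_ops = plus_pexp_def times_pexp_def uminus_pexp_def minus_pexp_def zero_pexp_def one_pexp_def

fun peval :: "(nat \<Rightarrow> real) \<Rightarrow> pexp \<Rightarrow> real" where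
  "peval z (PC c) = of_int c"
| "peval z (PV i) = z i"
| "peval z (PAdd p q) = peval z p + peval z q"
| "peval z (PMul p q) = peval z p * peval z q"

lemma peval_ops [simp]:
  "peval z (p + q) = peval z p + peval z q" "peval z (p * q) = peval z p * peval z q"
  "peval z (- p) = - peval z p" "peval z (p - q) = peval z p - peval z q"
  "peval z 0 = 0" "peval z 1 = 1"
  by (simp_all add: pexp_ops)

fun pvars :: "pexp \<Rightarrow> nat set" where
  "pvars (PC c) = {}"
| "pvars (PV i) = {i}"
| "pvars (PAdd p q) = pvars p \<union> pvars q"
| "pvars (PMul p q) = pvars p \<union> pvars q"

text \<open>The derivation determined by its values \<open>F i\<close> on the variables, that is,
  the Lie derivative along a polynomial vector field carried out on syntax. In contrast,
  \<open>pdir\<close> is the differential at a point \<open>z\<close>, evaluated in the direction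
  \<open>\<xi>\<close>.\<close>

fun pdiff :: "(nat \<Rightarrow> pexp) \<Rightarrow> pexp \<Rightarrow> pexp" where
  "pdiff F (PC c) = PC 0"
| "pdiff F (PV i) = F i"
| "pdiff F (PAdd p q) = PAdd (pdiff F p) (pdiff F q)"
| "pdiff F (PMul p q) = PAdd (PMul (pdiff F p) q) (PMul p (pdiff F q))"

fun pdir :: "(nat \<Rightarrow> real) \<Rightarrow> (nat \<Rightarrow> real) \<Rightarrow> pexp \<Rightarrow> real" where
  "pdir z \<xi> (PC c) = 0"
| "pdir z \<xi> (PV i) = \<xi> i"
| "pdir z \<xi> (PAdd p q) = pdir z \<xi> p + pdir z \<xi> q"
| "pdir z \<xi> (PMul p q) = pdir z \<xi> p * peval z q + peval z p * pdir z \<xi> q"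

lemma pvars_pdiff: "pvars (pdiff F p) \<subseteq> pvars p \<union> (\<Union>i\<in>pvars p. pvars (F i))"
  by (induction p) auto

lemma pdir_cong: "(\<And>i. i \<in> pvars p \<Longrightarrow> \<xi> i = \<zeta> i) \<Longrightarrow> pdir z \<xi> p = pdir z \<zeta> p"
  by (induction p) auto

text \<open>Linearity in \<open>\<xi>\<close>, with explicit coefficients, so that expressions
  become matrix rows for \<open>generically_at_trivial_kernel\<close>.\<close>

lemma pdir_expand:
  assumes "finite J" "pvars p \<subseteq> J"
  shows "pdir z \<xi> p = (\<Sum>j\<in>J. pdir z (\<lambda>i. if i = j then 1 else 0) p * \<xi> j)"
  using assms(2)
proof (induction p)
  case (PV i)
  then show ?case using assms(1) by (simp add: if_distrib[of "\<lambda>x. x * _"] cong: if_cong)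
qed (auto simp: sum.distrib sum_distrib_left sum_distrib_right algebra_simps)

definition pword :: "(nat \<Rightarrow> nat \<Rightarrow> pexp) \<Rightarrow> nat list \<Rightarrow> pexp \<Rightarrow> pexp" where
  "pword F w p = foldl (\<lambda>p a. pdiff (F a) p) p w"

lemma pword_simps [simp]:
  "pword F [] p = p" "pword F (a # w) p = pword F w (pdiff (F a) p)"
  "pword F (w @ [a]) p = pdiff (F a) (pword F w p)"
  by (simp_all add: pword_def)

lemma pvars_pword:
  assumes "pvars h \<subseteq> V" "\<And>a i. a \<in> set w \<Longrightarrow> i \<in> V \<Longrightarrow> pvars (F a i) \<subseteq> V"
  shows "pvars (pword F w h) \<subseteq> V"
  using assms
proof (induction w arbitrary: h)
  case (Cons a w)
  then have "pvars (pdiff (F a) h) \<subseteq> V" using pvars_pdiff[of "F a" h] by fastforce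
  with Cons show ?case by simp
qed simp

context rational_domain
begin

lemma rational_on_peval:
  assumes "\<And>i. i \<in> pvars p \<Longrightarrow> rational_on N (Z i)"
  shows "rational_on N (\<lambda>x. peval (\<lambda>i. Z i x) p)"
  using assms by (induction p) (auto intro!: rational_intros)

lemma rational_on_pdir:
  assumes "\<And>i. i \<in> pvars p \<Longrightarrow> rational_on N (Z i)"
  shows "rational_on N (\<lambda>x. pdir (\<lambda>i. Z i x) \<xi> p)"
  using assms by (induction p) (auto intro!: rational_intros rational_on_peval)

text \<open>Chain rule: a direction \<open>v\<close> in the state space enters only through the
  induced rates \<open>grad (Z i) x \<bullet> v\<close> of the substituted functions.\<close>

lemma grad_peval:
  assumes "\<And>i. i \<in> pvars p \<Longrightarrow> rational_on N (Z i)" "N x \<noteq> 0"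
  shows "grad (\<lambda>x. peval (\<lambda>i. Z i x) p) x \<bullet> v = pdir (\<lambda>i. Z i x) (\<lambda>i. grad (Z i) x \<bullet> v) p"
  using assms
proof (induction p)
  case (PAdd p q)
  then show ?case
    by (simp add: grad_add rational_on_peval inner_add_left)
next
  case (PMul p q)
  then show ?case
    by (simp add: grad_mult rational_on_peval inner_add_left mult.commute)
qed (auto simp: grad_const)

lemma lie_derivative_peval:
  assumes "\<And>i. i \<in> pvars p \<Longrightarrow> rational_on N (Z i)" "N x \<noteq> 0"
    and "\<And>i. i \<in> pvars p \<Longrightarrow> lie_derivative f (Z i) x = peval (\<lambda>i. Z i x) (F i)"
  shows "lie_derivative f (\<lambda>x. peval (\<lambda>i. Z i x) p) x = peval (\<lambda>i. Z i x) (pdiff F p)"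
proof -
  have "pdir (\<lambda>i. Z i x) (\<lambda>i. grad (Z i) x \<bullet> f x) p = peval (\<lambda>i. Z i x) (pdiff F p)"
    using assms(3) by (induction p) (auto simp: lie_derivative_def algebra_simps)
  then show ?thesis using grad_peval[OF assms(1,2)] by (simp add: lie_derivative_def)
qed

text \<open>Once the functions \<open>Z i\<close> obey a closed polynomial system, differentiation
  along a word happens entirely in syntax. The representation holds off the zeros of
  \<open>N\<close>, which by \<open>grad_cong\<close> is enough to differentiate again. The
  induction strips the last letter, the one differentiated last.\<close>

lemma pword_in_lie_derivatives:
  assumes Z: "\<And>i. i \<in> V \<Longrightarrow> rational_on N (Z i)"
    and F: "\<And>a i. a \<in> set w \<Longrightarrow> i \<in> V \<Longrightarrow> pvars (F a i) \<subseteq> V"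
    and lie: "\<And>a i x. a \<in> set w \<Longrightarrow> i \<in> V \<Longrightarrow> N x \<noteq> 0 \<Longrightarrow>
      lie_derivative (f a) (Z i) x = peval (\<lambda>i. Z i x) (F a i)"
    and fields: "\<And>a. a \<in> set w \<Longrightarrow> f a \<in> S"
    and h: "pvars h \<subseteq> V" "(\<lambda>x. peval (\<lambda>i. Z i x) h) \<in> H"
  shows "\<exists>\<phi>\<in>lie_derivatives S H (length w). \<forall>x. N x \<noteq> 0 \<longrightarrow> \<phi> x = peval (\<lambda>i. Z i x) (pword F w h)"
  using F lie fields
proof (induction w rule: rev_induct)
  case Nil
  then show ?case using h by (auto intro!: bexI[of _ "\<lambda>x. peval (\<lambda>i. Z i x) h"])
next
  case (snoc a w)
  then obtain \<phi> where \<phi>: "\<phi> \<in> lie_derivatives S H (length w)"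
    "\<And>x. N x \<noteq> 0 \<Longrightarrow> \<phi> x = peval (\<lambda>i. Z i x) (pword F w h)" by auto
  have v: "pvars (pword F w h) \<subseteq> V" using h(1) snoc.prems by (intro pvars_pword) auto
  have "lie_derivative (f a) \<phi> x = peval (\<lambda>i. Z i x) (pword F (w @ [a]) h)" if x: "N x \<noteq> 0" for x
  proof -
    have "grad (\<lambda>x. peval (\<lambda>i. Z i x) (pword F w h)) x = grad \<phi> x"
      using v Z \<phi>(2) x by (intro grad_cong rational_on_peval) auto
    then have "lie_derivative (f a) \<phi> x = lie_derivative (f a) (\<lambda>x. peval (\<lambda>i. Z i x) (pword F w h)) x"
      by (simp add: lie_derivative_def)
    also have "\<dots> = peval (\<lambda>i. Z i x) (pdiff (F a) (pword F w h))"
      using v Z snoc.prems x by (intro lie_derivative_peval) auto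
    finally show ?thesis by simp
  qed
  moreover have "lie_derivative (f a) \<phi> \<in> lie_derivatives S H (length (w @ [a]))"
    using \<phi>(1) snoc.prems(3) by auto
  ultimately show ?case by blast
qed

end

section \<open>Evaluation of iterated derivatives by nested dual numbers\<close>

text \<open>Sparse linear forms in \<open>\<xi>\<close>: pairs of a variable index and a
  coefficient, merged by increasing index so that equal indices meet. Entries that cancel are
  dropped, hence a combination in which a single variable survives is literally a one-element
  list.\<close>

fun lf_add :: "(int \<times> int) list \<Rightarrow> (int \<times> int) list \<Rightarrow> (int \<times> int) list" where
  "lf_add [] ys = ys"
| "lf_add xs [] = xs"
| "lf_add ((i, a) # xs) ((j, b) # ys) =
    (if i < j then (i, a) # lf_add xs ((j, b) # ys)
     else if j < i then (j, b) # lf_add ((i, a) # xs) ys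
     else if a + b = 0 then lf_add xs ys else (i, a + b) # lf_add xs ys)"

fun lf_scale :: "int \<Rightarrow> (int \<times> int) list \<Rightarrow> (int \<times> int) list" where
  "lf_scale c xs = (if c = 0 then [] else map (\<lambda>(i, a). (i, c * a)) xs)"

fun lf_eval :: "(nat \<Rightarrow> real) \<Rightarrow> (int \<times> int) list \<Rightarrow> real" where
  "lf_eval \<xi> [] = 0"
| "lf_eval \<xi> ((i, a) # xs) = of_int a * \<xi> (nat i) + lf_eval \<xi> xs"

lemma lf_eval_add [simp]: "lf_eval \<xi> (lf_add xs ys) = lf_eval \<xi> xs + lf_eval \<xi> ys"
proof (induction xs ys rule: lf_add.induct)
  case (3 i a xs j b ys)
  show ?case
  proof (cases "i = j")
    case True
    have "of_int a * \<xi> (nat j) + of_int b * \<xi> (nat j) = 0" if "a + b = 0"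
      using that by (metis distrib_right mult_zero_left of_int_0 of_int_add)
    with 3 True show ?thesis by (auto simp: algebra_simps)
  qed (use 3 in auto)
qed auto

lemma lf_eval_scale [simp]: "lf_eval \<xi> (lf_scale c xs) = of_int c * lf_eval \<xi> xs"
  by (induction xs) (auto simp: algebra_simps)

declare lf_scale.simps [simp del]

text \<open>A leaf holds a value and its differential in \<open>\<xi>\<close>; a node
  \<open>JN p q\<close> is the dual number \<open>p + \<epsilon> q\<close>. One level per letter
  evaluates an iterated Lie derivative together with its differential at a point, without expanding
  the expression \<open>pword\<close>.\<close>

datatype jet = JL int "(int \<times> int) list" | JN jet jet

fun jadd :: "jet \<Rightarrow> jet \<Rightarrow> jet" where
  "jadd (JL a x) (JL b y) = JL (a + b) (lf_add x y)"
| "jadd (JN p q) (JN r s) = JN (jadd p r) (jadd q s)"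
| "jadd _ _ = JL 0 []"

fun jmul :: "jet \<Rightarrow> jet \<Rightarrow> jet" where
  "jmul (JL a x) (JL b y) = JL (a * b) (lf_add (lf_scale a y) (lf_scale b x))"
| "jmul (JN p q) (JN r s) = JN (jmul p r) (jadd (jmul q r) (jmul p s))"
| "jmul _ _ = JL 0 []"

fun jconst :: "nat list \<Rightarrow> int \<Rightarrow> jet" where
  "jconst [] c = JL c []"
| "jconst (_ # w) c = JN (jconst w c) (jconst w 0)"

fun jeval :: "nat list \<Rightarrow> jet list \<Rightarrow> pexp \<Rightarrow> jet" where
  "jeval w e (PC c) = jconst w c"
| "jeval w e (PV i) = e ! i"
| "jeval w e (PAdd p q) = jadd (jeval w e p) (jeval w e q)"
| "jeval w e (PMul p q) = jmul (jeval w e p) (jeval w e q)"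

text \<open>The infinitesimal part at every level carries the derivative along all letters of the
  word; the linear form at the leaf is the differential of that derivative.\<close>

fun jtop :: "jet \<Rightarrow> (int \<times> int) list" where
  "jtop (JL a x) = x"
| "jtop (JN p q) = jtop q"

fun jbase :: "int \<Rightarrow> int list \<Rightarrow> jet list" where
  "jbase i [] = []"
| "jbase i (c # cs) = JL c [(i, 1)] # jbase (i + 1) cs"

text \<open>The environment for the word \<open>a # w\<close> replaces each variable \<open>z\<close> by \<open>z + \<epsilon> F a z\<close>,
  so that the \<open>\<epsilon>\<close>-part of the value of an expression is the value of its derivative along \<open>F a\<close>.\<close>

fun jenv :: "(nat \<Rightarrow> pexp list) \<Rightarrow> int list \<Rightarrow> nat list \<Rightarrow> jet list" where
  "jenv F z [] = jbase 0 z"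
| "jenv F z (a # w) = (let e = jenv F z w in map2 (\<lambda>x p. JN x (jeval w e p)) e (F a))"

definition jrow :: "(nat \<Rightarrow> pexp list) \<Rightarrow> int list \<Rightarrow> pexp list \<Rightarrow> nat list \<Rightarrow> (int \<times> int) list list" where
  "jrow F z hs w = (let e = jenv F z w in map (\<lambda>h. jtop (jeval w e h)) hs)"

lemma length_jbase [simp]: "length (jbase i z) = length z"
  by (induction z arbitrary: i) auto

lemma nth_jbase: "k < length z \<Longrightarrow> jbase i z ! k = JL (z ! k) [(i + int k, 1)]"
  by (induction z arbitrary: i k) (auto simp: nth_Cons split: nat.splits)

context
  fixes F :: "nat \<Rightarrow> pexp list" and z :: "int list" and A :: "nat set"
  assumes length_F: "\<And>a. length (F a) = length z"
    and pvars_F: "\<And>a i. a \<in> A \<Longrightarrow> i < length z \<Longrightarrow> pvars (F a ! i) \<subseteq> {..<length z}"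
begin

lemma length_jenv [simp]: "length (jenv F z w) = length z"
  by (induction w) (auto simp: Let_def length_F)

text \<open>The \<open>JN\<close> clauses of \<open>jadd\<close> and \<open>jmul\<close> are the sum
  and product rules. The outermost level belongs to the first letter, the one applied first, which
  matches \<open>pword\<close>.\<close>

lemma jeval_Cons:
  assumes "pvars p \<subseteq> {..<length z}"
  shows "jeval (a # w) (jenv F z (a # w)) p =
    JN (jeval w (jenv F z w) p) (jeval w (jenv F z w) (pdiff (\<lambda>i. F a ! i) p))"
  using assms by (induction p) (auto simp: Let_def length_F)

lemma jtop_jeval:
  assumes "pvars p \<subseteq> {..<length z}" "set w \<subseteq> A"
  shows "jtop (jeval w (jenv F z w) p) = jtop (jeval [] (jbase 0 z) (pword (\<lambda>a i. F a ! i) w p))"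
  using assms
proof (induction w arbitrary: p)
  case (Cons a w)
  have "pvars (pdiff (\<lambda>i. F a ! i) p) \<subseteq> {..<length z}"
  proof (intro order_trans[OF pvars_pdiff] Un_least UN_least)
    fix i assume "i \<in> pvars p"
    then show "pvars (F a ! i) \<subseteq> {..<length z}"
      using Cons.prems by (intro pvars_F) auto
  qed (use Cons.prems in auto)
  with Cons.IH Cons.prems(2) show ?case
    by (simp only: jeval_Cons[OF Cons.prems(1)] jtop.simps pword_simps set_simps insert_subset)
qed simp

lemma jeval_base:
  assumes "pvars p \<subseteq> {..<length z}"
  shows "\<exists>c l. jeval [] (jbase 0 z) p = JL c l \<and> of_int c = peval (\<lambda>i. of_int (z ! i)) p
    \<and> lf_eval \<xi> l = pdir (\<lambda>i. of_int (z ! i)) \<xi> p"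
  using assms by (induction p) (auto simp: nth_jbase)

lemma lf_eval_jrow:
  assumes "\<forall>h\<in>set hs. pvars h \<subseteq> {..<length z}" and w: "set w \<subseteq> A"
    and "\<forall>h\<in>set hs. pdir (\<lambda>i. of_int (z ! i)) \<xi> (pword (\<lambda>a i. F a ! i) w h) = 0"
  shows "\<forall>l\<in>set (jrow F z hs w). lf_eval \<xi> l = 0"
proof -
  have "lf_eval \<xi> (jtop (jeval w (jenv F z w) h)) = 0" if h: "h \<in> set hs" for h
  proof -
    have "pvars (pword (\<lambda>a i. F a ! i) w h) \<subseteq> {..<length z}"
      using assms(1) h w pvars_F by (intro pvars_pword) blast+
    from jeval_base[OF this, of \<xi>] obtain c l where
      "jeval [] (jbase 0 z) (pword (\<lambda>a i. F a ! i) w h) = JL c l" "lf_eval \<xi> l = 0"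
      using assms(3) h by auto
    then show ?thesis using jtop_jeval[of h w] assms(1) w h by simp
  qed
  then show ?thesis unfolding jrow_def by (auto simp: Let_def)
qed

end

section \<open>The camera-frame system\<close>

abbreviation pcross :: "(nat \<Rightarrow> pexp) \<Rightarrow> (nat \<Rightarrow> pexp) \<Rightarrow> nat \<Rightarrow> pexp" where
  "pcross u v i \<equiv> u ((i + 1) mod 3) * v ((i + 2) mod 3) - u ((i + 2) mod 3) * v ((i + 1) mod 3)"

text \<open>Variables \<open>0..51\<close>, matrices columnwise: \<open>\<gamma>\<close> (0), \<open>s\<close> (2), \<open>W\<close> (5), \<open>K\<close> (14), \<open>c\<close> (23), \<open>\<nu>\<close> (26),
  \<open>\<Lambda>\<close> (29), \<open>\<delta>\<close> (38), \<open>\<Gamma>\<close> (41), intrinsic parameters (44). Field \<open>0\<close> is the drift, \<open>1..3\<close> belong to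
  the accelerometer, \<open>4..6\<close> to the gyroscope. The camera-frame rotation rate is \<open>c + K a + W \<omega>\<close>.\<close>

definition cam_fields :: "nat \<Rightarrow> pexp list" where
  "cam_fields a =
    (let \<Omega> = (\<lambda>i. PV (if a = 0 then 23 + i else if a \<le> 3 then 11 + 3 * a + i else 3 * a + i - 7));
         e = (\<lambda>i. if i = 2 then PV 4 - 1 else PV (2 + i) - PV i);
         u = (\<lambda>i. if a = 0 then pcross \<Omega> e i - PV (26 + i) else pcross \<Omega> e i);
         \<eta> = u 2;
         \<nu> = (\<lambda>i. PV (26 + i)); \<Gamma> = (\<lambda>i. PV (41 + i))
     in [u 0 - \<eta> * PV 0, u 1 - \<eta> * PV 1] @ map (\<lambda>i. - (\<eta> * PV i)) [2,3,4] @ replicate 21 0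
        @ map (\<lambda>i. pcross \<nu> \<Omega> i - \<eta> * \<nu> i +
             (if a = 0 then PV (38 + i) + \<Gamma> i else if a \<le> 3 then PV (26 + 3 * a + i) else 0)) [0,1,2]
        @ map (\<lambda>i. - (\<eta> * PV i)) [29,30,31,32,33,34,35,36,37,38,39,40]
        @ map (\<lambda>i. pcross \<Gamma> \<Omega> i - \<eta> * \<Gamma> i) [0,1,2] @ replicate 8 0)"

definition cam_outputs :: "pexp list" where
  "cam_outputs = (let x = PV 0; y = PV 1; r = x * x + y * y; d = 1 + PV 48 * r + PV 49 * (r * r);
      t = x * y in
     [PV 44 * (x * d + PC 2 * PV 50 * t + PV 51 * (r + PC 2 * (x * x))) + PV 46,
      PV 45 * (y * d + PV 50 * (r + PC 2 * (y * y)) + PC 2 * PV 51 * t) + PV 47])"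

text \<open>\<open>W\<close> and \<open>\<Lambda>\<close> are the identity, \<open>K\<close>,
  \<open>c\<close> and \<open>\<delta>\<close> vanish, and \<open>s\<close> minus the homogeneous
  image point equals \<open>- \<nu>\<close>, the first unit vector, so that the drift has
  \<open>\<eta> = 0\<close>. \<open>\<Gamma>\<close> is nonzero because the gravity norm has to
  detect the remaining scale there.\<close>

definition base_point :: "int list" where
  "base_point = [-1,0, 0,0,1, 1,0,0,0,1,0,0,0,1, 0,0,0,0,0,0,0,0,0, 0,0,0, -1,0,0,
     1,0,0,0,1,0,0,0,1, 0,0,0, 0,1,0, 1,1,0,0,0,0,1,0]"




fun lf_combination :: "int list \<Rightarrow> (int \<times> int) list list \<Rightarrow> (int \<times> int) list" where
  "lf_combination (c # cs) (r # rs) = lf_add (lf_scale c r) (lf_combination cs rs)"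
| "lf_combination _ _ = []"

text \<open>Elimination is not carried out in the logic: a certificate entry supplies the
  coefficients of a combination, and checking it means seeing that a single nonzero coefficient
  remains.\<close>

definition isolates :: "(int \<times> int) list list \<Rightarrow> int \<times> int list \<Rightarrow> bool" where
  "isolates ls p = (case lf_combination (snd p) ls of [(j, d)] \<Rightarrow> j = fst p \<and> d \<noteq> 0 | _ \<Rightarrow> False)"

lemma lf_eval_combination:
  "\<forall>l\<in>set ls. lf_eval \<xi> l = 0 \<Longrightarrow> lf_eval \<xi> (lf_combination cs ls) = 0"
  by (induction cs ls rule: lf_combination.induct) auto

lemma isolates_imp_zero:
  assumes "isolates ls (i, cs)" "\<forall>l\<in>set ls. lf_eval \<xi> l = 0"
  shows "\<xi> (nat i) = 0"
proof -
  obtain d where "lf_combination cs ls = [(i, d)]" "d \<noteq> 0"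
    using assms(1) unfolding isolates_def
    by (cases "lf_combination cs ls"; cases "tl (lf_combination cs ls)") auto
  with lf_eval_combination[OF assms(2), of cs] show ?thesis by simp
qed

text \<open>Entries at variables already known to vanish may be deleted. The third-order rows also
  contain variables of \<open>atoms2\<close>; after deletion their certificate concerns only the
  remaining 24.\<close>

lemma lf_eval_filter:
  assumes "\<And>i. \<not> P i \<Longrightarrow> \<xi> (nat i) = 0"
  shows "lf_eval \<xi> (filter (\<lambda>p. P (fst p)) l) = lf_eval \<xi> l"
  using assms by (induction l) auto

text \<open>A word lists fields in the order of differentiation, the first letter being applied first.\<close>

definition words2 :: "nat list list" where
  "words2 = [[], [4], [5], [6], [0], [4,5], [4,6], [4,0], [5,5], [5,6], [5,0], [6,5], [6,6], [0,4], [0,6]]"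

text \<open>One-letter words occur here because \<open>K\<close> enters through the accelerometer
  fields. \<open>[j]\<close> and \<open>[j,5]\<close> determine column \<open>j\<close> of
  \<open>K\<close>; \<open>[j]\<close>, \<open>[0,j]\<close> and \<open>[0,4,j]\<close> determine
  that of \<open>\<Lambda>\<close>. The word \<open>[0,0]\<close> involves \<open>\<delta>\<close>
  and \<open>\<Gamma>\<close> only through their sum; further gyroscope derivatives separate them,
  since they rotate \<open>\<Gamma>\<close> but not \<open>\<delta>\<close>.\<close>

definition words3 :: "nat list list" where
  "words3 = [[1], [2], [3], [1,5], [2,5], [3,5], [0,1], [0,2], [0,3], [0,4,1], [0,4,2], [0,4,3], [0,0], [0,0,4], [0,4,0], [0,0,5]]"

text \<open>The variables \<open>\<gamma>\<close>, \<open>s\<close>, \<open>W\<close>,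
  \<open>c\<close>, \<open>\<nu>\<close> and the intrinsic parameters, 14 + 6 + 8 in number.\<close>

definition atoms2 :: "nat set" where
  "atoms2 = {i. i < 14 \<or> 23 \<le> i \<and> i < 29 \<or> 44 \<le> i \<and> i < 52}"

text \<open>A pair \<open>(i, cs)\<close> gives the integer combination of the rows that isolates variable \<open>i\<close>; these are the
  rows of a left inverse of the coefficient matrix, cleared of denominators.\<close>

definition certificate2 :: "(int \<times> int list) list" where
  "certificate2 = [
    (0, [0, 0, -5935, -2138, 3518, 3478, 174, -300, 2678, 2734, 1380, 6, 0, -1377, 303, -78,
    534, 618, 2598, 1074, 534, 609, -459, 0, 306, 612, 0, 0, 1536, 768]), (1, [0, 0, 10489,
    6494, 5686, 7874, 7206, 1020, 8542, 2606, -588, 390, 0, 783, 2595, 1770, -2226, -1896,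
    -2472, 42, -2226, 597, -81, 0, -630, -234, 0, 0, 1344, 672]), (2, [0, 0, -961, -146, -1594,
    -2102, 192, -48, -2002, -2522, 426, 42, 0, -405, 411, 138, 318, 564, 60, -6, 318, 501, -135,
    0, 90, 180, 0, 0, -192, -96]), (3, [0, 0, 611, 178, 186, 442, 490, 20, 394, 66, -92, -46, 0,
    69, 109, -10, -142, -140, -196, -26, -142, 43, -15, 0, -66, -18, 0, 0, 80, 40]), (4, [0, 0,
    961, 146, -2738, -2458, -192, 48, -2330, -2038, -426, -42, 0, 405, -411, -138, -318, -564,
    -1428, -678, -318, -501, 135, 0, -90, -180, 0, 0, -1176, -588]), (5, [0, 0, -22, -32, 0, -9,
    15, 12, 0, 0, 15, 12, 0, 9]), (6, [0, 0, -2153, -1762, -2006, -1948, -1398, -420, -2498,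
    -1006, -120, -402, 0, -81, -807, -930, 474, 318, 354, -138, 474, -105, -27, 0, 18, 36, 0, 0,
    -312, -156]), (7, [0, 0, -407, -538, -2738, -2458, -192, 48, -2330, -2038, -426, -42, 0,
    405, -411, -138, -318, -564, -1428, -678, -318, -501, 135, 0, -90, -180, 0, 0, -1176,
    -588]), (8, [0, 0, 899, -62, 182, 694, 1398, 420, -10, -590, 120, 402, 0, 81, 465, 246, 210,
    24, -354, 138, 210, 447, 27, 0, -18, -36, 0, 0, 312, 156]), (9, [0, 0, -1735, -1154, 1262,
    1510, 198, 36, 1454, 2110, 108, 54, 0, -81, -465, -246, -210, -366, 126, 90, -210, -447,
    -27, 0, 18, 36, 0, 0, 144, 72]), (10, [0, 0, -2897, -2206, -1014, -1554, -1470, -60, -1638,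
    -426, 276, 138, 0, -207, -555, -426, 426, 420, 588, 78, 426, -129, 45, 0, 198, 54, 0, 0,
    -240, -120]), (11, [0, 0, 635, 2362, 4562, 3712, 192, -48, 4838, 3634, 426, 42, 0, -405,
    753, 822, -366, 222, 402, 678, -366, 159, 891, 0, 90, 180, 0, 0, 1176, 588]), (12, [0, 0,
    687, 330, 338, 518, 566, 172, 546, 142, -16, 106, 0, 69, 185, 142, -142, -140, -196, -26,
    -142, 43, -15, 0, -66, -18, 0, 0, 80, 40]), (13, [0, 0, -139, -698, 1262, 1168, -144, 36,
    1454, 2110, -234, 54, 0, 261, -465, -246, -210, -366, 126, 90, -210, -447, -27, 0, 18, 36,
    0, 0, 144, 72]), (23, [0, 0, 17, 28, 42, 27, 3, 6, 48, 30, 3, 6, 0, 0, 6, 12, -6, -3, 3, 6,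
    -6, -3, 0, 0, 0, 0, 0, 0, 3, 6]), (24, [0, 0, 0, 0, 0, 0, 0, 0, 0, 0, 0, 0, 0, 0, 2, 1, 0,
    0, 0, 0, 0, 0, 0, 0, 0, 0, -2, -1]), (25, [0, 0, 0, 0, 0, 0, 0, 0, 0, 0, 0, 0, 0, 0, 1, 2,
    0, 0, 0, 0, 0, 0, 0, 0, 0, 0, -1, -2]), (26, [0, 0, -8195, -4954, -3146, -466, -1398, -420,
    -2954, -1234, -120, -402, 0, -81, -3201, -1614, -210, -1050, -1014, -822, -210, -447, -27,
    0, 18, 36, 0, 0, -1680, -840]), (27, [0, 0, 899, -62, 2006, 1948, 1398, 420, 2498, 1006,
    120, 402, 0, 81, 807, 930, -474, -318, -354, 138, -474, 105, 27, 0, -18, -36, -342, -684,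
    312, 156]), (28, [0, 0, 2687, 2362, 2738, 2458, 192, -48, 2330, 2038, 426, 42, 0, -405, 411,
    138, 318, 564, 1428, 678, 318, 501, -135, 0, 90, 180, 1368, 684, 1176, 588]), (44, [0, 0,
    -106903, -60308, -40078, -66914, -68787, -4392, -71368, -18704, 9567, -1458, 0, -10296,
    -21588, -13764, 21174, 20199, 26865, 2358, 21516, -3948, 1926, 0, 8064, 2106, 0, 0, -9360,
    -4680]), (45, [0, 0, -320369, -185476, -131378, -206458, -205725, -13848, -225488, -62920,
    26457, -5838, 0, -29376, -67560, -44148, 64554, 59601, 79383, 4938, 65580, -12696, 4914, 0,
    23400, 6786, 0, 0, -30768, -15384]), (46, [8208, 0, -43441, -41582, -31366, -30038, -18294,
    7908, -39046, -19838, 3432, 2058, 0, -2403, -8247, -8970, 9426, 7116, 4308, -3714, 9426,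
    951, 1593, 0, 2358, -414, 0, 0, -3936, -1968]), (47, [0, 2052, -11147, -7510, -3086, -6412,
    -5214, -492, -5558, -628, 1032, 174, 0, -945, -2157, -1578, 1806, 1848, 2496, 366, 1806,
    -465, 27, 0, 666, 306, 0, 0, -600, -300]), (48, [0, 0, -237821, -26266, -86174, -198382,
    -256908, -62484, -166874, -13066, 17178, -27150, 0, -30753, -61557, -15726, 55626, 58566,
    95034, 21174, 53574, -26907, 4455, 0, 25074, 8082, 0, 0, -36528, -18264]), (49, [0, 0,
    10180, -1162, 3628, 9392, 13299, 3900, 6682, -430, -669, 1632, 0, 1485, 2901, 330, -2496,
    -2733, -4875, -1308, -2154, 1659, -189, 0, -1242, -432, 0, 0, 1920, 960]), (50, [0, 0,
    299261, 180988, 135050, 214522, 198453, 10536, 224264, 65944, -22713, 3606, 0, 24516, 67020,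
    43068, -60738, -56937, -69087, -2274, -61764, 14604, -6534, 0, -22320, -4626, 0, 0, 33936,
    16968]), (51, [0, 0, -129589, -37622, -41902, -94958, -115926, -21036, -86302, -11750,
    10992, -8526, 0, -15255, -29739, -10914, 27786, 29148, 43908, 8742, 27786, -10389, 2781, 0,
    12510, 3474, 0, 0, -15744, -7872])]"

definition certificate3 :: "(int \<times> int list) list" where
  "certificate3 = [
    (14, [2, 7, 0, 0, 0, 0, 0, -3]), (15, [1, 2]), (16, [-2, -1]), (17, [0, 0, 2, 7, 0, 0, 0, 0,
    0, -3]), (18, [0, 0, 1, 2]), (19, [0, 0, -2, -1]), (20, [0, 0, 0, 0, 2, 7, 0, 0, 0, 0, 0,
    -3]), (21, [0, 0, 0, 0, 1, 2]), (22, [0, 0, 0, 0, -2, -1]), (29, [7, 20, 0, 0, 0, 0, 0, 0,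
    0, 0, 0, 0, 15, 12, 0, 0, 0, 0, 0, 9]), (30, [16, 11, 0, 0, 0, 0, 0, 0, 0, 0, 0, 0, 6, 3]),
    (31, [7, 2, 0, 0, 0, 0, 0, 0, 0, 0, 0, 0, -12, -6, 0, 0, 0, 0, 0, -9]), (32, [0, 0, 7, 20,
    0, 0, 0, 0, 0, 0, 0, 0, 0, 0, 15, 12, 0, 0, 0, 0, 0, 9]), (33, [0, 0, 16, 11, 0, 0, 0, 0, 0,
    0, 0, 0, 0, 0, 6, 3]), (34, [0, 0, 7, 2, 0, 0, 0, 0, 0, 0, 0, 0, 0, 0, -12, -6, 0, 0, 0, 0,
    0, -9]), (35, [0, 0, 0, 0, 7, 20, 0, 0, 0, 0, 0, 0, 0, 0, 0, 0, 15, 12, 0, 0, 0, 0, 0, 9]),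
    (36, [0, 0, 0, 0, 16, 11, 0, 0, 0, 0, 0, 0, 0, 0, 0, 0, 6, 3]), (37, [0, 0, 0, 0, 7, 2, 0,
    0, 0, 0, 0, 0, 0, 0, 0, 0, -12, -6, 0, 0, 0, 0, 0, -9]), (38, [0, 0, 0, 0, 0, 0, 0, 0, 0, 0,
    0, 0, 0, 0, 0, 0, 0, 0, 0, 0, 0, 0, 0, 0, -6, 0, -2, -1, 0, 0, 3]), (39, [0, 0, 0, 0, 0, 0,
    0, 0, 0, 0, 0, 0, 0, 0, 0, 0, 0, 0, 0, 0, 0, 0, 0, 0, 0, 0, 1, 2, -1, -2]), (40, [0, 0, 0,
    0, 0, 0, 0, 0, 0, 0, 0, 0, 0, 0, 0, 0, 0, 0, 0, 0, 0, 0, 0, 0, 0, 0, -2, -1, 2, 1]), (41,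
    [0, 0, 0, 0, 0, 0, 0, 0, 0, 0, 0, 0, 0, 0, 0, 0, 0, 0, 0, 0, 0, 0, 0, 0, 3, 0, 2, 1, -4, -5,
    -3]), (42, [0, 0, 0, 0, 0, 0, 0, 0, 0, 0, 0, 0, 0, 0, 0, 0, 0, 0, 0, 0, 0, 0, 0, 0, 0, 0,
    -1, -2]), (43, [0, 0, 0, 0, 0, 0, 0, 0, 0, 0, 0, 0, 0, 0, 0, 0, 0, 0, 0, 0, 0, 0, 0, 0, 0,
    0, 2, 1])]"

abbreviation rows_of :: "nat list list \<Rightarrow> (int \<times> int) list list" where
  "rows_of ws \<equiv> concat (map (jrow cam_fields base_point cam_outputs) ws)"

lemma certificate2: "list_all (isolates (rows_of words2)) certificate2"
  by code_simp

lemma certificate3: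
  "list_all (isolates (map (filter (\<lambda>p. 14 \<le> fst p \<and> fst p < 23 \<or> 29 \<le> fst p \<and> fst p < 44)) (rows_of words3)))
     certificate3"
  by code_simp


lemma length_cam_fields: "length (cam_fields a) = length base_point"
  by (simp add: cam_fields_def base_point_def Let_def)

text \<open>An executable bound on the variables, so that closure of finitely many expressions under
  the fields is checked by evaluation.\<close>

fun pvars_all :: "(nat \<Rightarrow> bool) \<Rightarrow> pexp \<Rightarrow> bool" where
  "pvars_all P (PC c) \<longleftrightarrow> True"
| "pvars_all P (PV i) \<longleftrightarrow> P i"
| "pvars_all P (PAdd p q) \<longleftrightarrow> pvars_all P p \<and> pvars_all P q"
| "pvars_all P (PMul p q) \<longleftrightarrow> pvars_all P p \<and> pvars_all P q"

lemma pvars_all_iff: "pvars_all P p \<longleftrightarrow> pvars p \<subseteq> Collect P"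
  by (induction p) auto

lemma pvars_cam_outputs: "\<forall>h\<in>set cam_outputs. pvars h \<subseteq> {i. i < 2 \<or> 44 \<le> i \<and> i < 52}"
proof -
  have "list_all (pvars_all (\<lambda>i. i < 2 \<or> 44 \<le> i \<and> i < 52)) cam_outputs" by code_simp
  then show ?thesis by (simp add: list_all_iff pvars_all_iff)
qed

lemma pvars_cam_fields:
  assumes "a < 7" "i < 52"
  shows "pvars (cam_fields a ! i) \<subseteq> {..<52}"
proof -
  have "list_all (\<lambda>a. list_all (pvars_all (\<lambda>i. i < 52)) (cam_fields a)) [0,1,2,3,4,5,6]"
    by code_simp
  moreover have "a \<in> set [0,1,2,3,4,5,6]" using assms by auto
  ultimately have "list_all (pvars_all (\<lambda>i. i < 52)) (cam_fields a)"
    unfolding list_all_iff by blast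
  then show ?thesis using assms(2) length_cam_fields[of a]
    by (auto simp: list_all_length pvars_all_iff base_point_def lessThan_def)
qed

abbreviation cam_word :: "nat list \<Rightarrow> pexp \<Rightarrow> pexp" where
  "cam_word \<equiv> pword (\<lambda>a i. cam_fields a ! i)"

lemma pvars_cam_outputs_less: "h \<in> set cam_outputs \<Longrightarrow> pvars h \<subseteq> {..<52}"
  using pvars_cam_outputs by fastforce

lemma pvars_cam_word:
  assumes "set w \<subseteq> {..<7}" "h \<in> set cam_outputs"
  shows "pvars (cam_word w h) \<subseteq> {..<52}"
proof (rule pvars_pword[OF pvars_cam_outputs_less[OF assms(2)]])
  fix a i assume "a \<in> set w" "i \<in> {..<52::nat}"
  then show "pvars (cam_fields a ! i) \<subseteq> {..<52}"
    using assms(1) by (intro pvars_cam_fields) auto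
qed

lemma lf_eval_cam_row:
  assumes "set w \<subseteq> {..<7}"
    and "\<forall>h\<in>set cam_outputs. pdir (\<lambda>i. of_int (base_point ! i)) \<xi> (cam_word w h) = 0"
  shows "\<forall>l\<in>set (jrow cam_fields base_point cam_outputs w). lf_eval \<xi> l = 0"
proof (rule lf_eval_jrow[where A = "{..<7}", OF length_cam_fields])
  have [simp]: "length base_point = 52" by (simp add: base_point_def)
  show "pvars (cam_fields a ! i) \<subseteq> {..<length base_point}" if "a \<in> {..<7}" "i < length base_point" for a i
    using that pvars_cam_fields by simp
  show "\<forall>h\<in>set cam_outputs. pvars h \<subseteq> {..<length base_point}"
    using pvars_cam_outputs_less by simp
qed (use assms in auto)

lemma cam_kernel2:
  assumes "\<forall>w\<in>set words2. \<forall>h\<in>set cam_outputs. pdir (\<lambda>i. of_int (base_point ! i)) \<xi> (cam_word w h) = 0"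
  shows "\<forall>i\<in>atoms2. \<xi> i = 0"
proof -
  have "lf_eval \<xi> l = 0" if l: "l \<in> set (rows_of words2)" for l
  proof -
    obtain w where w: "w \<in> set words2" "l \<in> set (jrow cam_fields base_point cam_outputs w)"
      using l by auto
    have "set w \<subseteq> {..<7}" using w(1) by (auto simp: words2_def)
    then show ?thesis
      using lf_eval_cam_row[of w \<xi>] assms w by blast
  qed
  then have "\<xi> (nat i) = 0" if "(i, cs) \<in> set certificate2" for i cs
    using certificate2 that unfolding list_all_iff by (blast intro: isolates_imp_zero)
  then have "\<xi> i = 0" if "int i \<in> fst ` set certificate2" for i
    using that by (metis image_iff nat_int prod.collapse)
  moreover have "int ` atoms2 \<subseteq> fst ` set certificate2"
  proof -
    have "atoms2 = set ([0..<14] @ [23..<29] @ [44..<52])" by (auto simp: atoms2_def)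
    moreover have "list_all (\<lambda>i. int i \<in> set (map fst certificate2)) ([0..<14] @ [23..<29] @ [44..<52])"
      by code_simp
    ultimately show ?thesis unfolding list_all_iff by (metis image_subsetI list.set_map)
  qed
  ultimately show ?thesis by blast
qed

lemma cam_kernel3:
  assumes "\<forall>w\<in>set words3. \<forall>h\<in>set cam_outputs. pdir (\<lambda>i. of_int (base_point ! i)) \<xi> (cam_word w h) = 0"
    and 0: "\<forall>i\<in>atoms2. \<xi> i = 0"
  shows "\<forall>i<52. \<xi> i = 0"
proof -
  let ?P = "\<lambda>i::int. 14 \<le> i \<and> i < 23 \<or> 29 \<le> i \<and> i < 44"
  \<comment> \<open>Truncation to the 52 variables: \<open>lf_eval_filter\<close> asks for zero at
    every deleted index, and the words do not see the change.\<close>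
  let ?\<zeta> = "\<lambda>i. if i < 52 then \<xi> i else 0"
  have "lf_eval ?\<zeta> (filter (\<lambda>p. ?P (fst p)) l) = 0" if l: "l \<in> set (rows_of words3)" for l
  proof -
    obtain w where w: "w \<in> set words3" "l \<in> set (jrow cam_fields base_point cam_outputs w)"
      using l by auto
    have A: "set w \<subseteq> {..<7}" using w(1) by (auto simp: words3_def)
    have "pdir (\<lambda>i. of_int (base_point ! i)) ?\<zeta> (cam_word w h) = 0" if "h \<in> set cam_outputs" for h
      using assms(1) w(1) that pvars_cam_word[OF A that] by (subst pdir_cong[where \<zeta> = \<xi>]) auto
    then have "lf_eval ?\<zeta> l = 0"
      using lf_eval_cam_row[OF A, of ?\<zeta>] w(2) by blast
    moreover have "?\<zeta> (nat i) = 0" if "\<not> ?P i" for i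
    proof -
      have "nat i < 52 \<Longrightarrow> nat i \<in> atoms2"
        unfolding atoms2_def mem_Collect_eq using that by arith
      then show ?thesis using 0 by auto
    qed
    ultimately show ?thesis by (subst lf_eval_filter) blast+
  qed
  then have z: "\<forall>l\<in>set (map (filter (\<lambda>p. ?P (fst p))) (rows_of words3)). lf_eval ?\<zeta> l = 0"
    by auto
  have "?\<zeta> (nat i) = 0" if "(i, cs) \<in> set certificate3" for i cs
    using certificate3 that unfolding list_all_iff by (blast intro: isolates_imp_zero[OF _ z])
  then have "?\<zeta> i = 0" if "int i \<in> fst ` set certificate3" for i
    using that by (metis (no_types, lifting) image_iff nat_int prod.collapse)
  moreover have "int i \<in> fst ` set certificate3" if "i < 52" "i \<notin> atoms2" for i
  proof -
    have "i \<in> set ([14..<23] @ [29..<44])"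
      using that unfolding atoms2_def mem_Collect_eq set_append set_upt Un_iff atLeastLessThan_iff by arith
    moreover have "list_all (\<lambda>i. int i \<in> set (map fst certificate3)) ([14..<23] @ [29..<44])"
      by code_simp
    ultimately have "int i \<in> set (map fst certificate3)" unfolding list_all_iff by (elim bspec[rotated])
    then show ?thesis by simp
  qed
  ultimately show ?thesis using 0 by (metis (full_types))
qed

lemma pvars_pdiff_subset:
  "\<lbrakk>pvars p \<subseteq> S; S \<subseteq> T; \<And>i. i \<in> S \<Longrightarrow> pvars (F i) \<subseteq> T\<rbrakk> \<Longrightarrow> pvars (pdiff F p) \<subseteq> T"
  using pvars_pdiff[of F p] by blast

text \<open>The exclusion of the word \<open>[0, 0]\<close> keeps the acceleration parameters out of the second-order words.\<close>

lemma pvars_words2: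
  assumes w: "w \<in> set words2" and h: "h \<in> set cam_outputs"
  shows "pvars (cam_word w h) \<subseteq> atoms2"
proof -
  \<comment> \<open>The gyroscope fields preserve both \<open>?S1\<close>, which lacks
    \<open>c\<close> and \<open>\<nu>\<close>, and \<open>?S2\<close>, while the drift leads from
    \<open>?S1\<close> into \<open>?S2\<close>. A word with a single drift letter therefore stays in
    \<open>?S2\<close>.\<close>
  let ?S0 = "\<lambda>i::nat. i < 2 \<or> 44 \<le> i \<and> i < 52" and ?S1 = "\<lambda>i::nat. i < 14 \<or> 44 \<le> i \<and> i < 52"
  let ?S2 = "\<lambda>i::nat. i < 14 \<or> 23 \<le> i \<and> i < 29 \<or> 44 \<le> i \<and> i < 52"
  have upt: "Q i" if "list_all Q [0..<52]" "i < 52" for Q i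
    using that unfolding list_all_iff by (metis atLeastLessThan_iff le0 set_upt)
  have gyr: "Q a" if "list_all Q [4,5,6]" "a \<in> {4,5,6}" for Q and a :: nat
    using that by auto
  have "list_all (\<lambda>i. list_all (\<lambda>a. ?S1 i \<longrightarrow> pvars_all ?S1 (cam_fields a ! i)) [4,5,6]) [0..<52]"
    by code_simp
  then have l1: "list_all (\<lambda>a. ?S1 i \<longrightarrow> pvars_all ?S1 (cam_fields a ! i)) [4,5,6]" if "i < 52" for i
    by (rule upt) (fact that)
  have c1: "pvars (cam_fields a ! i) \<subseteq> Collect ?S1" if "a \<in> {4,5,6}" "i \<in> Collect ?S1" for a i
  proof -
    have "i < 52" using that(2) by auto
    from gyr[OF l1[OF this] that(1)] that(2) show ?thesis
      by (simp only: pvars_all_iff mem_Collect_eq simp_thms)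
  qed
  have "list_all (\<lambda>i. list_all (\<lambda>a. ?S2 i \<longrightarrow> pvars_all ?S2 (cam_fields a ! i)) [4,5,6]) [0..<52]"
    by code_simp
  then have l2: "list_all (\<lambda>a. ?S2 i \<longrightarrow> pvars_all ?S2 (cam_fields a ! i)) [4,5,6]" if "i < 52" for i
    by (rule upt) (fact that)
  have c2: "pvars (cam_fields a ! i) \<subseteq> Collect ?S2" if "a \<in> {4,5,6}" "i \<in> Collect ?S2" for a i
  proof -
    have "i < 52" using that(2) by auto
    from gyr[OF l2[OF this] that(1)] that(2) show ?thesis
      by (simp only: pvars_all_iff mem_Collect_eq simp_thms)
  qed
  have "list_all (\<lambda>i. ?S1 i \<longrightarrow> pvars_all ?S2 (cam_fields 0 ! i)) [0..<52]"
    by code_simp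
  then have l3: "?S1 i \<longrightarrow> pvars_all ?S2 (cam_fields 0 ! i)" if "i < 52" for i
    by (rule upt) (fact that)
  have c3: "pvars (cam_fields 0 ! i) \<subseteq> Collect ?S2" if "i \<in> Collect ?S1" for i
  proof -
    have "i < 52" using that by auto
    from l3[OF this] that show ?thesis
      by (simp only: pvars_all_iff mem_Collect_eq simp_thms)
  qed
  have h1: "pvars h \<subseteq> Collect ?S1" using pvars_cam_outputs h by fastforce
  have "set w \<subseteq> {4,5,6} \<or> w \<noteq> [] \<and> hd w = 0 \<and> set (tl w) \<subseteq> {4,5,6}
      \<or> w \<noteq> [] \<and> last w = 0 \<and> set (butlast w) \<subseteq> {4,5,6}"
    using w unfolding words2_def by auto
  then consider (gyro) "set w \<subseteq> {4,5,6}" | (first) v where "w = 0 # v" "set v \<subseteq> {4,5,6}"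
    | (last) v where "w = v @ [0]" "set v \<subseteq> {4,5,6}"
    by (metis append_butlast_last_id list.collapse)
  then have "pvars (cam_word w h) \<subseteq> Collect ?S2"
  proof cases
    case gyro
    have "pvars (cam_word w h) \<subseteq> Collect ?S1"
      by (rule pvars_pword[OF h1 c1]) (use gyro in blast)+
    also have "\<dots> \<subseteq> Collect ?S2" by auto
    finally show ?thesis .
  next
    case (first v)
    have "pvars (pdiff (\<lambda>i. cam_fields 0 ! i) h) \<subseteq> Collect ?S2"
      by (rule pvars_pdiff_subset[OF h1 _ c3]) auto
    then show ?thesis unfolding first(1) pword_simps
      by (rule pvars_pword[OF _ c2]) (use first(2) in blast)+
  next
    case (last v)
    have "pvars (cam_word v h) \<subseteq> Collect ?S1"
      by (rule pvars_pword[OF h1 c1]) (use last(2) in blast)+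
    then show ?thesis unfolding last(1) pword_simps
      by (rule pvars_pdiff_subset[OF _ _ c3]) auto
  qed
  then show ?thesis by (simp add: atoms2_def)
qed

lemma rational_field_Pair:
  "rational_field N f \<Longrightarrow> rational_field N g \<Longrightarrow> rational_field N (\<lambda>x. (f x, g x))"
  unfolding rational_field_def by (auto simp: Basis_prod_def)

lemma rational_field_vec:
  fixes f :: "'a::euclidean_space \<Rightarrow> real^'n"
  shows "(\<And>i. rational_on N (\<lambda>x. f x $ i)) \<Longrightarrow> rational_field N f"
  unfolding rational_field_def by (auto simp: Basis_vec_def inner_axis)

lemma rational_field_real: "rational_on N f \<Longrightarrow> rational_field N f"
  unfolding rational_field_def by simp

lemma rational_field_zero: "rational_field N (\<lambda>x. 0)"
  unfolding rational_field_def by (simp add: rational_on_const)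

lemmas rational_field_intros = rational_field_Pair rational_field_zero

lemma bounded_linear_comps:
  "bounded_linear f \<Longrightarrow> bounded_linear (\<lambda>x. fst (f x))"
  "bounded_linear f \<Longrightarrow> bounded_linear (\<lambda>x. snd (f x))"
  "bounded_linear g \<Longrightarrow> bounded_linear (\<lambda>x. g x $ i)"
  by (auto intro: bounded_linear_compose[OF bounded_linear_fst] bounded_linear_compose[OF bounded_linear_snd]
      bounded_linear_compose[OF bounded_linear_vec_nth])

lemma rational_on_comps:
  "bounded_linear f \<Longrightarrow> rational_on N (\<lambda>x. fst (f x))"
  "bounded_linear g \<Longrightarrow> rational_on N (\<lambda>x. snd (g x))"
  "bounded_linear h \<Longrightarrow> rational_on N (\<lambda>x. h x $ i)"
  by (auto intro!: rational_on_linear bounded_linear_comps)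

section \<open>The state in camera-frame coordinates\<close>

abbreviation "st_gamma \<equiv> \<lambda>s::imu_state. fst s"
abbreviation "st_rho \<equiv> \<lambda>s::imu_state. fst (snd s)"
abbreviation "st_v \<equiv> \<lambda>s::imu_state. fst (snd (snd s))"
abbreviation "st_g \<equiv> \<lambda>s::imu_state. fst (snd (snd (snd s)))"
abbreviation "st_bg \<equiv> \<lambda>s::imu_state. fst (snd (snd (snd (snd s))))"
abbreviation "st_ba \<equiv> \<lambda>s::imu_state. fst (snd (snd (snd (snd (snd s)))))"
abbreviation "st_Mg \<equiv> \<lambda>s::imu_state. fst (snd (snd (snd (snd (snd (snd s))))))"
abbreviation "st_Ts \<equiv> \<lambda>s::imu_state. fst (snd (snd (snd (snd (snd (snd (snd s)))))))"
abbreviation "st_Ma \<equiv> \<lambda>s::imu_state. fst (snd (snd (snd (snd (snd (snd (snd (snd s))))))))"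
abbreviation "st_p \<equiv> \<lambda>s::imu_state. fst (snd (snd (snd (snd (snd (snd (snd (snd (snd s)))))))))"
abbreviation "st_q \<equiv> \<lambda>s::imu_state. snd (snd (snd (snd (snd (snd (snd (snd (snd (snd s)))))))))"

text \<open>The squared quaternion norm is the only denominator in the dynamics, brought in by the
  normalization in \<open>quat_rotation\<close>.\<close>

definition imu_denominator :: "imu_state \<Rightarrow> real" where
  "imu_denominator s = (st_q s $ 1)^2 + (st_q s $ 2)^2 + (st_q s $ 3)^2 + (st_q s $ 4)^2"

lemma rational_domain_imu: "rational_domain imu_denominator"
proof
  have "real_polynomial_function (\<lambda>s. st_q s $ i)" for i
    by (intro real_polynomial_function.intros(1) bounded_linear_comps bounded_linear_ident)
  then show "real_polynomial_function imu_denominator"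
    unfolding imu_denominator_def[abs_def]
    by (intro real_polynomial_function.intros(3) real_polynomial_function_power)
qed

lemma imu_denominator_nonzero: "imu_denominator s \<noteq> 0 \<Longrightarrow> st_q s \<noteq> 0"
  unfolding imu_denominator_def by auto

lemma rational_quat_rotation: "rational_on imu_denominator (\<lambda>s. quat_rotation (st_q s) $ i $ j)"
proof -
  have c: "rational_on imu_denominator (\<lambda>s. st_q s $ i)" for i
    by (intro rational_on_comps bounded_linear_comps bounded_linear_ident)
  have "\<forall>i j. rational_on imu_denominator (\<lambda>s. quat_rotation (st_q s) $ i $ j)"
    unfolding forall_3 quat_rotation_def Let_def imu_denominator_def[symmetric]
    by (simp add: vector_3) (intro conjI rational_intros c)
  then show ?thesis by blast
qed

lemma lower_tri_matrix_nth:
  "lower_tri_matrix m = vector [vector [fst m, 0, 0], vector [fst (snd m), fst (snd (snd m)), 0],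
     vector [fst (snd (snd (snd m))), fst (snd (snd (snd (snd m)))), snd (snd (snd (snd (snd m))))]]"
  by (cases m) simp

lemma imu_state_cases:
  fixes s :: imu_state
  obtains \<gamma> \<rho> v g b\<^sub>g b\<^sub>a M\<^sub>g T\<^sub>s M\<^sub>a p q where "s = (\<gamma>, \<rho>, v, g, b\<^sub>g, b\<^sub>a, M\<^sub>g, T\<^sub>s, M\<^sub>a, p, q)"
  by (metis prod.collapse)

lemma imu_dynamics_proj:
  "imu_dynamics a\<^sub>m \<omega>\<^sub>m s =
     (let R = quat_rotation (st_q s);
          a\<^sub>t = lower_tri_matrix (st_Ma s) *v (a\<^sub>m - st_ba s);
          \<omega>\<^sub>t = st_Mg s *v (\<omega>\<^sub>m - st_bg s) - (st_Mg s ** st_Ts s) *v (a\<^sub>m - st_ba s);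
          d = C_matrix (st_gamma s) (st_rho s) *v
                (cross3 (R *v \<omega>\<^sub>t) (st_rho s *\<^sub>R st_p s - vector [st_gamma s$1, st_gamma s$2, 1]) - st_rho s *\<^sub>R (R *v st_v s))
      in (vector [d$1, d$2], d$3, cross3 (st_v s) \<omega>\<^sub>t + a\<^sub>t + st_g s, cross3 (st_g s) \<omega>\<^sub>t, 0, 0, 0, 0, 0, 0, 0))"
  by (rule imu_state_cases[of s]) (simp add: Let_def)

lemma rational_imu_dynamics: "rational_field imu_denominator (imu_dynamics a \<omega>)"
proof -
  have comp: "rational_on imu_denominator (\<lambda>s. st_gamma s $ i2)"
    "rational_on imu_denominator (\<lambda>s. st_rho s)" "rational_on imu_denominator (\<lambda>s. st_v s $ i)"
    "rational_on imu_denominator (\<lambda>s. st_g s $ i)" "rational_on imu_denominator (\<lambda>s. st_bg s $ i)"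
    "rational_on imu_denominator (\<lambda>s. st_ba s $ i)" "rational_on imu_denominator (\<lambda>s. st_Mg s $ i $ j)"
    "rational_on imu_denominator (\<lambda>s. st_Ts s $ i $ j)" "rational_on imu_denominator (\<lambda>s. st_p s $ i)"
    "rational_on imu_denominator (\<lambda>s. fst (st_Ma s))" "rational_on imu_denominator (\<lambda>s. fst (snd (st_Ma s)))"
    "rational_on imu_denominator (\<lambda>s. fst (snd (snd (st_Ma s))))"
    "rational_on imu_denominator (\<lambda>s. fst (snd (snd (snd (st_Ma s)))))"
    "rational_on imu_denominator (\<lambda>s. fst (snd (snd (snd (snd (st_Ma s))))))"
    "rational_on imu_denominator (\<lambda>s. snd (snd (snd (snd (snd (st_Ma s))))))" for i2 i j
    by (intro rational_on_comps bounded_linear_comps bounded_linear_ident)+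
  have L: "rational_on imu_denominator (\<lambda>s. lower_tri_matrix (st_Ma s) $ i $ j)" for i j
  proof -
    have "\<forall>i j. rational_on imu_denominator (\<lambda>s. lower_tri_matrix (st_Ma s) $ i $ j)"
      unfolding forall_3 lower_tri_matrix_nth by (simp add: vector_3 comp rational_on_const)
    then show ?thesis by blast
  qed
  have mv: "rational_on imu_denominator (\<lambda>s. (A s *v w s) $ i)"
    if "\<And>i j. rational_on imu_denominator (\<lambda>s. A s $ i $ j)" "\<And>j. rational_on imu_denominator (\<lambda>s. w s $ j)"
    for A :: "imu_state \<Rightarrow> real^3^3" and w i
    using that unfolding matrix_vector_mult_def by (simp add: sum_3) (intro rational_intros that)
  have mm: "rational_on imu_denominator (\<lambda>s. (A s ** B s) $ i $ j)"
    if "\<And>i j. rational_on imu_denominator (\<lambda>s. A s $ i $ j)" "\<And>i j. rational_on imu_denominator (\<lambda>s. B s $ i $ j)"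
    for A B :: "imu_state \<Rightarrow> real^3^3" and i j
    using that unfolding matrix_matrix_mult_def by (simp add: sum_3) (intro rational_intros that)
  have cr: "rational_on imu_denominator (\<lambda>s. cross3 (v s) (w s) $ i)"
    if "\<And>j. rational_on imu_denominator (\<lambda>s. v s $ j)" "\<And>j. rational_on imu_denominator (\<lambda>s. w s $ j)"
    for v w :: "imu_state \<Rightarrow> real^3" and i
  proof -
    have "\<forall>i. rational_on imu_denominator (\<lambda>s. cross3 (v s) (w s) $ i)"
      unfolding forall_3 cross3_def by (simp add: vector_3) (intro conjI rational_intros that)
    then show ?thesis by blast
  qed
  have dif: "rational_on imu_denominator (\<lambda>s. (v s - w s) $ i)" "rational_on imu_denominator (\<lambda>s. (v s + w s) $ i)"
     "rational_on imu_denominator (\<lambda>s. (r s *\<^sub>R w s) $ i)"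
    if "\<And>j. rational_on imu_denominator (\<lambda>s. v s $ j)" "\<And>j. rational_on imu_denominator (\<lambda>s. w s $ j)"
     "rational_on imu_denominator r" for v w :: "imu_state \<Rightarrow> real^3" and i r
    using that by (auto intro!: rational_intros)
  have gbar: "rational_on imu_denominator (\<lambda>s. vector [st_gamma s $ 1, st_gamma s $ 2, 1] $ i)" for i :: 3
  proof -
    have "\<forall>i::3. rational_on imu_denominator (\<lambda>s. vector [st_gamma s $ 1, st_gamma s $ 2, 1] $ i)"
      unfolding forall_3 by (simp add: vector_3 comp rational_on_const)
    then show ?thesis by blast
  qed
  have C: "rational_on imu_denominator (\<lambda>s. C_matrix (st_gamma s) (st_rho s) $ i $ j)" for i j
  proof -
    have "\<forall>i j. rational_on imu_denominator (\<lambda>s. C_matrix (st_gamma s) (st_rho s) $ i $ j)"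
      unfolding forall_3 C_matrix_def
      by (simp add: vector_3) (intro conjI rational_intros comp)
    then show ?thesis by blast
  qed
  have vec2: "rational_field imu_denominator (\<lambda>s. vector [v s $ 1, v s $ 2] :: real^2)"
    if "\<And>i. rational_on imu_denominator (\<lambda>s. v s $ i)" for v :: "imu_state \<Rightarrow> real^3"
  proof -
    have "\<forall>i::2. rational_on imu_denominator (\<lambda>s. vector [v s $ 1, v s $ 2] $ i)"
      unfolding forall_2 by (simp add: vector_2 that)
    then show ?thesis by (intro rational_field_vec) blast
  qed
  note base = comp L mv mm dif cr gbar C rational_quat_rotation rational_on_const
  show ?thesis
    unfolding imu_dynamics_proj[abs_def] Let_def
    by (intro rational_field_intros rational_field_real vec2)
     (rule base | rule rational_field_vec)+
qed


definition full_denominator :: "full_state \<Rightarrow> real" where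
  "full_denominator x = imu_denominator (fst x)"

lemma rational_on_fst:
  "rational_on imu_denominator f \<Longrightarrow> rational_on full_denominator (\<lambda>x. f (fst x))"
  unfolding full_denominator_def[abs_def] by (rule rational_on_compose_linear[OF _ bounded_linear_fst])

lemma rational_domain_full: "rational_domain full_denominator"
proof
  have "real_polynomial_function (\<lambda>x::full_state. st_q (fst x) $ i)" for i
    by (intro real_polynomial_function.intros(1) bounded_linear_comps bounded_linear_ident)
  then show "real_polynomial_function full_denominator"
    unfolding full_denominator_def[abs_def] imu_denominator_def[abs_def]
    by (intro real_polynomial_function.intros(3) real_polynomial_function_power)
qed

interpretation imu: rational_domain imu_denominator by (rule rational_domain_imu)
interpretation full: rational_domain full_denominator by (rule rational_domain_full)

lemma full_dynamics_fst: "full_dynamics a \<omega> x = (imu_dynamics a \<omega> (fst x), 0)"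
  by (cases x) simp

lemma rational_full_dynamics: "rational_field full_denominator (full_dynamics a \<omega>)"
proof -
  have "rational_field full_denominator (\<lambda>x. imu_dynamics a \<omega> (fst x))"
    unfolding rational_field_def
  proof
    fix b :: imu_state assume "b \<in> Basis"
    then have "rational_on imu_denominator (\<lambda>s. imu_dynamics a \<omega> s \<bullet> b)"
      using rational_imu_dynamics[of a \<omega>] unfolding rational_field_def by blast
    then show "rational_on full_denominator (\<lambda>x. imu_dynamics a \<omega> (fst x) \<bullet> b)"
      by (rule rational_on_fst)
  qed
  then show ?thesis
    unfolding full_dynamics_fst[abs_def] by (intro rational_field_intros)
qed

lemma rational_gravity_quat:
  "rational_on imu_denominator gravity_sq" "rational_on imu_denominator quat_norm_sq"
proof -
  have e: "gravity_sq = (\<lambda>s. st_g s \<bullet> st_g s)" "quat_norm_sq = (\<lambda>s. st_q s \<bullet> st_q s)"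
    by (auto simp: fun_eq_iff)
  have f: "rational_field imu_denominator (\<lambda>s. st_g s)" "rational_field imu_denominator (\<lambda>s. st_q s)"
    by (intro rational_field_vec rational_on_comps bounded_linear_comps bounded_linear_ident)+
  show "rational_on imu_denominator gravity_sq" "rational_on imu_denominator quat_norm_sq"
    unfolding e by (intro rational_on_inner f)+
qed

lemma landmark_direction_fst: "landmark_direction s = fst s"
  by (cases s) simp

interpretation imu: rational_system imu_denominator imu_dynamics reduced_outputs
proof
  show "rational_on imu_denominator h" if "h \<in> reduced_outputs" for h
    using that rational_gravity_quat unfolding reduced_outputs_def landmark_direction_fst
    by (auto intro!: rational_on_comps bounded_linear_comps bounded_linear_ident)
qed (fact rational_imu_dynamics imu_dynamics_affine)+

section \<open>The 52 camera-frame functions\<close>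

definition "camR x = quat_rotation (st_q (fst x))" for x :: full_state
definition "camW x = camR x ** st_Mg (fst x)" for x :: full_state
definition "camK x = - (camR x ** (st_Mg (fst x) ** st_Ts (fst x)))" for x :: full_state
text \<open>The camera-frame rotation rate at zero inputs, that is, the contribution of both biases.
  \<open>camD\<close> plays the same role for the acceleration \<open>a\<^sub>t\<close>, rotated and
  scaled by \<open>\<rho>\<close>.\<close>

definition "camc x = - (camW x *v st_bg (fst x)) - camK x *v st_ba (fst x)" for x :: full_state
definition "camV x = st_rho (fst x) *\<^sub>R (camR x *v st_v (fst x))" for x :: full_state
definition "camL x = st_rho (fst x) *\<^sub>R (camR x ** lower_tri_matrix (st_Ma (fst x)))" for x :: full_state
definition "camD x = - (camL x *v st_ba (fst x))" for x :: full_state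
definition "camG x = st_rho (fst x) *\<^sub>R (camR x *v st_g (fst x))" for x :: full_state

text \<open>The order is the variable numbering of \<open>cam_fields\<close>, so that the position
  in the list is the variable index.\<close>

definition atoms :: "(full_state \<Rightarrow> real) list" where
  "atoms =
    [\<lambda>x. st_gamma (fst x) $ 1, \<lambda>x. st_gamma (fst x) $ 2] @
    map (\<lambda>k x. st_rho (fst x) * st_p (fst x) $ k) [1, 2, 3] @
    concat (map (\<lambda>A. concat (map (\<lambda>j. map (\<lambda>i x. A x $ i $ j) [1, 2, 3]) [1, 2, 3])) [camW, camK]) @
    concat (map (\<lambda>u. map (\<lambda>i x. u x $ i) [1, 2, 3]) [camc, camV]) @
    concat (map (\<lambda>j. map (\<lambda>i x. camL x $ i $ j) [1, 2, 3]) [1, 2, 3]) @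
    concat (map (\<lambda>u. map (\<lambda>i x. u x $ i) [1, 2, 3]) [camD, camG]) @
    [\<lambda>x. fst (snd x), \<lambda>x. fst (snd (snd x)), \<lambda>x. fst (snd (snd (snd x))),
     \<lambda>x. fst (snd (snd (snd (snd x)))), \<lambda>x. fst (snd (snd (snd (snd (snd x))))),
     \<lambda>x. fst (snd (snd (snd (snd (snd (snd x)))))), \<lambda>x. fst (snd (snd (snd (snd (snd (snd (snd x))))))),
     \<lambda>x. snd (snd (snd (snd (snd (snd (snd (snd x)))))))]"

lemma length_atoms: "length atoms = 52"
  by (simp add: atoms_def)

lemma rational_atoms: "i < 52 \<Longrightarrow> rational_on full_denominator (atoms ! i)"
proof -
  have comp: "rational_on full_denominator (\<lambda>x. st_rho (fst x))" "rational_on full_denominator (\<lambda>x. st_v (fst x) $ i)"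
    "rational_on full_denominator (\<lambda>x. st_g (fst x) $ i)" "rational_on full_denominator (\<lambda>x. st_bg (fst x) $ i)"
    "rational_on full_denominator (\<lambda>x. st_ba (fst x) $ i)" "rational_on full_denominator (\<lambda>x. st_Mg (fst x) $ i $ j)"
    "rational_on full_denominator (\<lambda>x. st_Ts (fst x) $ i $ j)" "rational_on full_denominator (\<lambda>x. st_p (fst x) $ i)"
    "rational_on full_denominator (\<lambda>x. st_gamma (fst x) $ i')" for i j i'
    by (intro rational_on_comps bounded_linear_comps bounded_linear_ident)+
  have L: "rational_on full_denominator (\<lambda>x. lower_tri_matrix (st_Ma (fst x)) $ i $ j)" for i j
  proof -
    have "\<forall>i j. rational_on full_denominator (\<lambda>x. lower_tri_matrix (st_Ma (fst x)) $ i $ j)"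
      unfolding forall_3 lower_tri_matrix_nth vector_3
      by (intro conjI rational_on_const rational_on_comps bounded_linear_comps bounded_linear_ident)
    then show ?thesis by blast
  qed
  have R: "rational_on full_denominator (\<lambda>x. camR x $ i $ j)" for i j
    unfolding camR_def by (rule rational_on_fst[OF rational_quat_rotation])
  have W: "rational_on full_denominator (\<lambda>x. camW x $ i $ j)" for i j
    unfolding camW_def matrix_matrix_mult_def by (simp add: sum_3) (intro rational_intros comp R)
  have K: "rational_on full_denominator (\<lambda>x. camK x $ i $ j)" for i j
    unfolding camK_def matrix_matrix_mult_def by (simp add: sum_3) (intro rational_intros comp R)
  have c: "rational_on full_denominator (\<lambda>x. camc x $ i)" for i
    unfolding camc_def matrix_vector_mult_def by (simp add: sum_3) (intro rational_intros comp W K)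
  have V: "rational_on full_denominator (\<lambda>x. camV x $ i)" for i
    unfolding camV_def matrix_vector_mult_def by (simp add: sum_3) (intro rational_intros comp R)
  have G: "rational_on full_denominator (\<lambda>x. camG x $ i)" for i
    unfolding camG_def matrix_vector_mult_def by (simp add: sum_3) (intro rational_intros comp R)
  have Lam: "rational_on full_denominator (\<lambda>x. camL x $ i $ j)" for i j
    unfolding camL_def matrix_matrix_mult_def by (simp add: sum_3) (intro rational_intros comp R L)
  have D: "rational_on full_denominator (\<lambda>x. camD x $ i)" for i
    unfolding camD_def matrix_vector_mult_def by (simp add: sum_3) (intro rational_intros comp Lam)
  have "list_all (rational_on full_denominator) atoms"
    unfolding atoms_def
    by (simp add: comp W K c V G Lam D)
      (intro conjI rational_on_mult comp rational_on_comps bounded_linear_comps bounded_linear_ident)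
  then show "i < 52 \<Longrightarrow> rational_on full_denominator (atoms ! i)"
    by (simp add: list_all_length length_atoms)
qed

lemma image_point_atoms:
  "image_point x $ 1 = peval (\<lambda>i. (atoms ! i) x) (cam_outputs ! 0)"
  "image_point x $ 2 = peval (\<lambda>i. (atoms ! i) x) (cam_outputs ! 1)"
proof -
  obtain s f\<^sub>x f\<^sub>y c\<^sub>x c\<^sub>y k\<^sub>1 k\<^sub>2 p\<^sub>1 p\<^sub>2 where x: "x = (s, f\<^sub>x, f\<^sub>y, c\<^sub>x, c\<^sub>y, k\<^sub>1, k\<^sub>2, p\<^sub>1, p\<^sub>2)"
    by (metis prod.collapse)
  show "image_point x $ 1 = peval (\<lambda>i. (atoms ! i) x) (cam_outputs ! 0)"
    "image_point x $ 2 = peval (\<lambda>i. (atoms ! i) x) (cam_outputs ! 1)"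
    by (simp_all add: x cam_outputs_def atoms_def landmark_direction_fst Let_def vector_2 power2_eq_square)
qed

lemma rational_cam_output: "h \<in> set cam_outputs \<Longrightarrow> rational_on full_denominator (\<lambda>x. peval (\<lambda>i. (atoms ! i) x) h)"
  using pvars_cam_outputs_less by (intro full.rational_on_peval rational_atoms) auto

lemma rational_image_point: "rational_on full_denominator (\<lambda>x. image_point x $ i)"
proof -
  have "cam_outputs ! 0 \<in> set cam_outputs" "cam_outputs ! 1 \<in> set cam_outputs"
    by (simp_all add: cam_outputs_def Let_def)
  then have "\<forall>i. rational_on full_denominator (\<lambda>x. image_point x $ i)"
    unfolding forall_2 image_point_atoms using rational_cam_output by blast
  then show ?thesis by blast
qed

interpretation full: rational_system full_denominator full_dynamics full_outputs
proof
  show "rational_on full_denominator h" if "h \<in> full_outputs" for h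
    using that rational_gravity_quat rational_image_point unfolding full_outputs_def
    by (auto intro: rational_on_fst)
qed (fact rational_full_dynamics full_dynamics_affine)+

text \<open>Differentiability is known in advance, so a pairing with the gradient can be computed
  from the restriction to a single line by one-variable calculus.\<close>

lemma (in rational_domain) grad_direction:
  assumes "rational_on N \<phi>" "N x \<noteq> 0" "((\<lambda>t. \<phi> (x + t *\<^sub>R h)) has_real_derivative D) (at 0)"
  shows "grad \<phi> x \<bullet> h = D"
proof -
  have "((\<lambda>t. x + t *\<^sub>R h) has_derivative (\<lambda>t. t *\<^sub>R h)) (at 0)"
    by (auto intro!: derivative_eq_intros)
  from has_derivative_compose[OF this, of \<phi> "\<lambda>k. k \<bullet> grad \<phi> x"]
  have "((\<lambda>t. \<phi> (x + t *\<^sub>R h)) has_derivative (\<lambda>t. t *\<^sub>R h \<bullet> grad \<phi> x)) (at 0)"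
    using rational_on_gradient(1)[OF assms(1,2)] by (simp add: gderiv_def)
  then have "((\<lambda>t. \<phi> (x + t *\<^sub>R h)) has_real_derivative grad \<phi> x \<bullet> h) (at 0)"
    by (simp add: has_field_derivative_def inner_commute mult.commute[of _ "_ \<bullet> _"])
  then show ?thesis using assms(3) by (rule DERIV_unique)
qed

lemma atoms_nth:
  "(atoms ! 0) x = st_gamma (fst x) $ 1"
  "(atoms ! Suc 0) x = st_gamma (fst x) $ 2"
  "(atoms ! 2) x = st_rho (fst x) * st_p (fst x) $ 1"
  "(atoms ! 3) x = st_rho (fst x) * st_p (fst x) $ 2"
  "(atoms ! 4) x = st_rho (fst x) * st_p (fst x) $ 3"
  "(atoms ! 5) x = camW x $ 1 $ 1"
  "(atoms ! 6) x = camW x $ 2 $ 1"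
  "(atoms ! 7) x = camW x $ 3 $ 1"
  "(atoms ! 8) x = camW x $ 1 $ 2"
  "(atoms ! 9) x = camW x $ 2 $ 2"
  "(atoms ! 10) x = camW x $ 3 $ 2"
  "(atoms ! 11) x = camW x $ 1 $ 3"
  "(atoms ! 12) x = camW x $ 2 $ 3"
  "(atoms ! 13) x = camW x $ 3 $ 3"
  "(atoms ! 14) x = camK x $ 1 $ 1"
  "(atoms ! 15) x = camK x $ 2 $ 1"
  "(atoms ! 16) x = camK x $ 3 $ 1"
  "(atoms ! 17) x = camK x $ 1 $ 2"
  "(atoms ! 18) x = camK x $ 2 $ 2"
  "(atoms ! 19) x = camK x $ 3 $ 2"
  "(atoms ! 20) x = camK x $ 1 $ 3"
  "(atoms ! 21) x = camK x $ 2 $ 3"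
  "(atoms ! 22) x = camK x $ 3 $ 3"
  "(atoms ! 23) x = camc x $ 1"
  "(atoms ! 24) x = camc x $ 2"
  "(atoms ! 25) x = camc x $ 3"
  "(atoms ! 26) x = camV x $ 1"
  "(atoms ! 27) x = camV x $ 2"
  "(atoms ! 28) x = camV x $ 3"
  "(atoms ! 29) x = camL x $ 1 $ 1"
  "(atoms ! 30) x = camL x $ 2 $ 1"
  "(atoms ! 31) x = camL x $ 3 $ 1"
  "(atoms ! 32) x = camL x $ 1 $ 2"
  "(atoms ! 33) x = camL x $ 2 $ 2"
  "(atoms ! 34) x = camL x $ 3 $ 2"
  "(atoms ! 35) x = camL x $ 1 $ 3"
  "(atoms ! 36) x = camL x $ 2 $ 3"
  "(atoms ! 37) x = camL x $ 3 $ 3"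
  "(atoms ! 38) x = camD x $ 1"
  "(atoms ! 39) x = camD x $ 2"
  "(atoms ! 40) x = camD x $ 3"
  "(atoms ! 41) x = camG x $ 1"
  "(atoms ! 42) x = camG x $ 2"
  "(atoms ! 43) x = camG x $ 3"
  "(atoms ! 44) x = fst (snd x)"
  "(atoms ! 45) x = fst (snd (snd x))"
  "(atoms ! 46) x = fst (snd (snd (snd x)))"
  "(atoms ! 47) x = fst (snd (snd (snd (snd x))))"
  "(atoms ! 48) x = fst (snd (snd (snd (snd (snd x)))))"
  "(atoms ! 49) x = fst (snd (snd (snd (snd (snd (snd x))))))"
  "(atoms ! 50) x = fst (snd (snd (snd (snd (snd (snd (snd x)))))))"
  "(atoms ! 51) x = snd (snd (snd (snd (snd (snd (snd (snd x)))))))"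
  by (simp_all add: atoms_def)

section \<open>Closed polynomial dynamics of the camera-frame functions\<close>

definition cam_rate :: "real^3 \<Rightarrow> real^3 \<Rightarrow> full_state \<Rightarrow> real^3" where
  "cam_rate a \<omega> x = camc x + camK x *v a + camW x *v \<omega>"

text \<open>The vector on which \<open>C_matrix\<close> acts. Its third component is
  \<open>\<eta>\<close>, minus the logarithmic derivative of \<open>\<rho>\<close>.\<close>

definition cam_flow :: "real^3 \<Rightarrow> real^3 \<Rightarrow> full_state \<Rightarrow> real^3" where
  "cam_flow a \<omega> x = cross3 (cam_rate a \<omega> x) (st_rho (fst x) *\<^sub>R st_p (fst x) -
     vector [st_gamma (fst x) $ 1, st_gamma (fst x) $ 2, 1]) - camV x"

definition atom_rates :: "real^3 \<Rightarrow> real^3 \<Rightarrow> full_state \<Rightarrow> real list" where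
  "atom_rates a \<omega> x = (let \<Omega> = cam_rate a \<omega> x; u = cam_flow a \<omega> x; \<eta> = u $ 3 in
     [u $ 1 - \<eta> * st_gamma (fst x) $ 1, u $ 2 - \<eta> * st_gamma (fst x) $ 2] @
     map (\<lambda>k. - \<eta> * (st_rho (fst x) * st_p (fst x) $ k)) [1, 2, 3] @ replicate 21 0 @
     map (\<lambda>k. (cross3 (camV x) \<Omega> + camL x *v a + camD x + camG x) $ k - \<eta> * camV x $ k) [1, 2, 3] @
     concat (map (\<lambda>j. map (\<lambda>i. - \<eta> * camL x $ i $ j) [1, 2, 3]) [1, 2, 3]) @
     map (\<lambda>k. - \<eta> * camD x $ k) [1, 2, 3] @
     map (\<lambda>k. cross3 (camG x) \<Omega> $ k - \<eta> * camG x $ k) [1, 2, 3] @ replicate 8 0)"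

text \<open>The quaternion and the calibration parameters are at rest, so \<open>W\<close>,
  \<open>K\<close> and \<open>c\<close> are constant. \<open>R\<close> is a rotation, hence moves
  inside cross products and turns \<open>\<omega>\<^sub>t\<close> into the camera-frame rate
  \<open>\<Omega>\<close>. A factor \<open>\<rho>\<close> contributes \<open>- \<eta>\<close> times
  the quantity it scales.\<close>

lemma atom_rates:
  assumes x: "full_denominator x \<noteq> 0" and i: "i < 52"
  shows "grad (atoms ! i) x \<bullet> full_dynamics a \<omega> x = atom_rates a \<omega> x ! i"
proof -
  define s where "s = fst x"
  define ds where "ds = imu_dynamics a \<omega> s"
  \<comment> \<open>A straight line instead of a trajectory: only its direction matters for the
    gradient, and every atom is polynomial in \<open>t\<close> along it because \<open>camR\<close>
    stays fixed.\<close>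
  define y where "y t = x + t *\<^sub>R full_dynamics a \<omega> x" for t
  define R where "R = camR x"
  define \<omega>t where "\<omega>t = st_Mg s *v (\<omega> - st_bg s) - (st_Mg s ** st_Ts s) *v (a - st_ba s)"
  define acc where "acc = lower_tri_matrix (st_Ma s) *v (a - st_ba s)"
  define \<Omega> where "\<Omega> = cam_rate a \<omega> x"
  define u where "u = cam_flow a \<omega> x"
  define \<rho> where "\<rho> = st_rho s"
  have rot: "rotation_matrix R"
    using x unfolding R_def camR_def full_denominator_def
    by (intro rotation_matrix_quat_rotation imu_denominator_nonzero)
  have neg: "(- A) *v b = - (A *v b)" for A :: "real^3^3" and b
    by (simp add: matrix_vector_mult_def vec_eq_iff sum_negf)
  have \<Omega>: "R *v \<omega>t = \<Omega>"
    unfolding \<Omega>_def \<omega>t_def cam_rate_def camc_def camK_def camW_def R_def s_def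
    by (simp add: matrix_vector_mult_diff_distrib matrix_vector_mul_assoc matrix_mul_assoc neg)
  have V: "camV x = \<rho> *\<^sub>R (R *v st_v s)" and G: "camG x = \<rho> *\<^sub>R (R *v st_g s)"
    and L: "camL x = \<rho> *\<^sub>R (R ** lower_tri_matrix (st_Ma s))"
    by (simp_all add: camV_def camG_def camL_def \<rho>_def R_def s_def)
  have u: "u = cross3 \<Omega> (\<rho> *\<^sub>R st_p s - vector [st_gamma s $ 1, st_gamma s $ 2, 1]) - \<rho> *\<^sub>R (R *v st_v s)"
    unfolding u_def cam_flow_def V by (simp add: \<Omega>_def \<rho>_def s_def)
  have C: "C_matrix \<gamma> r *v w = vector [w$1 - \<gamma>$1 * w$3, w$2 - \<gamma>$2 * w$3, - r * w$3]" for \<gamma> r w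
    by (simp add: C_matrix_def matrix_vector_mult_def sum_3 vec_eq_iff forall_3)
  have "ds = (let d = C_matrix (st_gamma s) \<rho> *v u in (vector [d$1, d$2], d$3, cross3 (st_v s) \<omega>t + acc + st_g s,
      cross3 (st_g s) \<omega>t, 0, 0, 0, 0, 0, 0, 0))"
    unfolding ds_def imu_dynamics_proj Let_def u \<Omega>[symmetric]
    by (simp add: R_def camR_def \<omega>t_def acc_def \<rho>_def s_def)
  then have ds: "st_gamma ds $ 1 = u$1 - st_gamma s $ 1 * u$3" "st_gamma ds $ 2 = u$2 - st_gamma s $ 2 * u$3"
      "st_rho ds = - \<rho> * u$3" "st_v ds = cross3 (st_v s) \<omega>t + acc + st_g s" "st_g ds = cross3 (st_g s) \<omega>t"
      "st_bg ds = 0" "st_ba ds = 0" "st_Mg ds = 0" "st_Ts ds = 0" "st_Ma ds = 0" "st_p ds = 0" "st_q ds = 0"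
    by (simp_all add: Let_def C vector_2 vector_3)
  have y: "y t = (s + t *\<^sub>R ds, snd x)" for t
    unfolding y_def s_def ds_def full_dynamics_fst by (simp add: prod_eq_iff)
  have Ry: "camR (y t) = R" for t by (simp add: camR_def R_def y ds s_def)
  have Wy: "camW (y t) = camW x" for t unfolding camW_def Ry by (simp add: y ds) (simp add: R_def s_def)
  have Ky: "camK (y t) = camK x" for t unfolding camK_def Ry by (simp add: y ds) (simp add: R_def s_def)
  have cy: "camc (y t) = camc x" for t unfolding camc_def Wy Ky by (simp add: y ds) (simp add: s_def)
  have rho: "((\<lambda>t. (\<rho> + t * (- \<rho> * u$3)) * (A + t * B)) has_real_derivative \<rho> * B - u$3 * (\<rho> * A)) (at 0)" for A B
    by (auto intro!: derivative_eq_intros simp: algebra_simps)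
  have rho0: "((\<lambda>t. (\<rho> + t * (- \<rho> * u$3)) * A) has_real_derivative - u$3 * (\<rho> * A)) (at 0)" for A
    using rho[of A 0] by simp
  have Vy: "camV (y t) $ k = (\<rho> + t * (- \<rho> * u$3)) * ((R *v st_v s) $ k + t * (R *v st_v ds) $ k)" for t k
    unfolding camV_def Ry by (simp add: y ds(3) \<rho>_def matrix_vector_right_distrib matrix_vector_mult_scaleR)
  have Gy: "camG (y t) $ k = (\<rho> + t * (- \<rho> * u$3)) * ((R *v st_g s) $ k + t * (R *v st_g ds) $ k)" for t k
    unfolding camG_def Ry by (simp add: y ds(3) \<rho>_def matrix_vector_right_distrib matrix_vector_mult_scaleR)
  have Ly: "camL (y t) $ i $ j = (\<rho> + t * (- \<rho> * u$3)) * (R ** lower_tri_matrix (st_Ma s)) $ i $ j" for t i j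
    unfolding camL_def Ry by (simp add: y ds(3,10) \<rho>_def)
  have Dy: "camD (y t) $ i = (\<rho> + t * (- \<rho> * u$3)) * (- (R ** lower_tri_matrix (st_Ma s)) *v st_ba s) $ i" for t i
    unfolding camD_def camL_def Ry by (simp add: y ds(3,7,10) \<rho>_def scaleR_matrix_vector_assoc[symmetric] neg)
  \<comment> \<open>The body-frame acceleration is rotated into the camera frame; scaled by
    \<open>\<rho>\<close>, \<open>acc\<close> splits into the input part \<open>camL x *v a\<close>
    and the bias part \<open>camD x\<close>.\<close>
  have Rv: "\<rho> * (R *v st_v ds) $ k = (cross3 (camV x) \<Omega> + camL x *v a + camD x + camG x) $ k" for k
  proof -
    have "R *v st_v ds = cross3 (R *v st_v s) \<Omega> + R *v acc + R *v st_g s"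
      unfolding ds \<Omega>[symmetric] cross_rotation_matrix[OF rot] matrix_vector_right_distrib ..
    moreover have "\<rho> *\<^sub>R (R *v acc) = camL x *v a + camD x"
    proof -
      have "camL x *v b = \<rho> *\<^sub>R (R *v (lower_tri_matrix (st_Ma s) *v b))" for b
        unfolding L matrix_vector_mul_assoc scaleR_matrix_vector_assoc ..
      then show ?thesis
        unfolding camD_def s_def[symmetric] acc_def
        by (simp add: matrix_vector_mult_diff_distrib scaleR_right_diff_distrib)
    qed
    ultimately have "\<rho> *\<^sub>R (R *v st_v ds) = cross3 (camV x) \<Omega> + camL x *v a + camD x + camG x"
      unfolding V G by (simp add: scaleR_right_distrib cross_mult_left)
    from arg_cong[OF this, of "\<lambda>w. w $ k"] show ?thesis by simp
  qed
  have Rg: "\<rho> * (R *v st_g ds) $ k = cross3 (camG x) \<Omega> $ k" for k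
  proof -
    have "\<rho> *\<^sub>R (R *v st_g ds) = cross3 (camG x) \<Omega>"
      unfolding ds G \<Omega>[symmetric] cross_mult_left cross_rotation_matrix[OF rot] ..
    from arg_cong[OF this, of "\<lambda>w. w $ k"] show ?thesis by simp
  qed
  have dV: "((\<lambda>t. camV (y t) $ k) has_real_derivative
      (cross3 (camV x) \<Omega> + camL x *v a + camD x + camG x) $ k - u$3 * camV x $ k) (at 0)" for k
    using rho[of "(R *v st_v s) $ k" "(R *v st_v ds) $ k"] unfolding Vy Rv by (simp add: V)
  have dG: "((\<lambda>t. camG (y t) $ k) has_real_derivative cross3 (camG x) \<Omega> $ k - u$3 * camG x $ k) (at 0)" for k
    using rho[of "(R *v st_g s) $ k" "(R *v st_g ds) $ k"] unfolding Gy Rg by (simp add: G)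
  have dL: "((\<lambda>t. camL (y t) $ i $ j) has_real_derivative - u$3 * camL x $ i $ j) (at 0)" for i j
    unfolding Ly L by (rule DERIV_cong[OF rho0]) simp
  have dD: "((\<lambda>t. camD (y t) $ i) has_real_derivative - u$3 * camD x $ i) (at 0)" for i
    unfolding Dy
    by (rule DERIV_cong[OF rho0]) (simp add: camD_def L scaleR_matrix_vector_assoc[symmetric] neg s_def)
  have dgam: "((\<lambda>t. st_gamma (fst (y t)) $ 1) has_real_derivative u$1 - u$3 * st_gamma s $ 1) (at 0)"
    "((\<lambda>t. st_gamma (fst (y t)) $ 2) has_real_derivative u$2 - u$3 * st_gamma s $ 2) (at 0)"
    unfolding y by (auto simp: ds mult.commute intro!: derivative_eq_intros)
  have dp: "((\<lambda>t. st_rho (fst (y t)) * st_p (fst (y t)) $ k) has_real_derivative - u$3 * (\<rho> * st_p s $ k)) (at 0)" for k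
    using rho0[of "st_p s $ k"] by (simp add: y ds \<rho>_def)
  have cam: "snd (y t) = snd x" for t by (simp add: y)
  have "list_all2 (\<lambda>\<phi> d. ((\<lambda>t. \<phi> (y t)) has_real_derivative d) (at 0)) atoms (atom_rates a \<omega> x)"
    unfolding atoms_def atom_rates_def Let_def \<Omega>_def[symmetric] u_def[symmetric] s_def[symmetric] \<rho>_def[symmetric]
    by (simp add: numeral_eq_Suc
       Wy Ky cy cam dV[simplified] dG dL[simplified] dD[simplified] dgam dp[simplified])
  then have "((\<lambda>t. (atoms ! i) (x + t *\<^sub>R full_dynamics a \<omega> x)) has_real_derivative atom_rates a \<omega> x ! i) (at 0)"
    using i length_atoms unfolding list_all2_conv_all_nth y_def by simp
  then show ?thesis
    by (rule full.grad_direction[OF rational_atoms[OF i] x])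
qed


definition cam_field :: "nat \<Rightarrow> full_state \<Rightarrow> full_state" where
  "cam_field b = [drift_field full_dynamics, input_field1 full_dynamics 1, input_field1 full_dynamics 2,
     input_field1 full_dynamics 3, input_field2 full_dynamics 1, input_field2 full_dynamics 2,
     input_field2 full_dynamics 3] ! b"

lemma cam_field_in_system_fields: "b < 7 \<Longrightarrow> cam_field b \<in> system_fields full_dynamics"
  by (auto simp: cam_field_def system_fields_def less_Suc_eq numeral_eq_Suc)

text \<open>The rates are affine in the inputs, through \<open>\<Omega>\<close> and
  \<open>camL x *v a\<close>, so subtracting those at zero input leaves the contribution of one
  column of \<open>K\<close> and \<open>\<Lambda>\<close>, or of one column of
  \<open>W\<close>.\<close>

lemma atom_rates_cam_fields:
  defines "val x \<equiv> map (peval (\<lambda>i. (atoms ! i) x))"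
  shows "atom_rates 0 0 x = val x (cam_fields 0)"
    "map2 (-) (atom_rates (axis 1 1) 0 x) (atom_rates 0 0 x) = val x (cam_fields 1)"
    "map2 (-) (atom_rates (axis 2 1) 0 x) (atom_rates 0 0 x) = val x (cam_fields 2)"
    "map2 (-) (atom_rates (axis 3 1) 0 x) (atom_rates 0 0 x) = val x (cam_fields 3)"
    "map2 (-) (atom_rates 0 (axis 1 1) x) (atom_rates 0 0 x) = val x (cam_fields 4)"
    "map2 (-) (atom_rates 0 (axis 2 1) x) (atom_rates 0 0 x) = val x (cam_fields 5)"
    "map2 (-) (atom_rates 0 (axis 3 1) x) (atom_rates 0 0 x) = val x (cam_fields 6)"
  unfolding val_def atom_rates_def cam_fields_def cam_flow_def cam_rate_def
  by (simp_all add: Let_def atoms_nth atoms_nth(3,4)[unfolded numeral_2_eq_2 numeral_3_eq_3] cross3_def matrix_vector_mult_def sum_3 axis_def vector_3 algebra_simps)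


lemma lie_derivative_atoms:
  assumes b: "b < 7" and i: "i < 52" and x: "full_denominator x \<noteq> 0"
  shows "lie_derivative (cam_field b) (atoms ! i) x = peval (\<lambda>i. (atoms ! i) x) (cam_fields b ! i)"
proof -
  have len: "length (atom_rates a \<omega> x) = 52" for a \<omega>
    by (simp add: atom_rates_def Let_def)
  have len': "length (cam_fields c) = 52" for c
    using length_cam_fields[of c] by (simp add: base_point_def)
  have val: "map (peval (\<lambda>i. (atoms ! i) x)) (cam_fields b) ! i = peval (\<lambda>i. (atoms ! i) x) (cam_fields b ! i)"
    using i len' by simp
  note grad = atom_rates[OF x i]
  have sub: "grad (atoms ! i) x \<bullet> (full_dynamics a \<omega> x - full_dynamics 0 0 x) =
      map2 (-) (atom_rates a \<omega> x) (atom_rates 0 0 x) ! i" for a \<omega>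
    using i len by (simp add: inner_diff_right grad)
  show ?thesis
  proof (cases "b = 0")
    case True
    then show ?thesis
      unfolding lie_derivative_def val[symmetric]
      by (simp add: cam_field_def drift_field_def grad atom_rates_cam_fields(1) del: full_dynamics.simps)
  next
    case False
    with b have "b \<in> {1, 2, 3, 4, 5, 6}" by auto
    then show ?thesis
      unfolding lie_derivative_def val[symmetric]
      by (auto simp: cam_field_def input_field1_def input_field2_def sub atom_rates_cam_fields(2-)
          simp del: full_dynamics.simps)
  qed
qed

section \<open>The base state and the differentials of the functions there\<close>

lemma vector_4:
  "(vector [a, b, c, d] :: 'a::zero^4) $ 1 = a" "(vector [a, b, c, d] :: 'a::zero^4) $ 2 = b"
  "(vector [a, b, c, d] :: 'a::zero^4) $ 3 = c" "(vector [a, b, c, d] :: 'a::zero^4) $ 4 = d"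
  unfolding vector_def by simp_all

lemma mat_1_nth: "(mat 1 :: real^'n^'n) $ i $ j = (if i = j then 1 else 0)"
  by (simp add: mat_def)

text \<open>A preimage of \<open>base_point\<close>. With the identity quaternion and
  \<open>\<rho> = 1\<close>, passing to the camera frame changes no values, so the remaining entries
  can be read off from it.\<close>

definition base_state :: full_state where
  "base_state = ((vector [- 1, 0], 1, vector [- 1, 0, 0], vector [0, 1, 0], 0, 0, mat 1, 0,
     (1, 0, 1, 0, 0, 1), vector [0, 0, 1], vector [1, 0, 0, 0]), (1, 1, 0, 0, 0, 0, 1, 0))"

lemma base_denominator: "full_denominator base_state \<noteq> 0"
  by (simp add: base_state_def full_denominator_def imu_denominator_def vector_4)

lemma quat_rotation_base: "quat_rotation (vector [1, 0, 0, 0]) = mat 1"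
  by (simp add: quat_rotation_def vector_4 vec_eq_iff forall_3 mat_def)

lemma lower_tri_base: "lower_tri_matrix (1, 0, 1, 0, 0, 1) = mat 1"
  by (simp add: vec_eq_iff forall_3 mat_def)

lemma atoms_base_state: "i < 52 \<Longrightarrow> (atoms ! i) base_state = of_int (base_point ! i)"
proof -
  have "map (\<lambda>\<phi>. \<phi> base_state) atoms = map of_int base_point"
    by (simp add: atoms_def base_point_def base_state_def camR_def camW_def camK_def camc_def camV_def
        camL_def camD_def camG_def quat_rotation_base lower_tri_base vector_3 vector_2 mat_1_nth
        del: lower_tri_matrix.simps)
  then show "i < 52 \<Longrightarrow> (atoms ! i) base_state = of_int (base_point ! i)"
    by (metis (no_types, lifting) length_atoms length_map nth_map)
qed


lemma DERIV_matrix_matrix_mult: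
  fixes A B :: "real \<Rightarrow> real^3^3"
  assumes "\<And>i j. ((\<lambda>t. A t $ i $ j) has_real_derivative A' $ i $ j) (at 0)"
    and "\<And>i j. ((\<lambda>t. B t $ i $ j) has_real_derivative B' $ i $ j) (at 0)"
  shows "((\<lambda>t. (A t ** B t) $ i $ j) has_real_derivative (A' ** B 0 + A 0 ** B') $ i $ j) (at 0)"
  unfolding matrix_matrix_mult_def using assms
  by (auto simp: sum_3 intro!: derivative_eq_intros)

lemma DERIV_matrix_vector_mult:
  fixes A :: "real \<Rightarrow> real^3^3" and v :: "real \<Rightarrow> real^3"
  assumes "\<And>i j. ((\<lambda>t. A t $ i $ j) has_real_derivative A' $ i $ j) (at 0)"
    and "\<And>i. ((\<lambda>t. v t $ i) has_real_derivative v' $ i) (at 0)"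
  shows "((\<lambda>t. (A t *v v t) $ i) has_real_derivative (A' *v v 0 + A 0 *v v') $ i) (at 0)"
  unfolding matrix_vector_mult_def using assms
  by (auto simp: sum_3 intro!: derivative_eq_intros)

text \<open>At the identity the derivative is the skew matrix of twice the vector part of
  \<open>q\<close>, an infinitesimal rotation. The scalar part does not appear because of the
  normalization.\<close>

lemma DERIV_quat_rotation_base:
  "((\<lambda>t. quat_rotation (vector [1, 0, 0, 0] + t *\<^sub>R q) $ i $ j) has_real_derivative
    (vector [vector [0, - 2 * q$4, 2 * q$3], vector [2 * q$4, 0, - 2 * q$2],
      vector [- 2 * q$3, 2 * q$2, 0]] :: real^3^3) $ i $ j) (at 0)"
proof -
  have "\<forall>i j. ((\<lambda>t. quat_rotation (vector [1, 0, 0, 0] + t *\<^sub>R q) $ i $ j) has_real_derivative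
    (vector [vector [0, - 2 * q$4, 2 * q$3], vector [2 * q$4, 0, - 2 * q$2],
      vector [- 2 * q$3, 2 * q$2, 0]] :: real^3^3) $ i $ j) (at 0)"
    unfolding forall_3 quat_rotation_def Let_def
    by (auto simp: vector_3 vector_4 intro!: derivative_eq_intros)
  then show ?thesis by blast
qed

lemma lower_tri_add_scaleR:
  "lower_tri_matrix (m + t *\<^sub>R n) = lower_tri_matrix m + t *\<^sub>R lower_tri_matrix n"
  by (cases m; cases n) (simp add: vec_eq_iff forall_3)

text \<open>At \<open>base_state\<close> the upper triangle of \<open>camL\<close> detects the rotation, and then \<open>camG\<close> together with
  the norm of gravity detects the scale \<open>\<rho>\<close>.\<close>

lemma base_state_immersion:
  assumes at: "\<And>i. i < 52 \<Longrightarrow> grad (atoms ! i) base_state \<bullet> \<xi> = 0"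
    and grav: "grad (\<lambda>x. gravity_sq (fst x)) base_state \<bullet> \<xi> = 0"
    and quat: "grad (\<lambda>x. quat_norm_sq (fst x)) base_state \<bullet> \<xi> = 0"
  shows "\<xi> = 0"
proof -
  obtain g r v gr bg ba Mg Ts m1 m2 m3 m4 m5 m6 p q c1 c2 c3 c4 c5 c6 c7 c8
    where \<xi>: "\<xi> = ((g, r, v, gr, bg, ba, Mg, Ts, (m1, m2, m3, m4, m5, m6), p, q), (c1, c2, c3, c4, c5, c6, c7, c8))"
    by (metis prod.collapse)
  define y where "y t = base_state + t *\<^sub>R \<xi>" for t
  define D :: "real^3^3" where "D = vector [vector [0, - 2 * q$4, 2 * q$3], vector [2 * q$4, 0, - 2 * q$2],
      vector [- 2 * q$3, 2 * q$2, 0]]"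
  let ?der = "\<lambda>f d. (f has_real_derivative d) (at 0)"
  have lin: "?der (\<lambda>t. (a + t *\<^sub>R b) $ i) (b $ i)" "?der (\<lambda>t. (t *\<^sub>R b) $ i) (b $ i)"
    for a b :: "real^'n" and i
    by (auto intro!: derivative_eq_intros)
  have lin2: "?der (\<lambda>t. (a + t *\<^sub>R b) $ i $ j) (b $ i $ j)" "?der (\<lambda>t. (t *\<^sub>R b) $ i $ j) (b $ i $ j)"
    for a b :: "real^3^3" and i j
    by (auto intro!: derivative_eq_intros)
  have y0: "y 0 = base_state" by (simp add: y_def)
  have R0: "camR (y 0) = mat 1"
    by (simp add: y0 camR_def base_state_def quat_rotation_base)
  have R: "?der (\<lambda>t. camR (y t) $ i $ j) (D $ i $ j)" for i j
    using DERIV_quat_rotation_base[of q i j] by (simp add: camR_def y_def base_state_def \<xi> D_def)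
  have W0: "camW (y 0) = mat 1" by (simp add: camW_def R0) (simp add: y0 base_state_def)
  have W: "?der (\<lambda>t. camW (y t) $ i $ j) ((D + Mg) $ i $ j)" for i j
    using DERIV_matrix_matrix_mult[OF R lin2(1)[of "mat 1" Mg], of i j]
    by (simp add: R0) (simp add: camW_def y_def base_state_def \<xi>)
  have K0: "camK (y 0) = 0" by (simp add: camK_def y0 base_state_def)
  have K: "?der (\<lambda>t. camK (y t) $ i $ j) (- Ts $ i $ j)" for i j
  proof -
    have "?der (\<lambda>t. ((mat 1 + t *\<^sub>R Mg) ** (t *\<^sub>R Ts)) $ i $ j) (Ts $ i $ j)" for i j
      using DERIV_matrix_matrix_mult[OF lin2(1)[of "mat 1" Mg] lin2(2)[of Ts], of i j] by simp
    from DERIV_minus[OF DERIV_matrix_matrix_mult[OF R this, of i j]]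
    show ?thesis by (simp add: R0) (simp add: camK_def y_def base_state_def \<xi>)
  qed
  have c: "?der (\<lambda>t. camc (y t) $ i) (- bg $ i)" for i
    using DERIV_diff[OF DERIV_minus[OF DERIV_matrix_vector_mult[OF W lin(2)[of bg], of i]]
        DERIV_matrix_vector_mult[OF K[folded vector_uminus_component] lin(2)[of ba], of i]]
    by (simp add: W0 K0) (simp add: camc_def y_def base_state_def \<xi>)
  have V: "?der (\<lambda>t. camV (y t) $ i) ((r *\<^sub>R vector [- 1, 0, 0] + (D *v vector [- 1, 0, 0] + v)) $ i)" for i
  proof -
    have "?der (\<lambda>t. (1 + t * r) * (camR (y t) *v (vector [- 1, 0, 0] + t *\<^sub>R v)) $ i)
      (r * (vector [- 1, 0, 0] :: real^3) $ i + (D *v vector [- 1, 0, 0] + v) $ i)"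
      by (rule DERIV_cong[OF DERIV_mult[OF _ DERIV_matrix_vector_mult[OF R lin(1)]]])
        (auto simp: R0 intro!: derivative_eq_intros)
    then show ?thesis by (simp add: camV_def) (simp add: y_def base_state_def \<xi>)
  qed
  have G: "?der (\<lambda>t. camG (y t) $ i) ((r *\<^sub>R vector [0, 1, 0] + (D *v vector [0, 1, 0] + gr)) $ i)" for i
  proof -
    have "?der (\<lambda>t. (1 + t * r) * (camR (y t) *v (vector [0, 1, 0] + t *\<^sub>R gr)) $ i)
      (r * (vector [0, 1, 0] :: real^3) $ i + (D *v vector [0, 1, 0] + gr) $ i)"
      by (rule DERIV_cong[OF DERIV_mult[OF _ DERIV_matrix_vector_mult[OF R lin(1)]]])
        (auto simp: R0 intro!: derivative_eq_intros)
    then show ?thesis by (simp add: camG_def) (simp add: y_def base_state_def \<xi>)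
  qed
  let ?Lam = "r *\<^sub>R mat 1 + (D + lower_tri_matrix (m1, m2, m3, m4, m5, m6))"
  have L0: "camL (y 0) = mat 1"
    by (simp add: camL_def R0) (simp add: y0 base_state_def lower_tri_base del: lower_tri_matrix.simps)
  have L: "?der (\<lambda>t. camL (y t) $ i $ j) (?Lam $ i $ j)" for i j
  proof -
    have "?der (\<lambda>t. (1 + t * r) * (camR (y t) ** (mat 1 + t *\<^sub>R lower_tri_matrix (m1, m2, m3, m4, m5, m6))) $ i $ j)
      (?Lam $ i $ j)"
      by (rule DERIV_cong[OF DERIV_mult[OF _ DERIV_matrix_matrix_mult[OF R lin2(1)]]])
        (auto simp: R0 simp del: lower_tri_matrix.simps intro!: derivative_eq_intros)
    moreover have "lower_tri_matrix (st_Ma (fst (y t))) = mat 1 + t *\<^sub>R lower_tri_matrix (m1, m2, m3, m4, m5, m6)" for t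
      unfolding lower_tri_base[symmetric] lower_tri_add_scaleR[symmetric] by (simp add: y_def base_state_def \<xi>)
    moreover have "st_rho (fst (y t)) = 1 + t * r" for t by (simp add: y_def base_state_def \<xi>)
    ultimately show ?thesis by (simp add: camL_def del: lower_tri_matrix.simps)
  qed
  have Dd: "?der (\<lambda>t. camD (y t) $ i) (- ba $ i)" for i
    using DERIV_minus[OF DERIV_matrix_vector_mult[OF L lin(2)[of ba], of i]]
    by (simp add: L0 del: lower_tri_matrix.simps) (simp add: camD_def y_def base_state_def \<xi>)
  have zero: "d = 0" if "i < 52" "?der (\<lambda>t. (atoms ! i) (y t)) d" for i d
    using full.grad_direction[OF rational_atoms[OF that(1)] base_denominator that(2)[unfolded y_def]]
      at[OF that(1)] by simp
  have lin3: "?der (\<lambda>t. t * d - 1) d" "?der (\<lambda>t. t * d) d" "?der (\<lambda>t. 1 + t * d) d" for d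
    by (auto intro!: derivative_eq_intros)
  have gam: "g = 0"
    using zero[of 0 "g $ 1"] zero[of "Suc 0" "g $ 2"] lin3
    by (simp add: atoms_nth y_def base_state_def \<xi> vec_eq_iff forall_2)
  have intr: "c1 = 0" "c2 = 0" "c3 = 0" "c4 = 0" "c5 = 0" "c6 = 0" "c7 = 0" "c8 = 0"
    using zero[of 44 c1] zero[of 45 c2] zero[of 46 c3] zero[of 47 c4] zero[of 48 c5] zero[of 49 c6] zero[of 50 c7] zero[of 51 c8] lin3
    by (simp_all add: atoms_nth y_def base_state_def \<xi>)
  \<comment> \<open>This differential is \<open>r\<close> times the identity plus the skew
    \<open>D\<close> plus a lower triangular matrix, so above the diagonal only \<open>D\<close>
    contributes; its vanishing leaves the diagonal to tie \<open>m1\<close>, \<open>m3\<close> and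
    \<open>m6\<close> to \<open>- r\<close>.\<close>
  have Lz: "\<forall>i j. ?Lam $ i $ j = 0"
    unfolding forall_3 using zero[of 29, unfolded atoms_nth, OF _ L] zero[of 30, unfolded atoms_nth, OF _ L] zero[of 31, unfolded atoms_nth, OF _ L] zero[of 32, unfolded atoms_nth, OF _ L] zero[of 33, unfolded atoms_nth, OF _ L] zero[of 34, unfolded atoms_nth, OF _ L] zero[of 35, unfolded atoms_nth, OF _ L] zero[of 36, unfolded atoms_nth, OF _ L] zero[of 37, unfolded atoms_nth, OF _ L]
    by (simp del: lower_tri_matrix.simps)
  then have q: "q$2 = 0" "q$3 = 0" "q$4 = 0" and m: "m1 = - r" "m3 = - r" "m6 = - r"
    unfolding forall_3 by (simp_all add: D_def mat_1_nth vector_3)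
  then have D0: "D = 0" unfolding D_def by (simp add: vec_eq_iff forall_3)
  have m': "m2 = 0" "m4 = 0" "m5 = 0"
    using Lz unfolding forall_3 by (simp_all add: D0 mat_1_nth vector_3)
  have gz: "gr $ 1 = 0" "r + gr $ 2 = 0" "gr $ 3 = 0"
    using zero[of 41, unfolded atoms_nth, OF _ G] zero[of 42, unfolded atoms_nth, OF _ G] zero[of 43, unfolded atoms_nth, OF _ G]
    by (simp_all add: D0 vector_3)
  \<comment> \<open>Gravity at the base state is the second unit vector, so its squared norm sees
    exactly \<open>gr $ 2\<close>; together with \<open>r + gr $ 2 = 0\<close> this removes the
    scale.\<close>
  have "?der (\<lambda>t. gravity_sq (fst (base_state + t *\<^sub>R \<xi>))) (2 * gr $ 2)"
    by (auto simp: base_state_def \<xi> inner_vec_def sum_3 vector_3 intro!: derivative_eq_intros)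
  then have "gr $ 2 = 0"
    using full.grad_direction[OF rational_on_fst[OF rational_gravity_quat(1)] base_denominator] grav by fastforce
  with gz m have r: "r = 0" and gr: "gr = 0" by (simp_all add: vec_eq_iff forall_3)
  \<comment> \<open>The one direction of \<open>q\<close> that the normalized rotation cannot see is
    caught by the squared norm.\<close>
  have "?der (\<lambda>t. quat_norm_sq (fst (base_state + t *\<^sub>R \<xi>))) (2 * q $ 1)"
    by (auto simp: base_state_def \<xi> inner_vec_def sum_4 vector_4 intro!: derivative_eq_intros)
  then have "q $ 1 = 0"
    using full.grad_direction[OF rational_on_fst[OF rational_gravity_quat(2)] base_denominator] quat by fastforce
  with q have q0: "q = 0" by (simp add: vec_eq_iff forall_4)
  have "\<forall>i j. (D + Mg) $ i $ j = 0" "\<forall>i j. - Ts $ i $ j = 0"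
    unfolding forall_3 using zero[of 5, unfolded atoms_nth, OF _ W] zero[of 6, unfolded atoms_nth, OF _ W] zero[of 7, unfolded atoms_nth, OF _ W] zero[of 8, unfolded atoms_nth, OF _ W] zero[of 9, unfolded atoms_nth, OF _ W] zero[of 10, unfolded atoms_nth, OF _ W] zero[of 11, unfolded atoms_nth, OF _ W] zero[of 12, unfolded atoms_nth, OF _ W] zero[of 13, unfolded atoms_nth, OF _ W]
      zero[of 14, unfolded atoms_nth, OF _ K] zero[of 15, unfolded atoms_nth, OF _ K] zero[of 16, unfolded atoms_nth, OF _ K] zero[of 17, unfolded atoms_nth, OF _ K] zero[of 18, unfolded atoms_nth, OF _ K] zero[of 19, unfolded atoms_nth, OF _ K] zero[of 20, unfolded atoms_nth, OF _ K] zero[of 21, unfolded atoms_nth, OF _ K] zero[of 22, unfolded atoms_nth, OF _ K]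
    by simp_all
  then have Mg: "Mg = 0" "Ts = 0" by (simp_all add: D0 vec_eq_iff)
  have bias: "bg = 0" "ba = 0"
    using zero[of 23, unfolded atoms_nth, OF _ c] zero[of 24, unfolded atoms_nth, OF _ c] zero[of 25, unfolded atoms_nth, OF _ c] zero[of 38, unfolded atoms_nth, OF _ Dd] zero[of 39, unfolded atoms_nth, OF _ Dd] zero[of 40, unfolded atoms_nth, OF _ Dd]
    by (simp_all add: vec_eq_iff forall_3)
  have v: "v = 0"
    using zero[of 26, unfolded atoms_nth, OF _ V] zero[of 27, unfolded atoms_nth, OF _ V] zero[of 28, unfolded atoms_nth, OF _ V]
    by (simp add: vec_eq_iff forall_3 D0 r)
  have dp: "?der (\<lambda>t. st_rho (fst (y t)) * st_p (fst (y t)) $ i) (p $ i)" for i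
    by (auto simp: y_def base_state_def \<xi> r intro!: derivative_eq_intros)
  have p: "p = 0"
    using zero[of 2, unfolded atoms_nth, OF _ dp] zero[of 3, unfolded atoms_nth, OF _ dp] zero[of 4, unfolded atoms_nth, OF _ dp]
    by (simp add: vec_eq_iff forall_3)
  show ?thesis
    unfolding \<xi> by (simp add: gam intr r gr q0 Mg bias v p m m' zero_prod_def)
qed

text \<open>In coordinates the gradients are rational, so a trivial kernel at one point persists
  generically; by duality it means that the codistribution is everything.\<close>

lemma (in rational_system) generically_at_full_rank:
  assumes x0: "N x0 \<noteq> 0"
    and ker: "\<And>\<xi>. (\<And>\<phi> j. j \<le> k \<Longrightarrow> \<phi> \<in> lie_derivatives (system_fields F) H j \<Longrightarrow> grad \<phi> x0 \<bullet> \<xi> = 0) \<Longrightarrow> \<xi> = 0"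
  shows "generically_at x0 (\<lambda>x. N x \<noteq> 0 \<and> codistribution (system_fields F) H k x = UNIV)"
proof -
  define I where "I = {\<phi>. \<exists>j\<le>k. \<phi> \<in> lie_derivatives (system_fields F) H j}"
  have comb: "(\<Sum>b\<in>Basis. (v \<bullet> b) * \<xi> b) = v \<bullet> (\<Sum>b\<in>Basis. \<xi> b *\<^sub>R b)" for v :: 'a and \<xi>
    by (simp add: inner_sum_right mult.commute)
  have rep: "(\<Sum>b\<in>Basis. (w \<bullet> b) *\<^sub>R b) = w" for w :: 'a
    by (rule euclidean_representation)
  have "generically_at x0 (\<lambda>x. N x \<noteq> 0 \<and>
    (\<forall>\<xi>. (\<forall>\<phi>\<in>I. (\<Sum>b\<in>Basis. (grad \<phi> x \<bullet> b) * \<xi> b) = 0) \<longrightarrow> (\<forall>b\<in>Basis. \<xi> b = 0)))"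
  proof (rule generically_at_trivial_kernel[OF finite_Basis x0])
    show "rational_on N (\<lambda>x. grad \<phi> x \<bullet> b)" if "\<phi> \<in> I" "b \<in> Basis" for \<phi> b
      using that rational_words rational_on_gradient(2) unfolding I_def rational_field_def by blast
    fix \<xi> :: "'a \<Rightarrow> real"
    assume *: "\<forall>\<phi>\<in>I. (\<Sum>b\<in>Basis. (grad \<phi> x0 \<bullet> b) * \<xi> b) = 0"
    have "(\<Sum>b\<in>Basis. \<xi> b *\<^sub>R b) = 0"
      by (rule ker) (use * in \<open>auto simp: comb I_def\<close>)
    then show "\<forall>b\<in>Basis. \<xi> b = 0"
      using inner_sum_left_Basis[of _ \<xi>] by (metis inner_zero_left)
  qed
  then show ?thesis
  proof (rule generically_at_mono)
    fix x
    assume x: "N x \<noteq> 0 \<and> (\<forall>\<xi>. (\<forall>\<phi>\<in>I. (\<Sum>b\<in>Basis. (grad \<phi> x \<bullet> b) * \<xi> b) = 0) \<longrightarrow> (\<forall>b\<in>Basis. \<xi> b = 0))"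
    have "v \<in> codistribution (system_fields F) H k x" for v
    proof (rule in_codistributionI)
      fix w assume w: "\<And>\<phi> j. j \<le> k \<Longrightarrow> \<phi> \<in> lie_derivatives (system_fields F) H j \<Longrightarrow> grad \<phi> x \<bullet> w = 0"
      have "\<forall>\<phi>\<in>I. (\<Sum>b\<in>Basis. (grad \<phi> x \<bullet> b) * (w \<bullet> b)) = 0"
        unfolding comb rep using w by (auto simp: I_def)
      with x have "\<forall>b\<in>Basis. w \<bullet> b = 0" by blast
      then have "w = 0" by (simp add: euclidean_all_zero_iff)
      then show "v \<bullet> w = 0" by simp
    qed
    with x show "N x \<noteq> 0 \<and> codistribution (system_fields F) H k x = UNIV" by blast
  qed
qed

section \<open>From words in the camera-frame functions to codistributions\<close>

lemma pdir_cong_point: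
  "(\<And>i. i \<in> pvars p \<Longrightarrow> z i = z' i) \<Longrightarrow> peval z p = peval z' p \<and> pdir z \<xi> p = pdir z' \<xi> p"
  by (induction p) auto

lemma cam_output_in_full_outputs:
  assumes "h \<in> set cam_outputs"
  shows "(\<lambda>x. peval (\<lambda>i. (atoms ! i) x) h) \<in> full_outputs"
proof -
  have "set cam_outputs = {cam_outputs ! 0, cam_outputs ! 1}"
    by (simp add: cam_outputs_def Let_def)
  with assms show ?thesis
    unfolding full_outputs_def by (auto simp: image_point_atoms)
qed

lemma cam_outputs_nth: "cam_outputs ! 0 \<in> set cam_outputs" "cam_outputs ! 1 \<in> set cam_outputs"
  by (simp_all add: cam_outputs_def Let_def)

text \<open>A direction annihilated by the codistribution induces rates of the atoms, and these
  rates annihilate every word, since each word represents an actual Lie derivative. Kernel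
  statements about integer rows thereby bear on the state space.\<close>

lemma annihilator_cam_word:
  assumes x: "full_denominator x \<noteq> 0" and w: "set w \<subseteq> {..<7}" "length w \<le> k" and h: "h \<in> set cam_outputs"
    and ann: "\<And>\<phi> j. j \<le> k \<Longrightarrow> \<phi> \<in> lie_derivatives (system_fields full_dynamics) full_outputs j \<Longrightarrow> grad \<phi> x \<bullet> \<xi> = 0"
  shows "pdir (\<lambda>i. (atoms ! i) x) (\<lambda>i. grad (atoms ! i) x \<bullet> \<xi>) (cam_word w h) = 0"
proof -
  have "\<exists>\<phi>\<in>lie_derivatives (system_fields full_dynamics) full_outputs (length w).
      \<forall>x. full_denominator x \<noteq> 0 \<longrightarrow> \<phi> x = peval (\<lambda>i. (atoms ! i) x) (cam_word w h)"
  proof (rule full.pword_in_lie_derivatives[where V = "{..<52}" and f = cam_field])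
    show "pvars (cam_fields a ! i) \<subseteq> {..<52}" if "a \<in> set w" "i \<in> {..<52}" for a i
      using that w(1) by (intro pvars_cam_fields) auto
    show "lie_derivative (cam_field a) (atoms ! i) x = peval (\<lambda>i. (atoms ! i) x) (cam_fields a ! i)"
      if "a \<in> set w" "i \<in> {..<52}" "full_denominator x \<noteq> 0" for a i x
      using that w(1) by (intro lie_derivative_atoms) auto
    show "cam_field a \<in> system_fields full_dynamics" if "a \<in> set w" for a
      using that w(1) by (intro cam_field_in_system_fields) auto
  qed (use rational_atoms pvars_cam_outputs_less[OF h] cam_output_in_full_outputs[OF h] in auto)
  then obtain \<phi> where \<phi>: "\<phi> \<in> lie_derivatives (system_fields full_dynamics) full_outputs (length w)"
    "\<And>x. full_denominator x \<noteq> 0 \<Longrightarrow> \<phi> x = peval (\<lambda>i. (atoms ! i) x) (cam_word w h)" by blast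
  have at: "\<And>i. i \<in> pvars (cam_word w h) \<Longrightarrow> rational_on full_denominator (atoms ! i)"
    using pvars_cam_word[OF w(1) h] rational_atoms by auto
  have "grad (\<lambda>x. peval (\<lambda>i. (atoms ! i) x) (cam_word w h)) x = grad \<phi> x"
    using \<phi>(2) x by (intro full.grad_cong full.rational_on_peval at) auto
  then show ?thesis
    using full.grad_peval[of "cam_word w h" "\<lambda>i. atoms ! i" x \<xi>, OF at x] ann[OF w(2) \<phi>(1)] by simp
qed

lemma length_words2: "w \<in> set words2 \<Longrightarrow> length w \<le> 2 \<and> set w \<subseteq> {..<7}"
  by (auto simp: words2_def)

lemma length_words3: "w \<in> set words3 \<Longrightarrow> length w \<le> 3 \<and> set w \<subseteq> {..<7}"
  by (auto simp: words3_def)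

lemma atoms2_less: "atoms2 \<subseteq> {..<52}"
  by (auto simp: atoms2_def)

lemma pdir_base_state:
  assumes "set w \<subseteq> {..<7}" "h \<in> set cam_outputs"
  shows "pdir (\<lambda>i. (atoms ! i) base_state) \<xi> (cam_word w h) = pdir (\<lambda>i. of_int (base_point ! i)) \<xi> (cam_word w h)"
proof (rule pdir_cong_point[THEN conjunct2])
  fix i assume "i \<in> pvars (cam_word w h)"
  then show "(atoms ! i) base_state = of_int (base_point ! i)"
    using pvars_cam_word[OF assms] by (intro atoms_base_state) auto
qed

text \<open>The system is block triangular: once the rates of \<open>atoms2\<close> vanish, the
  third-order certificate applies to the others. All 52 rates and the two norm differentials
  together vanish only in the zero direction.\<close>

lemma full_kernel_base_state:
  assumes ann: "\<And>\<phi> j. j \<le> 3 \<Longrightarrow> \<phi> \<in> lie_derivatives (system_fields full_dynamics) full_outputs j \<Longrightarrow>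
    grad \<phi> base_state \<bullet> \<xi> = 0"
  shows "\<xi> = 0"
proof -
  let ?\<xi> = "\<lambda>i. grad (atoms ! i) base_state \<bullet> \<xi>"
  have *: "pdir (\<lambda>i. of_int (base_point ! i)) ?\<xi> (cam_word w h) = 0"
    if "set w \<subseteq> {..<7}" "length w \<le> 3" "h \<in> set cam_outputs" for w h
    using annihilator_cam_word[OF base_denominator that ann] pdir_base_state[OF that(1,3)] by simp
  have "\<forall>i\<in>atoms2. ?\<xi> i = 0"
    using * length_words2 by (intro cam_kernel2) force
  then have "\<forall>i<52. ?\<xi> i = 0"
    using * length_words3 by (intro cam_kernel3) blast+
  moreover have "grad (\<lambda>x. gravity_sq (fst x)) base_state \<bullet> \<xi> = 0"
    "grad (\<lambda>x. quat_norm_sq (fst x)) base_state \<bullet> \<xi> = 0"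
    by (rule ann[of 0]; simp add: full_outputs_def)+
  ultimately show ?thesis by (intro base_state_immersion) auto
qed

lemma generically_full_rank3:
  "generically_at base_state (\<lambda>x. full_denominator x \<noteq> 0 \<and>
     codistribution (system_fields full_dynamics) full_outputs 3 x = UNIV)"
  by (rule full.generically_at_full_rank[OF base_denominator full_kernel_base_state])

text \<open>The unknowns are 28 free numbers \<open>\<xi> i\<close>, not rates induced by a
  state-space direction: by \<open>pvars_words2\<close> the words contain no other variables, so the
  linear system has full column rank and keeps it at generic states.\<close>

lemma generically_kernel2:
  "generically_at base_state (\<lambda>x. full_denominator x \<noteq> 0 \<and>
     (\<forall>\<xi>. (\<forall>w\<in>set words2. \<forall>h\<in>set cam_outputs. pdir (\<lambda>i. (atoms ! i) x) \<xi> (cam_word w h) = 0) \<longrightarrow>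
       (\<forall>i\<in>atoms2. \<xi> i = 0)))"
proof -
  let ?I = "set words2 \<times> set cam_outputs"
  let ?M = "\<lambda>p j x. pdir (\<lambda>i. (atoms ! i) x) (\<lambda>i. if i = j then 1 else 0) (cam_word (fst p) (snd p))"
  have fin: "finite atoms2" using atoms2_less finite_subset by blast
  have expand: "(\<Sum>j\<in>atoms2. ?M p j x * \<xi> j) = pdir (\<lambda>i. (atoms ! i) x) \<xi> (cam_word (fst p) (snd p))"
    if "p \<in> ?I" for p x \<xi>
    by (rule pdir_expand[symmetric, OF fin pvars_words2]) (use that in auto)
  have "generically_at base_state (\<lambda>x. full_denominator x \<noteq> 0 \<and>
      (\<forall>\<xi>. (\<forall>p\<in>?I. (\<Sum>j\<in>atoms2. ?M p j x * \<xi> j) = 0) \<longrightarrow> (\<forall>j\<in>atoms2. \<xi> j = 0)))"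
  proof (rule full.generically_at_trivial_kernel[OF fin base_denominator])
    show "rational_on full_denominator (?M p j)" if "p \<in> ?I" "j \<in> atoms2" for p j
    proof (rule full.rational_on_pdir)
      fix i assume "i \<in> pvars (cam_word (fst p) (snd p))"
      moreover have "pvars (cam_word (fst p) (snd p)) \<subseteq> atoms2"
        by (rule pvars_words2) (use that in auto)
      ultimately show "rational_on full_denominator (atoms ! i)"
        using atoms2_less by (intro rational_atoms) auto
    qed
    fix \<xi> assume *: "\<forall>p\<in>?I. (\<Sum>j\<in>atoms2. ?M p j base_state * \<xi> j) = 0"
    show "\<forall>j\<in>atoms2. \<xi> j = 0"
    proof (rule cam_kernel2, intro ballI)
      fix w h assume wh: "w \<in> set words2" "h \<in> set cam_outputs"
      then have "pdir (\<lambda>i. (atoms ! i) base_state) \<xi> (cam_word w h) = 0"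
        using * expand[of "(w, h)" base_state \<xi>] by auto
      then show "pdir (\<lambda>i. of_int (base_point ! i)) \<xi> (cam_word w h) = 0"
        using pdir_base_state[OF _ wh(2)] length_words2[OF wh(1)] by simp
    qed
  qed
  then show ?thesis
    by (rule generically_at_mono) (simp add: expand)
qed

lemma camera_parameters_atoms: "c \<in> camera_parameters \<Longrightarrow> \<exists>i\<in>atoms2. c = atoms ! i"
proof -
  have "\<forall>c\<in>camera_parameters. \<exists>i\<in>{44,45,46,47,48,49,50,51}. c = atoms ! i"
    unfolding camera_parameters_def by (simp add: atoms_nth fun_eq_iff split_beta)
  moreover have "{44,45,46,47,48,49,50,51} \<subseteq> atoms2" by (auto simp: atoms2_def)
  ultimately show "c \<in> camera_parameters \<Longrightarrow> \<exists>i\<in>atoms2. c = atoms ! i" by blast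
qed

text \<open>The camera parameters are themselves members of \<open>atoms2\<close>, so a direction
  annihilated by the second-order codistribution does not change them, and
  \<open>in_codistributionI\<close> applies.\<close>

lemma generically_camera_parameters:
  "generically_at base_state (\<lambda>x. \<forall>c\<in>camera_parameters.
     grad c x \<in> codistribution (system_fields full_dynamics) full_outputs 2 x)"
proof (rule generically_at_mono[OF generically_kernel2], intro ballI)
  fix x c
  assume x: "full_denominator x \<noteq> 0 \<and>
     (\<forall>\<xi>. (\<forall>w\<in>set words2. \<forall>h\<in>set cam_outputs. pdir (\<lambda>i. (atoms ! i) x) \<xi> (cam_word w h) = 0) \<longrightarrow>
       (\<forall>i\<in>atoms2. \<xi> i = 0))"
    and "c \<in> camera_parameters"
  then obtain i where i: "i \<in> atoms2" "c = atoms ! i" using camera_parameters_atoms by blast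
  show "grad c x \<in> codistribution (system_fields full_dynamics) full_outputs 2 x"
  proof (rule in_codistributionI)
    fix \<xi> assume ann: "\<And>\<phi> j. j \<le> 2 \<Longrightarrow> \<phi> \<in> lie_derivatives (system_fields full_dynamics) full_outputs j \<Longrightarrow>
      grad \<phi> x \<bullet> \<xi> = 0"
    have "\<forall>w\<in>set words2. \<forall>h\<in>set cam_outputs.
        pdir (\<lambda>i. (atoms ! i) x) (\<lambda>i. grad (atoms ! i) x \<bullet> \<xi>) (cam_word w h) = 0"
      using x length_words2 by (intro ballI annihilator_cam_word[OF _ _ _ _ ann]) auto
    with x have "\<forall>i\<in>atoms2. grad (atoms ! i) x \<bullet> \<xi> = 0"
      by (elim conjE allE[of _ "\<lambda>i. grad (atoms ! i) x \<bullet> \<xi>"]) blast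
    with i show "grad c x \<bullet> \<xi> = 0" by blast
  qed
qed

text \<open>The Lie derivatives of the full system are polynomials in those of the reduced system and
  the camera parameters, so a direction annihilated by the latter is annihilated by the former.\<close>

inductive lifted :: "nat \<Rightarrow> (full_state \<Rightarrow> real) \<Rightarrow> bool" for k where
  word: "j \<le> k \<Longrightarrow> \<phi> \<in> lie_derivatives (system_fields imu_dynamics) reduced_outputs j \<Longrightarrow>
    lifted k (\<lambda>x. \<phi> (fst x))"
| camera: "bounded_linear c \<Longrightarrow> lifted k (\<lambda>x. c (snd x))"
| const: "lifted k (\<lambda>x. a)"
| add: "lifted k f \<Longrightarrow> lifted k g \<Longrightarrow> lifted k (\<lambda>x. f x + g x)"
| mult: "lifted k f \<Longrightarrow> lifted k g \<Longrightarrow> lifted k (\<lambda>x. f x * g x)"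

lemma lifted_mono: "lifted k f \<Longrightarrow> k \<le> l \<Longrightarrow> lifted l f"
proof (induction rule: lifted.induct)
  case (word j \<phi>)
  then show ?case by (intro lifted.word[of j]) auto
qed (auto intro: lifted.intros)

lemma rational_on_lifted: "lifted k f \<Longrightarrow> rational_on full_denominator f"
proof (induction rule: lifted.induct)
  case (word j \<phi>)
  then show ?case by (intro rational_on_fst imu.rational_words)
next
  case (camera c)
  then show ?case
    by (intro rational_on_linear bounded_linear_compose[OF _ bounded_linear_snd])
qed (auto intro: rational_intros)

lemma grad_fst:
  assumes "rational_on imu_denominator \<phi>" "full_denominator x \<noteq> 0"
  shows "grad (\<lambda>x. \<phi> (fst x)) x = (grad \<phi> (fst x), 0)"
proof (rule grad_eq, rule GDERIV_eqI)
  have "(\<phi> has_derivative (\<lambda>h. h \<bullet> grad \<phi> (fst x))) (at (fst x))"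
    using imu.rational_on_gradient(1)[OF assms(1)] assms(2) by (simp add: gderiv_def full_denominator_def)
  then show "((\<lambda>x. \<phi> (fst x)) has_derivative (\<lambda>h. fst h \<bullet> grad \<phi> (fst x))) (at x)"
    by (rule has_derivative_compose[OF bounded_linear_imp_has_derivative[OF bounded_linear_fst]])
qed (simp add: inner_prod_def)

lemma grad_snd:
  fixes c :: "camera \<Rightarrow> real" and x :: full_state
  assumes "bounded_linear c"
  shows "grad (\<lambda>x. c (snd x)) x \<bullet> (v, 0) = 0"
proof -
  have "GDERIV (\<lambda>x. c (snd x)) x :> (0, adjoint c 1)"
  proof (rule GDERIV_eqI)
    show "((\<lambda>x::full_state. c (snd x)) has_derivative (\<lambda>h. c (snd h))) (at x)"
      by (intro bounded_linear_imp_has_derivative bounded_linear_compose[OF assms bounded_linear_snd])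
    show "c (snd h) = h \<bullet> (0, adjoint c 1)" for h :: full_state
      using adjoint_works[of c "snd h" 1] assms by (simp add: inner_prod_def bounded_linear.linear)
  qed
  then show ?thesis by (simp add: grad_eq inner_prod_def)
qed

lemma lifted_peval:
  "(\<And>i. i \<in> pvars p \<Longrightarrow> lifted k (atoms ! i)) \<Longrightarrow> lifted k (\<lambda>x. peval (\<lambda>i. (atoms ! i) x) p)"
  by (induction p) (auto intro: lifted.intros)

lemma full_system_field:
  assumes "f \<in> system_fields full_dynamics"
  obtains f' where "f' \<in> system_fields imu_dynamics" "f = (\<lambda>x. (f' (fst x), 0))"
proof -
  have "drift_field full_dynamics = (\<lambda>x. (drift_field imu_dynamics (fst x), 0))"
    "input_field1 full_dynamics j = (\<lambda>x. (input_field1 imu_dynamics j (fst x), 0))"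
    "input_field2 full_dynamics j = (\<lambda>x. (input_field2 imu_dynamics j (fst x), 0))" for j
    by (simp_all add: fun_eq_iff drift_field_def input_field1_def input_field2_def full_dynamics_fst
        del: full_dynamics.simps imu_dynamics.simps)
  then show ?thesis
    using assms that unfolding system_fields_def by (auto; blast)
qed

text \<open>The fields have no camera component, so camera functions are constant along them, and a
  lifted word becomes a lifted word of the next order. The Leibniz rule does the rest, with
  \<open>lifted_mono\<close> raising the undifferentiated factors.\<close>

lemma lifted_lie_derivative:
  assumes "lifted k \<psi>" "f \<in> system_fields full_dynamics"
  shows "\<exists>\<theta>. lifted (Suc k) \<theta> \<and> (\<forall>x. full_denominator x \<noteq> 0 \<longrightarrow> lie_derivative f \<psi> x = \<theta> x)"
proof -
  obtain f' where f': "f' \<in> system_fields imu_dynamics" "f = (\<lambda>x. (f' (fst x), 0))"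
    using assms(2) by (rule full_system_field)
  show ?thesis using assms(1)
  proof (induction rule: lifted.induct)
    case (word j \<phi>)
    have "lie_derivative f (\<lambda>x. \<phi> (fst x)) x = lie_derivative f' \<phi> (fst x)" if "full_denominator x \<noteq> 0" for x
      using grad_fst[OF imu.rational_words[OF word(2)] that] by (simp add: lie_derivative_def f'(2) inner_prod_def)
    moreover have "lifted (Suc k) (\<lambda>x. lie_derivative f' \<phi> (fst x))"
      using word f'(1) by (intro lifted.word[of "Suc j"]) auto
    ultimately show ?case by blast
  next
    case (camera c)
    have "lie_derivative f (\<lambda>x. c (snd x)) x = 0" for x
      unfolding lie_derivative_def f'(2) by (rule grad_snd[OF camera])
    then show ?case using lifted.const[of "Suc k" 0] by blast
  next
    case (const a)
    have "lie_derivative f (\<lambda>x. a) x = 0" for x by (simp add: lie_derivative_def full.grad_const)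
    then show ?case using lifted.const[of "Suc k" 0] by blast
  next
    case (add g h)
    then obtain \<theta> \<theta>' where "lifted (Suc k) \<theta>" "lifted (Suc k) \<theta>'"
      "\<forall>x. full_denominator x \<noteq> 0 \<longrightarrow> lie_derivative f g x = \<theta> x"
      "\<forall>x. full_denominator x \<noteq> 0 \<longrightarrow> lie_derivative f h x = \<theta>' x" by blast
    then show ?case
      using add.hyps rational_on_lifted
      by (intro exI[of _ "\<lambda>x. \<theta> x + \<theta>' x"])
        (auto simp: lie_derivative_def full.grad_add inner_add_left intro: lifted.add)
  next
    case (mult g h)
    then obtain \<theta> \<theta>' where "lifted (Suc k) \<theta>" "lifted (Suc k) \<theta>'"
      "\<forall>x. full_denominator x \<noteq> 0 \<longrightarrow> lie_derivative f g x = \<theta> x"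
      "\<forall>x. full_denominator x \<noteq> 0 \<longrightarrow> lie_derivative f h x = \<theta>' x" by blast
    then show ?case
      using mult.hyps rational_on_lifted lifted_mono[of k _ "Suc k"]
      by (intro exI[of _ "\<lambda>x. g x * \<theta>' x + h x * \<theta> x"])
        (auto simp: lie_derivative_def full.grad_mult inner_add_left intro!: lifted.add lifted.mult)
  qed
qed

lemma lifted_words:
  assumes "\<phi> \<in> lie_derivatives (system_fields full_dynamics) full_outputs k"
  shows "\<exists>\<theta>. lifted k \<theta> \<and> (\<forall>x. full_denominator x \<noteq> 0 \<longrightarrow> \<phi> x = \<theta> x)"
  using assms
proof (induction k arbitrary: \<phi>)
  case 0
  have red: "lifted 0 (\<lambda>x. h (fst x))" if "h \<in> reduced_outputs" for h
    using that by (intro lifted.word[of 0]) auto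
  \<comment> \<open>Apart from the landmark direction, an output of the reduced system, the image
    point involves only atoms 44 to 51, which are linear in the camera component.\<close>
  have at: "lifted 0 (atoms ! i)" if "i < 2 \<or> 44 \<le> i \<and> i < 52" for i
  proof -
    have "lifted 0 (atoms ! 0)" "lifted 0 (atoms ! 1)"
      using red[of "\<lambda>s. landmark_direction s $ 1"] red[of "\<lambda>s. landmark_direction s $ 2"]
      by (simp_all add: reduced_outputs_def landmark_direction_fst atoms_def)
    moreover have "lifted 0 (\<lambda>x. (atoms ! i) x)" if "i \<in> {44,45,46,47,48,49,50,51}" for i
      using that
      by (elim insertE emptyE; simp only: atoms_nth)
        (intro lifted.camera bounded_linear_comps bounded_linear_ident)+
    moreover have "i \<in> {0, 1} \<or> i \<in> {44,45,46,47,48,49,50,51}" using that by auto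
    ultimately show ?thesis by auto
  qed
  have "lifted 0 (\<lambda>x. peval (\<lambda>i. (atoms ! i) x) h)" if "h \<in> set cam_outputs" for h
    using pvars_cam_outputs that at by (intro lifted_peval) blast
  then have "lifted 0 (\<lambda>x. image_point x $ 1)" "lifted 0 (\<lambda>x. image_point x $ 2)"
    unfolding image_point_atoms using cam_outputs_nth by blast+
  moreover have "lifted 0 (\<lambda>x. gravity_sq (fst x))" "lifted 0 (\<lambda>x. quat_norm_sq (fst x))"
    by (rule red; simp add: reduced_outputs_def)+
  ultimately show ?case using 0 by (auto simp: full_outputs_def)
next
  case (Suc k)
  then obtain f \<psi> where f: "\<phi> = lie_derivative f \<psi>" "f \<in> system_fields full_dynamics"
    "\<psi> \<in> lie_derivatives (system_fields full_dynamics) full_outputs k" by auto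
  from Suc.IH[OF f(3)] obtain \<theta> where \<theta>: "lifted k \<theta>" "\<And>x. full_denominator x \<noteq> 0 \<Longrightarrow> \<psi> x = \<theta> x"
    by blast
  have "\<phi> x = lie_derivative f \<theta> x" if "full_denominator x \<noteq> 0" for x
    using full.grad_cong[OF full.rational_words[OF f(3)] \<theta>(2) that] by (simp add: f(1) lie_derivative_def)
  with lifted_lie_derivative[OF \<theta>(1) f(2)] show ?case by auto
qed

text \<open>Extending a direction by zero in the camera component kills every generator: the lifted
  words by hypothesis, the camera functions because they do not change. Sums and products follow by
  the Leibniz rule.\<close>

lemma lifted_annihilated:
  assumes "lifted k \<theta>" and x: "full_denominator x \<noteq> 0"
    and ann: "\<And>\<phi> j. j \<le> k \<Longrightarrow> \<phi> \<in> lie_derivatives (system_fields imu_dynamics) reduced_outputs j \<Longrightarrow>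
      grad \<phi> (fst x) \<bullet> \<xi> = 0"
  shows "grad \<theta> x \<bullet> (\<xi>, 0) = 0"
  using assms(1)
proof (induction rule: lifted.induct)
  case (word j \<phi>)
  then show ?case
    using grad_fst[OF imu.rational_words[OF word(2)] x] ann by (simp add: inner_prod_def)
next
  case (camera c)
  then show ?case by (rule grad_snd)
next
  case (add f g)
  then show ?case
    using x rational_on_lifted by (simp add: full.grad_add inner_add_left)
next
  case (mult f g)
  then show ?case
    using x rational_on_lifted by (simp add: full.grad_mult inner_add_left)
qed (simp add: full.grad_const)

lemma reduced_kernel_base_state:
  assumes ann: "\<And>\<phi> j. j \<le> 3 \<Longrightarrow> \<phi> \<in> lie_derivatives (system_fields imu_dynamics) reduced_outputs j \<Longrightarrow>
    grad \<phi> (fst base_state) \<bullet> \<xi> = 0"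
  shows "\<xi> = 0"
proof -
  have "(\<xi>, 0) = (0 :: full_state)"
  proof (rule full_kernel_base_state)
    fix \<phi> j assume j: "j \<le> (3::nat)" "\<phi> \<in> lie_derivatives (system_fields full_dynamics) full_outputs j"
    then obtain \<theta> where \<theta>: "lifted j \<theta>" "\<And>x. full_denominator x \<noteq> 0 \<Longrightarrow> \<phi> x = \<theta> x"
      using lifted_words by blast
    have "grad \<phi> base_state = grad \<theta> base_state"
      by (rule full.grad_cong[OF full.rational_words[OF j(2)] \<theta>(2) base_denominator])
    also have "\<dots> \<bullet> (\<xi>, 0) = 0"
      by (rule lifted_annihilated[OF \<theta>(1) base_denominator]) (use ann j(1) order_trans in blast)
    finally show "grad \<phi> base_state \<bullet> (\<xi>, 0) = 0" .
  qed
  then show ?thesis by (simp add: zero_prod_def)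
qed

lemma component_weakly_observable_if:
  "weakly_observable F H x \<Longrightarrow> component_weakly_observable F H c x"
  unfolding weakly_observable_def component_weakly_observable_def by metis

theorem mainTheorem1:
  shows
    "generically (\<lambda>x. \<forall>c\<in>camera_parameters.
        grad c x \<in> codistribution (system_fields full_dynamics) full_outputs 2 x
        \<and> component_weakly_observable full_dynamics full_outputs c x)
   \<and> DIM(imu_state) = 46
   \<and> generically (\<lambda>x'.
        dim (codistribution (system_fields imu_dynamics) reduced_outputs 3 x') = 46
        \<and> weakly_observable imu_dynamics reduced_outputs x')
   \<and> DIM(full_state) = 54
   \<and> (\<exists>k. generically (\<lambda>x. \<forall>b\<in>Basis.
        grad (\<lambda>y. y \<bullet> b) x \<in> codistribution (system_fields full_dynamics) full_outputs k x
        \<and> component_weakly_observable full_dynamics full_outputs (\<lambda>y. y \<bullet> b) x))"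
proof (intro conjI)
  have full: "weakly_observable full_dynamics full_outputs x"
    if "full_denominator x \<noteq> 0 \<and> codistribution (system_fields full_dynamics) full_outputs 3 x = UNIV" for x
    using that full.full_rank_imp_weakly_observable by blast
  show "generically (\<lambda>x. \<forall>c\<in>camera_parameters.
        grad c x \<in> codistribution (system_fields full_dynamics) full_outputs 2 x
        \<and> component_weakly_observable full_dynamics full_outputs c x)"
    \<comment> \<open>Both generic conditions are anchored at \<open>base_state\<close> and so hold
      together: second-order membership, and third-order full rank, which supplies observability of
      the components.\<close>
    by (rule generically_at_imp_generically[OF generically_at_mono[OF
          generically_at_conj[OF generically_camera_parameters generically_full_rank3]]])
      (use full component_weakly_observable_if in blast)
  show "\<exists>k. generically (\<lambda>x. \<forall>b\<in>Basis.
        grad (\<lambda>y. y \<bullet> b) x \<in> codistribution (system_fields full_dynamics) full_outputs k x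
        \<and> component_weakly_observable full_dynamics full_outputs (\<lambda>y. y \<bullet> b) x)"
    \<comment> \<open>At full rank the codistribution is the whole space, so order 3 serves every
      coordinate.\<close>
    by (rule exI[of _ 3], rule generically_at_imp_generically[OF generically_at_mono[OF generically_full_rank3]])
      (use full component_weakly_observable_if in blast)
  have base: "imu_denominator (fst base_state) \<noteq> 0"
    using base_denominator by (simp add: full_denominator_def)
  show "generically (\<lambda>x'.
        dim (codistribution (system_fields imu_dynamics) reduced_outputs 3 x') = 46
        \<and> weakly_observable imu_dynamics reduced_outputs x')"
  proof (rule generically_at_imp_generically[OF generically_at_mono[OF
          imu.generically_at_full_rank[OF base reduced_kernel_base_state]]])
    fix x' assume x': "imu_denominator x' \<noteq> 0 \<and>
      codistribution (system_fields imu_dynamics) reduced_outputs 3 x' = UNIV"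
    then show "dim (codistribution (system_fields imu_dynamics) reduced_outputs 3 x') = 46 \<and>
        weakly_observable imu_dynamics reduced_outputs x'"
      using imu.full_rank_imp_weakly_observable[of x' 3] by (simp add: dim_UNIV)
  qed
qed (fact DIM_imu_state DIM_full_state)+

end
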